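(* Let $\Delta$ be the Laplacian on $\mathbb{R}^2$. i) For any $1<q<\infty$ and $0<s_0\le 1$ there is $C=C(q,s_0)>0$ such that for every $\tau>0$ $$\big\|(\tau-\Delta)^{-1}f\big\|_{L^q(\mathbb{R}^2)}\le C\,\tau^{-s_0}\|f\|_{L^k(\mathbb{R}^2)},\qquad \frac1k=\frac1q+1-s_0 .$$ ii) For any $1<q<\infty$, $0<s_0\le 1$ and $a>2(1-s_0)$ there is $C=C(q,s_0,a)>0$ such that for every $\tau>0$ $$\big\|(\tau-\Delta)^{-1}\langle x\rangle^{-a}f\big\|_{L^q(\mathbb{R}^2)}\le C\,\tau^{-s_0}\|f\|_{L^q(\mathbb{R}^2)} .$$ iii) For any $1<q<\infty$, $0<s_0\le 1$ and $a>2(1-s_0)$ there is $C=C(q,s_0,a)>0$ such that for every $\tau>0$ $$\big\|\langle x\rangle^{-a}(\tau-\Delta)^{-1}f\big\|_{L^q(\mathbb{R}^2)}\le C\,\tau^{-s_0}\|f\|_{L^q(\mathbb{R}^2)} .$$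
   Context: $\langle x\rangle=(1+|x|^2)^{1/2}$. In ii) and iii), $\langle x\rangle^{-a}$ denotes the multiplication operator. The estimates are for all $f$ for which the right-hand side is finite.
   Formalization: The printed ranges are too large: the formal version adds k ≥ 1 (i.e. s_0 ≥ 1/q) in i), s_0 ≥ 1/q in ii), and s_0 ≥ 1 − 1/q in iii); outside these ranges the stated estimates are false. *)

theory Defs
  imports "HOL-Analysis.Analysis"
begin

type_synonym plane = "real ^ 2"

definition bracket :: "plane \<Rightarrow> real" where
  "bracket x = sqrt (1 + (norm x)\<^sup>2)"

definition bracket_mult :: "real \<Rightarrow> (plane \<Rightarrow> complex) \<Rightarrow> plane \<Rightarrow> complex" where
  "bracket_mult a f = (\<lambda>x. of_real (bracket x powr (-a)) * f x)"

text \<open>Functions, not classes modulo null sets; every class in the usual Lebesgue space has a Borel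
  representative. The definitions are used for exponents at least 1 only.\<close>

definition Lp :: "real \<Rightarrow> (plane \<Rightarrow> complex) set" where
  "Lp p = {f \<in> borel_measurable lborel. integrable lborel (\<lambda>x. norm (f x) powr p)}"

definition Lp_norm :: "real \<Rightarrow> (plane \<Rightarrow> complex) \<Rightarrow> real" where
  "Lp_norm p f = (\<integral>x. norm (f x) powr p \<partial>lborel) powr (1 / p)"

definition partial :: "2 \<Rightarrow> (plane \<Rightarrow> complex) \<Rightarrow> plane \<Rightarrow> complex" where
  "partial i \<phi> = (\<lambda>x. frechet_derivative \<phi> (at x) (axis i 1))"

definition iter_partial :: "2 list \<Rightarrow> (plane \<Rightarrow> complex) \<Rightarrow> plane \<Rightarrow> complex" where
  "iter_partial is \<phi> = foldr partial is \<phi>"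

definition laplacian :: "(plane \<Rightarrow> complex) \<Rightarrow> plane \<Rightarrow> complex" where
  "laplacian \<phi> = (\<lambda>x. \<Sum>i\<in>UNIV. partial i (partial i \<phi>) x)"

text \<open>The Schwartz space. Differentiability of all iterated partial derivatives is smoothness.\<close>

definition schwartz :: "(plane \<Rightarrow> complex) set" where
  "schwartz = {\<phi>. \<forall>is. (\<forall>x. iter_partial is \<phi> differentiable (at x)) \<and>
     (\<forall>N::nat. bounded (range (\<lambda>x. bracket x ^ N *\<^sub>R iter_partial is \<phi> x)))}"

text \<open>Slowly growing functions: those functions \<open>u\<close> for which the integral of \<open>u \<phi>\<close> converges
  absolutely for all Schwartz \<open>\<phi>\<close>, and which so act as tempered distributions. All Lebesgue
  spaces with exponent at least 1 are included.\<close>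

definition slowly_growing :: "(plane \<Rightarrow> complex) set" where
  "slowly_growing = {u \<in> borel_measurable lborel.
     \<exists>N::nat. integrable lborel (\<lambda>x. norm (u x) / bracket x ^ N)}"

text \<open>The equation \<open>\<tau> u - \<Delta> u = f\<close> in the sense of tempered distributions; the
  pairing is bilinear.\<close>

definition solves_resolvent_eq ::
    "real \<Rightarrow> (plane \<Rightarrow> complex) \<Rightarrow> (plane \<Rightarrow> complex) \<Rightarrow> bool" where
  "solves_resolvent_eq \<tau> f u \<longleftrightarrow> f \<in> slowly_growing \<and> u \<in> slowly_growing \<and>
     (\<forall>\<phi>\<in>schwartz. (\<integral>x. u x * (of_real \<tau> * \<phi> x - laplacian \<phi> x) \<partial>lborel)
                  = (\<integral>x. f x * \<phi> x \<partial>lborel))"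

text \<open>\<open>(\<tau> - \<Delta>)\<^sup>-\<^sup>1 f\<close>. For \<open>\<tau> > 0\<close> the operator \<open>\<tau> - \<Delta>\<close> is
  invertible on tempered distributions, so the choice below only picks a representative modulo
  null sets. Nothing at all is known about it when there is no solution: any estimate for it
  therefore presupposes solvability.\<close>

definition resolvent :: "real \<Rightarrow> (plane \<Rightarrow> complex) \<Rightarrow> plane \<Rightarrow> complex" where
  "resolvent \<tau> f = (SOME u. solves_resolvent_eq \<tau> f u)"

end

theory Submission
  imports Defs "HOL-Probability.Distributions"
begin


text \<open>The operator \<open>(\<tau> - \<Delta>)\<^sup>-\<^sup>1\<close> is convolution with
  \<open>G\<^sub>\<tau> = \<integral>\<^sub>0\<^sup>\<infinity> e\<^sup>-\<^sup>\<tau>\<^sup>t h\<^sub>t dt\<close>, the Laplace transform in time of the heat kernel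
  \<open>h\<^sub>t\<close>. In two dimensions \<open>\<parallel>h\<^sub>t\<parallel>\<^sub>r\<close> is a multiple of \<open>t\<close> to the power \<open>1/r - 1\<close>, which is integrable at
  \<open>t = 0\<close> for every finite \<open>r\<close>; with \<open>r = 1/s\<^sub>0\<close> this gives \<open>\<parallel>G\<^sub>\<tau>\<parallel>\<^sub>r \<le> c \<tau>\<close> to the power \<open>- s\<^sub>0\<close>
  (\<open>green_Lr_norm\<close>), and so the whole dependence on \<open>\<tau>\<close>. The unweighted estimate is then Young's inequality.
  In the two weighted estimates the missing integrability \<open>1 - s\<^sub>0\<close> comes from the weight by Hoelder's inequality:
  \<open>\<langle>x\<rangle>\<^sup>-\<^sup>a\<close> lies in \<open>L\<close> with exponent \<open>1/(1 - s\<^sub>0)\<close> exactly because \<open>a > 2 (1 - s\<^sub>0)\<close>. When the weight is applied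
  after the resolvent and \<open>1/q = 1 - s\<^sub>0\<close>, the intermediate space is \<open>L\<^sup>\<infinity>\<close>. To include it, Young's inequality is
  kept in its pointwise form, a bound of \<open>G\<^sub>\<tau> * f\<close> by the power \<open>\<theta>\<close> of an integrable function \<open>j\<close>
  where \<open>\<theta>\<close> may be \<open>0\<close>, and is combined with the weight afterwards (\<open>green_conv_weighted_estimate\<close>).

  As \<open>resolvent\<close> is defined by an arbitrary choice of a distributional solution, these bounds say something
  about it only once solutions are known to exist and to be unique almost everywhere.

  Uniqueness: if \<open>w\<close> is slowly growing and \<open>\<tau> w - \<Delta> w = 0\<close>, test the equation with a Gaussian
  \<open>h\<^sub>t(\<cdot> - y)\<close>. Since \<open>\<Delta> h\<^sub>t = \<partial>\<^sub>t h\<^sub>t\<close>, the heat flow \<open>H(t) = (h\<^sub>t * w)(y)\<close> satisfies \<open>H' = \<tau> H\<close>, so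
  it is a multiple of \<open>e\<^sup>\<tau>\<^sup>t\<close>; but it grows only polynomially in \<open>t\<close>. Hence \<open>H = 0\<close>
  (\<open>heat_flow_eq_0\<close>), and letting \<open>t \<longrightarrow> 0\<close> gives \<open>w = 0\<close>. That Gaussians are admissible test functions is
  \<open>schwartz_heat\<close>.

  Existence: by Fubini, \<open>G\<^sub>\<tau> * f\<close> is a solution for every slowly growing \<open>f\<close> as soon as
  \<open>G\<^sub>\<tau> * (\<tau> \<phi> - \<Delta> \<phi>) = \<phi>\<close> for Schwartz functions \<open>\<phi>\<close>. With \<open>H(t) = (h\<^sub>t * \<phi>)(y)\<close> the left-hand
  side at \<open>y\<close> is \<open>\<integral>\<^sub>0\<^sup>\<infinity> e\<^sup>-\<^sup>\<tau>\<^sup>t (\<tau> H(t) - H'(t)) dt\<close>, the integral of the derivative of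
  \<open>- e\<^sup>-\<^sup>\<tau>\<^sup>t H(t)\<close>, which is \<open>\<phi>(y)\<close> (\<open>integral_exp_heat_flow_test\<close>).\<close>

section \<open>Hoelder's inequality for several functions\<close>

text \<open>Concavity of the logarithm in the form \<open>ln x \<le> ln S + x/S - 1\<close>, the tangent at the arithmetic mean \<open>S\<close>.\<close>

lemma weighted_am_gm3:
  fixes a b c :: real
  assumes "0 \<le> a" "0 \<le> b" "0 \<le> c" "0 \<le> \<alpha>" "0 \<le> \<beta>" "0 \<le> \<gamma>" "\<alpha> + \<beta> + \<gamma> = 1"
  shows "a powr \<alpha> * b powr \<beta> * c powr \<gamma> \<le> \<alpha> * a + \<beta> * b + \<gamma> * c"
proof (cases "a = 0 \<or> b = 0 \<or> c = 0")
  case True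
  then show ?thesis using assms by auto
next
  case False
  define S where "S = \<alpha> * a + \<beta> * b + \<gamma> * c"
  have pos: "a > 0" "b > 0" "c > 0" using False assms by auto
  have Spos: "S > 0"
  proof -
    have "\<alpha> > 0 \<or> \<beta> > 0 \<or> \<gamma> > 0" using assms by linarith
    then show ?thesis
      unfolding S_def using pos assms
      by (smt (verit) mult_nonneg_nonneg mult_pos_pos)
  qed
  have key: "ln x \<le> ln S + x / S - 1" if "x > 0" for x
    using ln_le_minus_one[of "x / S"] that Spos by (simp add: ln_div)
  have "\<alpha> * ln a + \<beta> * ln b + \<gamma> * ln c
      \<le> \<alpha> * (ln S + a / S - 1) + \<beta> * (ln S + b / S - 1) + \<gamma> * (ln S + c / S - 1)"
    using key pos assms by (intro add_mono mult_left_mono) auto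
  also have "\<dots> = (\<alpha> + \<beta> + \<gamma>) * (ln S - 1) + (\<alpha> * a + \<beta> * b + \<gamma> * c) / S"
    by (simp add: algebra_simps add_divide_distrib)
  also have "\<dots> = (\<alpha> + \<beta> + \<gamma>) * (ln S - 1) + S / S"
    by (simp add: S_def)
  also have "\<dots> = ln S" using Spos assms by simp
  finally have "exp (\<alpha> * ln a + \<beta> * ln b + \<gamma> * ln c) \<le> S"
    using Spos by (simp add: ln_ge_iff)
  then show ?thesis
    using pos by (simp add: powr_def exp_add S_def)
qed

text \<open>After normalising the three integrals to \<open>1\<close>, the inequality is the integral of the weighted
  inequality between the geometric and the arithmetic mean. The exponents may vanish: as \<open>0 powr 0 = 0\<close>,
  a factor with exponent \<open>0\<close> is at most \<open>1\<close>, and it is \<open>0\<close> wherever its base is. For the same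
  reason the bounds \<open>A\<close>, \<open>B\<close>, \<open>C\<close> may vanish: the integrand is then \<open>0\<close> almost everywhere.\<close>

lemma nn_integral_Hoelder3:
  fixes F G H :: "'a \<Rightarrow> real"
  assumes [measurable]: "F \<in> borel_measurable M" "G \<in> borel_measurable M" "H \<in> borel_measurable M"
    and nn: "\<And>x. 0 \<le> F x" "\<And>x. 0 \<le> G x" "\<And>x. 0 \<le> H x" "0 \<le> A" "0 \<le> B" "0 \<le> C"
    and exps: "0 \<le> \<alpha>" "0 \<le> \<beta>" "0 \<le> \<gamma>" "\<alpha> + \<beta> + \<gamma> = 1"
    and bounds: "(\<integral>\<^sup>+x. F x \<partial>M) \<le> ennreal A" "(\<integral>\<^sup>+x. G x \<partial>M) \<le> ennreal B"
      "(\<integral>\<^sup>+x. H x \<partial>M) \<le> ennreal C"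
  shows "(\<integral>\<^sup>+x. ennreal (F x powr \<alpha> * G x powr \<beta> * H x powr \<gamma>) \<partial>M)
    \<le> ennreal (A powr \<alpha> * B powr \<beta> * C powr \<gamma>)"
proof (cases "A = 0 \<or> B = 0 \<or> C = 0")
  case True
  have zero: "AE x in M. f x = 0"
    if "(\<integral>\<^sup>+x. f x \<partial>M) \<le> ennreal 0" "\<And>x. 0 \<le> f x" "f \<in> borel_measurable M" for f :: "'a \<Rightarrow> real"
  proof -
    have "(\<integral>\<^sup>+x. f x \<partial>M) = 0" using that by simp
    then have "AE x in M. ennreal (f x) = 0" using that by (subst (asm) nn_integral_0_iff_AE) auto
    then show ?thesis using that by (auto simp: ennreal_eq_0_iff antisym)
  qed
  have "AE x in M. F x = 0 \<or> G x = 0 \<or> H x = 0"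
    using True zero[of F] zero[of G] zero[of H] bounds nn by auto
  then have "AE x in M. ennreal (F x powr \<alpha> * G x powr \<beta> * H x powr \<gamma>) = 0"
    by eventually_elim auto
  then have "(\<integral>\<^sup>+x. ennreal (F x powr \<alpha> * G x powr \<beta> * H x powr \<gamma>) \<partial>M) = 0"
    by (subst nn_integral_0_iff_AE) auto
  then show ?thesis by simp
next
  case False
  then have pos: "A > 0" "B > 0" "C > 0" using nn by auto
  define K where "K = A powr \<alpha> * B powr \<beta> * C powr \<gamma>"
  have K: "K \<ge> 0" unfolding K_def by simp
  have pw: "F x powr \<alpha> * G x powr \<beta> * H x powr \<gamma>
      \<le> K * (\<alpha> / A * F x + \<beta> / B * G x + \<gamma> / C * H x)" for x
  proof -
    have "(F x / A) powr \<alpha> * (G x / B) powr \<beta> * (H x / C) powr \<gamma>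
        \<le> \<alpha> * (F x / A) + \<beta> * (G x / B) + \<gamma> * (H x / C)"
      using weighted_am_gm3[of "F x / A" "G x / B" "H x / C" \<alpha> \<beta> \<gamma>] nn exps pos by simp
    then have "K * ((F x / A) powr \<alpha> * (G x / B) powr \<beta> * (H x / C) powr \<gamma>)
        \<le> K * (\<alpha> * (F x / A) + \<beta> * (G x / B) + \<gamma> * (H x / C))"
      using K by (rule mult_left_mono)
    moreover have "K * ((F x / A) powr \<alpha> * (G x / B) powr \<beta> * (H x / C) powr \<gamma>)
        = F x powr \<alpha> * G x powr \<beta> * H x powr \<gamma>"
      unfolding K_def using pos nn by (simp add: powr_divide field_simps)
    ultimately show ?thesis by simp
  qed
  have "(\<integral>\<^sup>+x. ennreal (F x powr \<alpha> * G x powr \<beta> * H x powr \<gamma>) \<partial>M)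
      \<le> (\<integral>\<^sup>+x. ennreal (K * \<alpha> / A) * F x + ennreal (K * \<beta> / B) * G x + ennreal (K * \<gamma> / C) * H x \<partial>M)"
  proof (rule nn_integral_mono)
    fix x
    have "ennreal (F x powr \<alpha> * G x powr \<beta> * H x powr \<gamma>)
        \<le> ennreal (K * (\<alpha> / A * F x + \<beta> / B * G x + \<gamma> / C * H x))"
      using pw by (rule ennreal_leI)
    also have "\<dots> = ennreal (K * \<alpha> / A) * F x + ennreal (K * \<beta> / B) * G x + ennreal (K * \<gamma> / C) * H x"
    proof -
      have "K * (\<alpha> / A * F x + \<beta> / B * G x + \<gamma> / C * H x)
          = K * \<alpha> / A * F x + K * \<beta> / B * G x + K * \<gamma> / C * H x"
        by (simp add: algebra_simps)
      then show ?thesis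
        using nn exps pos K by (simp del: times_divide_eq_left add: ennreal_mult'[symmetric])
    qed
    finally show "ennreal (F x powr \<alpha> * G x powr \<beta> * H x powr \<gamma>)
      \<le> ennreal (K * \<alpha> / A) * F x + ennreal (K * \<beta> / B) * G x + ennreal (K * \<gamma> / C) * H x" .
  qed
  also have "\<dots> = ennreal (K * \<alpha> / A) * (\<integral>\<^sup>+x. F x \<partial>M) + ennreal (K * \<beta> / B) * (\<integral>\<^sup>+x. G x \<partial>M)
      + ennreal (K * \<gamma> / C) * (\<integral>\<^sup>+x. H x \<partial>M)"
    by (simp add: nn_integral_add nn_integral_cmult)
  also have "\<dots> \<le> ennreal (K * \<alpha> / A) * ennreal A + ennreal (K * \<beta> / B) * ennreal B
      + ennreal (K * \<gamma> / C) * ennreal C"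
    by (intro add_mono mult_left_mono bounds) auto
  also have "\<dots> = ennreal (K * (\<alpha> + \<beta> + \<gamma>))"
    using pos exps(1-3) K by (simp add: distrib_left flip: ennreal_mult' ennreal_plus)
  also have "\<dots> = ennreal K" using exps by simp
  finally show ?thesis unfolding K_def .
qed

lemma nn_integral_Hoelder2:
  fixes F G :: "'a \<Rightarrow> real"
  assumes "F \<in> borel_measurable M" "G \<in> borel_measurable M"
    and "\<And>x. 0 \<le> F x" "\<And>x. 0 \<le> G x" "0 \<le> A" "0 \<le> B"
    and "0 \<le> \<alpha>" "0 \<le> \<beta>" "\<alpha> + \<beta> = 1"
    and "(\<integral>\<^sup>+x. F x \<partial>M) \<le> ennreal A" "(\<integral>\<^sup>+x. G x \<partial>M) \<le> ennreal B"
  shows "(\<integral>\<^sup>+x. ennreal (F x powr \<alpha> * G x powr \<beta>) \<partial>M) \<le> ennreal (A powr \<alpha> * B powr \<beta>)"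
proof -
  have eq: "a powr \<alpha> * b powr \<beta> * b powr 0 = a powr \<alpha> * b powr \<beta>" for a b :: real
    by simp
  show ?thesis
    using nn_integral_Hoelder3[of F M G G A B B \<alpha> \<beta> 0] assms unfolding eq by simp
qed

section \<open>The heat kernel on the plane\<close>

definition heat :: "real \<Rightarrow> plane \<Rightarrow> real" where
  "heat t x = exp (- (norm x)\<^sup>2 / (4 * t)) / (4 * pi * t)"

lemma heat_nonneg: "t > 0 \<Longrightarrow> heat t x \<ge> 0"
  by (simp add: heat_def)

lemma heat_minus_commute: "heat t (x - y) = heat t (y - x)"
  by (simp add: heat_def norm_minus_commute)

lemma heat_le: "t > 0 \<Longrightarrow> heat t x \<le> 1 / (4 * pi * t)"
  by (simp add: heat_def divide_right_mono)

lemma borel_measurable_heat [measurable (raw)]: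
  assumes [measurable]: "f \<in> borel_measurable M" "g \<in> borel_measurable M"
  shows "(\<lambda>x. heat (f x) (g x)) \<in> borel_measurable M"
  unfolding heat_def by measurable

lemma norm_plane: "(norm (x::plane))\<^sup>2 = (x \<bullet> axis 1 1)\<^sup>2 + (x \<bullet> axis 2 1)\<^sup>2"
  by (simp add: norm_vec_def L2_set_def sum_2 inner_axis)

text \<open>The heat kernel at time \<open>t\<close> is the density of two independent normal variables of variance \<open>2 t\<close>;
  this is what makes its integral \<open>1\<close>.\<close>

lemma heat_eq_normal_density:
  assumes "t > 0"
  shows "heat t x = (\<Prod>b\<in>Basis. normal_density 0 (sqrt (2 * t)) (x \<bullet> b))"
proof -
  have B: "(Basis :: plane set) = {axis 1 1, axis 2 1}"
    by (auto simp: Basis_vec_def) (metis exhaust_2)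
  have "axis 1 (1::real) \<noteq> (axis 2 1 :: plane)"
    by (simp add: axis_eq_axis)
  then have "(\<Prod>b\<in>Basis. normal_density 0 (sqrt (2 * t)) (x \<bullet> b))
    = normal_density 0 (sqrt (2 * t)) (x \<bullet> axis 1 1) * normal_density 0 (sqrt (2 * t)) (x \<bullet> axis 2 1)"
    by (simp add: B)
  also have "\<dots> = exp (- (x \<bullet> axis 1 1)\<^sup>2 / (4 * t) - (x \<bullet> axis 2 1)\<^sup>2 / (4 * t)) / (4 * pi * t)"
    using assms by (simp add: normal_density_def flip: exp_add)
  also have "\<dots> = heat t x"
    unfolding heat_def norm_plane by (simp add: add_divide_distrib diff_divide_distrib)
  finally show ?thesis by simp
qed

lemma nn_integral_heat:
  assumes "t > 0"
  shows "(\<integral>\<^sup>+x. heat t x \<partial>lborel) = 1"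
proof -
  have "(\<integral>\<^sup>+x. heat t x \<partial>lborel)
      = (\<integral>\<^sup>+x. (\<Prod>b\<in>Basis. ennreal (normal_density 0 (sqrt (2 * t)) (x \<bullet> b))) \<partial>(lborel :: plane measure))"
    using assms by (simp add: heat_eq_normal_density prod_ennreal)
  also have "\<dots> = (\<Prod>b\<in>(Basis :: plane set). (\<integral>\<^sup>+x. ennreal (normal_density 0 (sqrt (2 * t)) x) \<partial>lborel))"
    by (intro nn_integral_lborel_prod) auto
  also have "\<dots> = 1"
    using assms by (subst nn_integral_eq_integral) auto
  finally show ?thesis .
qed

lemma nn_integral_plane_affine:
  fixes f :: "plane \<Rightarrow> ennreal"
  assumes [measurable]: "f \<in> borel_measurable borel" and c: "c \<noteq> 0"
  shows "(\<integral>\<^sup>+x. f x \<partial>lborel) = ennreal (c\<^sup>2) * (\<integral>\<^sup>+x. f (t + c *\<^sub>R x) \<partial>lborel)"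
  by (subst lborel_affine[OF c, of t])
     (simp add: nn_integral_density nn_integral_distr nn_integral_cmult)

lemma integral_plane_affine:
  fixes f :: "plane \<Rightarrow> 'b :: {banach, second_countable_topology}"
  assumes [measurable]: "f \<in> borel_measurable borel" and c: "c \<noteq> 0"
  shows "(\<integral>x. f x \<partial>lborel) = c\<^sup>2 *\<^sub>R (\<integral>x. f (t + c *\<^sub>R x) \<partial>lborel)"
  by (subst lborel_affine[OF c, of t])
     (simp add: integral_density integral_distr)

lemma nn_integral_plane_minus:
  fixes f :: "plane \<Rightarrow> ennreal"
  assumes [measurable]: "f \<in> borel_measurable borel"
  shows "(\<integral>\<^sup>+x. f (y - x) \<partial>lborel) = (\<integral>\<^sup>+x. f x \<partial>lborel)"
    "(\<integral>\<^sup>+x. f (x - y) \<partial>lborel) = (\<integral>\<^sup>+x. f x \<partial>lborel)"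
  using nn_integral_plane_affine[of f "-1" y] nn_integral_plane_affine[of f 1 "-y"] by simp_all

lemma nn_integral_heat_minus:
  assumes "t > 0"
  shows "(\<integral>\<^sup>+x. heat t (x - y) \<partial>lborel) = 1"
  using nn_integral_plane_minus(2)[of "\<lambda>x. ennreal (heat t x)" y] nn_integral_heat[OF assms] by simp

lemma integrable_heat_minus: "t > 0 \<Longrightarrow> integrable lborel (\<lambda>x. heat t (x - y))"
  by (rule integrableI_bounded) (auto simp: heat_nonneg nn_integral_heat_minus)

text \<open>Powers of a Gaussian are Gaussians, so that all \<open>L\<^sup>r\<close> norms of the heat kernel reduce to its integral.\<close>

lemma heat_powr:
  assumes "t > 0" "r > 0"
  shows "heat t x powr r = (4 * pi * t) powr (1 - r) / r * heat (t / r) x"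
proof -
  have "heat t x powr r = exp (- (norm x)\<^sup>2 / (4 * t)) powr r / (4 * pi * t) powr r"
    unfolding heat_def using assms by (simp add: powr_divide)
  also have "exp (- (norm x)\<^sup>2 / (4 * t)) powr r = exp (- (norm x)\<^sup>2 / (4 * (t / r)))"
    using assms by (simp add: powr_def)
  also have "\<dots> / (4 * pi * t) powr r = (4 * pi * t) powr (1 - r) / r * heat (t / r) x"
    using assms by (simp add: heat_def powr_diff)
  finally show ?thesis .
qed

section \<open>Polynomial weights\<close>

lemma bracket_ge_1: "bracket x \<ge> 1"
  by (simp add: bracket_def)

lemma bracket_pos: "bracket x > 0"
  using bracket_ge_1[of x] by linarith

lemma norm_le_bracket: "norm x \<le> bracket x"
  unfolding bracket_def by (rule real_le_rsqrt) simp

lemma bracket_squared: "(bracket x)\<^sup>2 = 1 + (norm x)\<^sup>2"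
  by (simp add: bracket_def)

lemma borel_measurable_bracket [measurable (raw)]:
  assumes [measurable]: "f \<in> borel_measurable M"
  shows "(\<lambda>x. bracket (f x)) \<in> borel_measurable M"
  unfolding bracket_def by measurable

text \<open>The submultiplicativity of \<open>\<langle>x\<rangle>\<close> (Peetre's inequality): it moves polynomial weights across
  a convolution at the price of the same weight on the kernel.\<close>

lemma bracket_add_le: "bracket (x + y) \<le> 2 * bracket x * bracket y"
proof (rule power2_le_imp_le)
  have "norm (x + y) \<le> norm x + norm y" by (rule norm_triangle_ineq)
  then have "(norm (x + y))\<^sup>2 \<le> (norm x + norm y)\<^sup>2" by (simp add: power_mono)
  also have "\<dots> \<le> 2 * (norm x)\<^sup>2 + 2 * (norm y)\<^sup>2"
    using zero_le_power2[of "norm x - norm y"] by (simp add: power2_eq_square algebra_simps)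
  finally have "1 + (norm (x + y))\<^sup>2 \<le> 4 * ((1 + (norm x)\<^sup>2) * (1 + (norm y)\<^sup>2))"
    using mult_nonneg_nonneg[OF zero_le_power2 zero_le_power2, of "norm x" "norm y"]
      zero_le_power2[of "norm x"] zero_le_power2[of "norm y"]
    unfolding distrib_left distrib_right mult_1_left mult_1_right by linarith
  then show "(bracket (x + y))\<^sup>2 \<le> (2 * bracket x * bracket y)\<^sup>2"
    by (simp add: bracket_squared power_mult_distrib mult.assoc)
qed (simp add: bracket_pos less_imp_le)

lemma bracket_power_le: "bracket x ^ N \<le> 2 ^ N * bracket y ^ N * bracket (x - y) ^ N"
  using power_mono[OF bracket_add_le[of y "x - y"], of N] bracket_pos[of x]
  by (simp add: power_mult_distrib)

lemma bracket_minus_commute: "bracket (x - y) = bracket (y - x)"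
  by (simp add: bracket_def norm_minus_commute)

lemma power_le_exp:
  fixes a :: real
  assumes "a > 0"
  obtains K where "K > 0" "\<And>t. t \<ge> 0 \<Longrightarrow> (1 + t) ^ N \<le> K * exp (a * t)"
proof
  show "fact N / a ^ N * exp a > 0" using assms by simp
  fix t :: real assume t: "t \<ge> 0"
  define v where "v = a * (1 + t)"
  have "v \<ge> 0" using assms t by (simp add: v_def)
  have "(\<Sum>n\<in>{N}. v ^ n /\<^sub>R fact n) \<le> (\<Sum>n. v ^ n /\<^sub>R fact n)"
    using \<open>v \<ge> 0\<close> by (intro sum_le_suminf summable_exp_generic) auto
  also have "\<dots> = exp v" using exp_converges sums_unique by metis
  finally have "v ^ N \<le> fact N * exp v" by (simp add: field_simps)
  then have "a ^ N * (1 + t) ^ N \<le> fact N * (exp a * exp (a * t))"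
    by (simp add: v_def distrib_left exp_add flip: power_mult_distrib)
  then show "(1 + t) ^ N \<le> fact N / a ^ N * exp a * exp (a * t)"
    using assms by (simp add: field_simps)
qed

text \<open>A polynomial weight costs a power of \<open>1 + t\<close> and a doubling of the time: with
  \<open>w = |z|\<^sup>2/t\<close> one has \<open>\<langle>z\<rangle>\<^sup>2 \<le> (1 + t) (1 + w)\<close>, and the power of \<open>1 + w\<close> is absorbed by half of
  the Gaussian exponent \<open>- w/4\<close>.\<close>

lemma bracket_power_heat_le:
  obtains C where "C > 0"
    "\<And>t z. t > 0 \<Longrightarrow> bracket z ^ N * heat t z \<le> C * (1 + t) ^ N * heat (2 * t) z"
proof -
  obtain K :: real where "K > 0" and key: "\<And>w. 0 \<le> w \<Longrightarrow> (1 + w) ^ N \<le> K * exp (1/8 * w)"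
    using power_le_exp[of "1/8" N] by auto
  define C :: real where "C = 2 * K"
  have "bracket z ^ N * heat t z \<le> C * (1 + t) ^ N * heat (2 * t) z" if t: "t > 0" for t z
  proof -
    define w where "w = (norm z)\<^sup>2 / t"
    have w: "w \<ge> 0" using t by (simp add: w_def)
    have "bracket z ^ N \<le> (bracket z)\<^sup>2 ^ N"
      using bracket_ge_1[of z] by (intro power_mono) (auto simp: power2_eq_square)
    also have "\<dots> \<le> ((1 + t) * (1 + w)) ^ N"
    proof (rule power_mono)
      have "(norm z)\<^sup>2 = t * w" using t by (simp add: w_def)
      then show "(bracket z)\<^sup>2 \<le> (1 + t) * (1 + w)"
        using t w unfolding bracket_squared by (simp add: algebra_simps)
    qed simp
    also have "\<dots> \<le> (1 + t) ^ N * (K * exp (1/8 * w))"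
      unfolding power_mult_distrib using key[OF w] t by (intro mult_left_mono) auto
    finally have "bracket z ^ N * heat t z \<le> (1 + t) ^ N * (K * exp (1/8 * w)) * heat t z"
      using heat_nonneg[OF t] by (rule mult_right_mono)
    moreover have "exp (1/8 * w) * heat t z = 2 * heat (2 * t) z"
      using t unfolding heat_def w_def by (simp add: field_simps flip: exp_add)
    moreover have "(1 + t) ^ N * (K * exp (1/8 * w)) * heat t z = (1 + t) ^ N * K * (exp (1/8 * w) * heat t z)"
      by (simp only: mult_ac)
    ultimately show ?thesis unfolding C_def by (simp only: mult_ac)
  qed
  moreover have "C > 0" using \<open>K > 0\<close> by (simp add: C_def)
  ultimately show thesis using that by blast
qed


section \<open>Gamma integrals and integrability of the weights\<close>

lemma nn_integral_Gamma_scaled: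
  assumes "s > 0" "l > (0::real)"
  shows "(\<integral>\<^sup>+t. ennreal (indicator {0<..} t * (t powr (s - 1) * exp (- l * t))) \<partial>lborel)
    = ennreal (Gamma s * l powr (- s))"
proof -
  define f :: "real \<Rightarrow> real" where "f t = indicator {0..} t * t powr (s - 1) / exp t" for t
  have [measurable]: "f \<in> borel_measurable borel" unfolding f_def by measurable
  have f_scaled: "indicator {0<..} t * (t powr (s - 1) * exp (- l * t)) = l powr (1 - s) * f (0 + l * t)" for t
    using assms by (cases "t > 0")
      (auto simp: f_def indicator_def powr_mult exp_minus field_simps powr_diff zero_le_mult_iff)
  have "(\<integral>\<^sup>+t. ennreal (indicator {0<..} t * (t powr (s - 1) * exp (- l * t))) \<partial>lborel)
      = ennreal (l powr (1 - s)) * (\<integral>\<^sup>+t. ennreal (f (0 + l * t)) \<partial>lborel)"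
    unfolding f_scaled by (simp add: ennreal_mult' nn_integral_cmult)
  also have "ennreal (l powr (1 - s)) = ennreal (l powr (- s)) * ennreal \<bar>l\<bar>"
    using assms by (simp add: powr_diff powr_minus field_simps flip: ennreal_mult')
  also have "\<dots> * (\<integral>\<^sup>+t. ennreal (f (0 + l * t)) \<partial>lborel) = ennreal (l powr (- s)) * (\<integral>\<^sup>+t. ennreal (f t) \<partial>lborel)"
    using assms nn_integral_real_affine[of f l 0] by (simp add: mult.assoc)
  also have "(\<integral>\<^sup>+t. ennreal (f t) \<partial>lborel) = ennreal (Gamma s)"
    unfolding f_def using Gamma_conv_nn_integral_real[OF assms(1)] by simp
  finally show ?thesis
    using assms by (simp add: mult.commute flip: ennreal_mult')
qed

lemma nn_integral_exp_scaled:
  assumes "l > (0::real)"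
  shows "(\<integral>\<^sup>+t. ennreal (indicator {0<..} t * exp (- l * t)) \<partial>lborel) = ennreal (1 / l)"
proof -
  have "(\<integral>\<^sup>+t. ennreal (indicator {0<..} t * exp (- l * t)) \<partial>lborel)
      = (\<integral>\<^sup>+t. ennreal (indicator {0<..} t * (t powr (1 - 1) * exp (- l * t))) \<partial>lborel)"
    by (intro nn_integral_cong) (auto simp: indicator_def)
  then show ?thesis
    using nn_integral_Gamma_scaled[of 1 l] assms by (simp add: powr_minus inverse_eq_divide)
qed

text \<open>Polar coordinates are avoided by writing the weight as a mixture of Gaussians,
  \<open>\<Gamma>(b/2) \<langle>x\<rangle>\<^sup>-\<^sup>b = \<integral>\<^sub>0\<^sup>\<infinity> t\<close> to the power \<open>b/2 - 1\<close> times \<open>exp (- t (1 + |x|\<^sup>2)) dt\<close>. The Gaussian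
  in \<open>x\<close> has integral \<open>\<pi>/t\<close>, which leaves the integral of \<open>\<Gamma>(b/2 - 1)\<close>; it converges if \<open>b > 2\<close>.\<close>

lemma nn_integral_bracket_powr_finite:
  assumes "b > 2"
  shows "(\<integral>\<^sup>+x. ennreal (bracket x powr (- b)) \<partial>lborel) < \<infinity>"
proof -
  define k where "k t x = indicator {0<..} t * (pi * t powr (b / 2 - 1 - 1) * exp (- 1 * t)) * heat (1 / (4 * t)) x"
    for t and x :: plane
  have [measurable]: "(\<lambda>(t, x). k t x) \<in> borel_measurable (borel \<Otimes>\<^sub>M borel)"
    unfolding k_def by measurable
  have k: "k t x = indicator {0<..} t * (t powr (b / 2 - 1) * exp (- (1 + (norm x)\<^sup>2) * t))" for t x
  proof (cases "t > 0")
    case True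
    have "t powr (b / 2 - 1) = t powr (b / 2 - 1 - 1) * t"
      using True powr_mult_base[of t "b / 2 - 1 - 1"] by (simp add: mult.commute)
    then show ?thesis
      using True by (simp add: k_def heat_def field_simps flip: exp_add)
  qed (simp add: k_def)
  have "ennreal (Gamma (b / 2)) * (\<integral>\<^sup>+x. ennreal (bracket x powr (- b)) \<partial>lborel)
      = (\<integral>\<^sup>+x. ennreal (Gamma (b / 2)) * ennreal (bracket x powr (- b)) \<partial>lborel)"
    by (simp add: nn_integral_cmult)
  also have "\<dots> = (\<integral>\<^sup>+x. (\<integral>\<^sup>+t. ennreal (k t x) \<partial>lborel) \<partial>lborel)"
  proof (rule nn_integral_cong)
    fix x :: plane
    have "bracket x powr (- b) = ((bracket x)\<^sup>2) powr (- (b / 2))"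
      using bracket_pos[of x] by (simp add: powr_powr flip: powr_numeral)
    then show "ennreal (Gamma (b / 2)) * ennreal (bracket x powr (- b)) = (\<integral>\<^sup>+t. ennreal (k t x) \<partial>lborel)"
      unfolding k using nn_integral_Gamma_scaled[of "b / 2" "1 + (norm x)\<^sup>2"] assms
      by (simp add: bracket_squared add_pos_nonneg flip: ennreal_mult'')
  qed
  also have "\<dots> = (\<integral>\<^sup>+t. (\<integral>\<^sup>+x. ennreal (k t x) \<partial>lborel) \<partial>lborel)"
    by (intro lborel_pair.Fubini') measurable
  also have "\<dots> = (\<integral>\<^sup>+t. ennreal (indicator {0<..} t * (pi * t powr (b / 2 - 1 - 1) * exp (- 1 * t))) \<partial>lborel)"
  proof (rule nn_integral_cong)
    fix t :: real
    show "(\<integral>\<^sup>+x. ennreal (k t x) \<partial>lborel) = ennreal (indicator {0<..} t * (pi * t powr (b / 2 - 1 - 1) * exp (- 1 * t)))"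
      by (cases "t > 0") (simp_all add: k_def ennreal_mult' nn_integral_cmult nn_integral_heat)
  qed
  also have "\<dots> = ennreal pi * (\<integral>\<^sup>+t. ennreal (indicator {0<..} t * (t powr (b / 2 - 1 - 1) * exp (- 1 * t))) \<partial>lborel)"
    by (subst nn_integral_cmult[symmetric]) (auto intro!: nn_integral_cong simp: indicator_def ennreal_mult' mult.assoc)
  also have "\<dots> < \<infinity>"
    using nn_integral_Gamma_scaled[of "b / 2 - 1" 1] assms by (simp flip: ennreal_mult')
  finally have "ennreal (Gamma (b / 2)) * (\<integral>\<^sup>+x. ennreal (bracket x powr (- b)) \<partial>lborel) < \<infinity>" .
  moreover have "Gamma (b / 2) > 0" using assms by (intro Gamma_real_pos) auto
  ultimately show ?thesis
    by (auto simp: ennreal_mult_less_top ennreal_eq_0_iff)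
qed

lemma nn_integral_bracket_powr_le:
  assumes "b > 2"
  obtains K where "K > 0" "(\<integral>\<^sup>+x. ennreal (bracket x powr (- b)) \<partial>lborel) \<le> ennreal K"
proof -
  obtain k where "k \<ge> 0" "(\<integral>\<^sup>+x. ennreal (bracket x powr (- b)) \<partial>lborel) = ennreal k"
    using nn_integral_bracket_powr_finite[OF assms] by (metis ennreal_cases infinity_ennreal_def order_less_irrefl)
  then show thesis using that[of "k + 1"] by (simp add: ennreal_leI)
qed

lemma integrable_inverse_bracket_power:
  assumes "3 \<le> N"
  shows "integrable lborel (\<lambda>x. 1 / bracket x ^ N)"
proof (rule integrableI_bounded)
  have "1 / bracket x ^ N = bracket x powr (- real N)" for x
    using bracket_pos[of x] by (simp add: powr_minus powr_realpow inverse_eq_divide)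
  then show "(\<integral>\<^sup>+x. ennreal (norm (1 / bracket x ^ N)) \<partial>lborel) < \<infinity>"
    using nn_integral_bracket_powr_finite[of "real N"] assms by simp
qed simp

section \<open>The resolvent kernel\<close>

definition damped_heat :: "real \<Rightarrow> real \<Rightarrow> plane \<Rightarrow> real" where
  "damped_heat \<tau> t x = indicator {0<..} t * (exp (- \<tau> * t) * heat t x)"

text \<open>For \<open>\<tau> > 0\<close> and \<open>x \<noteq> 0\<close>, in terms of the Macdonald function,
  \<open>green \<tau> x = K\<^sub>0(\<surd>\<tau> |x|) / (2 \<pi>)\<close>. At the
  logarithmic singularity \<open>x = 0\<close> the integral diverges and the value is the default \<open>0\<close>.\<close>

definition green :: "real \<Rightarrow> plane \<Rightarrow> real" where
  "green \<tau> x = (\<integral>t. damped_heat \<tau> t x \<partial>lborel)"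

lemma damped_heat_nonneg: "damped_heat \<tau> t x \<ge> 0"
  by (cases "t > 0") (simp_all add: damped_heat_def heat_nonneg)

lemma borel_measurable_damped_heat [measurable (raw)]:
  assumes [measurable]: "f \<in> borel_measurable M" "g \<in> borel_measurable M"
  shows "(\<lambda>x. damped_heat \<tau> (f x) (g x)) \<in> borel_measurable M"
  unfolding damped_heat_def by measurable

lemma green_nonneg: "green \<tau> x \<ge> 0"
  unfolding green_def by (simp add: damped_heat_nonneg)

lemma borel_measurable_green_aux: "green \<tau> \<in> borel_measurable borel"
  unfolding green_def by measurable

lemma borel_measurable_green [measurable (raw)]:
  assumes [measurable]: "g \<in> borel_measurable M"
  shows "(\<lambda>x. green \<tau> (g x)) \<in> borel_measurable M"
  using measurable_compose[OF assms borel_measurable_green_aux] .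

text \<open>The inequality covers also the points where the integral diverges and \<open>green\<close> has the default value
  \<open>0\<close>, and it suffices for all upper bounds.\<close>

lemma green_le_nn_integral: "ennreal (green \<tau> x) \<le> (\<integral>\<^sup>+t. damped_heat \<tau> t x \<partial>lborel)"
  unfolding green_def
proof (cases "integrable lborel (\<lambda>t. damped_heat \<tau> t x)")
  case True
  then show "ennreal (\<integral>t. damped_heat \<tau> t x \<partial>lborel) \<le> (\<integral>\<^sup>+t. damped_heat \<tau> t x \<partial>lborel)"
    by (simp add: nn_integral_eq_integral damped_heat_nonneg)
qed (simp add: not_integrable_integral_eq)

text \<open>With \<open>r = 1/s\<close>, Hoelder's inequality in \<open>t\<close> replaces Minkowski's integral inequality. The
  integrand \<open>e\<^sup>-\<^sup>\<tau>\<^sup>t h\<^sub>t\<close> is split against \<open>G(t) = t\<close> to the power \<open>s - 1\<close> times \<open>e\<^sup>-\<^sup>\<tau>\<^sup>t\<close>, whose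
  integral is \<open>B = \<Gamma>(s) \<tau>\<close> to the power \<open>- s\<close>. The other factor \<open>F\<close>
  carries \<open>h\<^sub>t\<close> to the power \<open>r\<close>, and its integral over \<open>x\<close> is a multiple of \<open>G(t)\<close> again, so that only
  powers of \<open>B\<close> appear.\<close>

lemma green_Lr_norm:
  assumes s: "0 < s" "s \<le> 1"
  obtains c where "c > 0"
    "\<And>\<tau>. \<tau> > 0 \<Longrightarrow> (\<integral>\<^sup>+x. ennreal (green \<tau> x powr (1 / s)) \<partial>lborel) \<le> ennreal ((c * \<tau> powr (- s)) powr (1 / s))"
proof -
  define D where "D = s * (4 * pi) powr (1 - 1 / s)"
  have D: "D > 0" using s by (simp add: D_def)
  define c where "c = D powr s * Gamma s"
  have c: "c > 0" using D s by (simp add: c_def Gamma_real_pos)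
  moreover have "(\<integral>\<^sup>+x. ennreal (green \<tau> x powr (1 / s)) \<partial>lborel) \<le> ennreal ((c * \<tau> powr (- s)) powr (1 / s))"
    if \<tau>: "\<tau> > 0" for \<tau>
  proof -
    define B where "B = Gamma s * \<tau> powr (- s)"
    have B: "B > 0" using s \<tau> by (simp add: B_def Gamma_real_pos)
    define G where "G t = indicator {0<..} t * (t powr (s - 1) * exp (- \<tau> * t))" for t
    \<comment> \<open>The power of \<open>t\<close> which cancels the one of \<open>G\<close> in the product \<open>F\<^sup>s G\<^sup>1\<^sup>-\<^sup>s\<close>.\<close>
    define e where "e = (1 - s) * (1 / s - 1)"
    define F where "F t x = indicator {0<..} t * (exp (- \<tau> * t) * (t powr e * heat t x powr (1 / s)))"
      for t and x :: plane
    have [measurable]: "(\<lambda>(t, x). F t x) \<in> borel_measurable (borel \<Otimes>\<^sub>M borel)" "G \<in> borel_measurable borel"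
      unfolding F_def G_def by measurable
    have FG: "F t x powr s * G t powr (1 - s) = damped_heat \<tau> t x" for t x
    proof (cases "t > 0")
      case True
      have "F t x powr s * G t powr (1 - s)
          = (exp (- \<tau> * t) powr s * exp (- \<tau> * t) powr (1 - s)) * ((t powr e) powr s * (t powr (s - 1)) powr (1 - s))
            * (heat t x powr (1 / s)) powr s"
        using True by (simp add: F_def G_def powr_mult heat_nonneg)
      also have "exp (- \<tau> * t) powr s * exp (- \<tau> * t) powr (1 - s) = exp (- \<tau> * t)"
        by (simp flip: powr_add)
      also have "(t powr e) powr s * (t powr (s - 1)) powr (1 - s) = 1"
      proof -
        have "e * s + (s - 1) * (1 - s) = 0"
          using s by (simp add: e_def field_simps)
        then show ?thesis using True by (simp add: powr_powr flip: powr_add)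
      qed
      also have "(heat t x powr (1 / s)) powr s = heat t x"
        using True s heat_nonneg by (simp add: powr_powr)
      finally show ?thesis using True by (simp add: damped_heat_def)
    qed (use s in \<open>simp add: F_def damped_heat_def\<close>)
    have pointwise: "ennreal (green \<tau> x powr (1 / s)) \<le> (\<integral>\<^sup>+t. F t x \<partial>lborel) * ennreal (B powr (1 / s - 1))" for x
    proof (cases "(\<integral>\<^sup>+t. F t x \<partial>lborel) = \<infinity>")
      case True
      then show ?thesis using B by (simp add: ennreal_top_mult)
    next
      case False
      then obtain A where A: "A \<ge> 0" "(\<integral>\<^sup>+t. F t x \<partial>lborel) = ennreal A"
        by (metis ennreal_cases infinity_ennreal_def)
      have "ennreal (green \<tau> x) \<le> (\<integral>\<^sup>+t. ennreal (F t x powr s * G t powr (1 - s)) \<partial>lborel)"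
        unfolding FG by (rule green_le_nn_integral)
      also have "\<dots> \<le> ennreal (A powr s * B powr (1 - s))"
        using A B s nn_integral_Gamma_scaled[OF s(1) \<tau>]
        by (intro nn_integral_Hoelder2) (auto simp: F_def G_def B_def heat_nonneg indicator_def)
      finally have "green \<tau> x \<le> A powr s * B powr (1 - s)"
        by (subst (asm) ennreal_le_iff) auto
      then have "green \<tau> x powr (1 / s) \<le> (A powr s * B powr (1 - s)) powr (1 / s)"
        using s green_nonneg by (intro powr_mono2) auto
      also have "\<dots> = A * B powr (1 / s - 1)"
        using s A by (simp add: powr_mult powr_powr diff_divide_distrib)
      finally show ?thesis
        using A by (simp add: ennreal_leI flip: ennreal_mult'')
    qed
    have inner: "(\<integral>\<^sup>+x. F t x \<partial>lborel) = ennreal D * ennreal (G t)" for t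
    proof (cases "t > 0")
      case True
      have "(\<integral>\<^sup>+x. F t x \<partial>lborel) = (\<integral>\<^sup>+x. ennreal (exp (- \<tau> * t) * t powr e * ((4 * pi * t) powr (1 - 1 / s) * s)) * ennreal (heat (t * s) x) \<partial>lborel)"
        using True s by (intro nn_integral_cong) (simp add: F_def heat_powr mult.assoc mult.left_commute heat_nonneg flip: ennreal_mult'')
      also have "\<dots> = ennreal (exp (- \<tau> * t) * t powr e * ((4 * pi * t) powr (1 - 1 / s) * s))"
        using True s by (simp add: nn_integral_cmult nn_integral_heat)
      also have "exp (- \<tau> * t) * t powr e * ((4 * pi * t) powr (1 - 1 / s) * s) = D * (exp (- \<tau> * t) * (t powr e * t powr (1 - 1 / s)))"
        using True by (simp add: D_def powr_mult)
      also have "t powr e * t powr (1 - 1 / s) = t powr (s - 1)"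
      proof -
        have "e + (1 - 1 / s) = s - 1" using s by (simp add: e_def field_simps)
        then show ?thesis using True by (metis powr_add)
      qed
      finally show ?thesis
        using True D by (simp add: G_def mult.commute flip: ennreal_mult')
    qed (simp add: F_def G_def)
    have "(\<integral>\<^sup>+x. ennreal (green \<tau> x powr (1 / s)) \<partial>lborel)
        \<le> (\<integral>\<^sup>+x. (\<integral>\<^sup>+t. F t x \<partial>lborel) * ennreal (B powr (1 / s - 1)) \<partial>lborel)"
      by (intro nn_integral_mono pointwise)
    also have "\<dots> = (\<integral>\<^sup>+x. (\<integral>\<^sup>+t. F t x \<partial>lborel) \<partial>lborel) * ennreal (B powr (1 / s - 1))"
      by (simp add: nn_integral_multc)
    also have "(\<integral>\<^sup>+x. (\<integral>\<^sup>+t. F t x \<partial>lborel) \<partial>lborel) = (\<integral>\<^sup>+t. (\<integral>\<^sup>+x. F t x \<partial>lborel) \<partial>lborel)"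
      by (intro lborel_pair.Fubini') measurable
    also have "\<dots> = ennreal D * ennreal B"
      unfolding inner using nn_integral_Gamma_scaled[OF s(1) \<tau>]
      by (simp add: nn_integral_cmult B_def G_def)
    also have "\<dots> * ennreal (B powr (1 / s - 1)) = ennreal (D * B powr (1 / s))"
      using B D by (simp add: powr_diff flip: ennreal_mult')
    also have "D * B powr (1 / s) = (c * \<tau> powr (- s)) powr (1 / s)"
      using D s B by (simp add: c_def B_def powr_mult powr_powr Gamma_real_pos less_imp_le mult.assoc)
    finally show ?thesis .
  qed
  ultimately show thesis using that by blast
qed

text \<open>The moments of the heat kernel grow polynomially in time; the damping beats this growth.\<close>

lemma nn_integral_bracket_power_green:
  assumes "\<tau> > 0"
  obtains K where "K \<ge> 0" "(\<integral>\<^sup>+z. ennreal (bracket z ^ N * green \<tau> z) \<partial>lborel) \<le> ennreal K"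
proof -
  obtain C where C: "C > 0" "\<And>t z. t > 0 \<Longrightarrow> bracket z ^ N * heat t z \<le> C * (1 + t) ^ N * heat (2 * t) z"
    using bracket_power_heat_le by blast
  obtain K where K: "K > 0" "\<And>t. t \<ge> 0 \<Longrightarrow> (1 + t) ^ N \<le> K * exp (\<tau> / 2 * t)"
    using power_le_exp[of "\<tau> / 2" N] assms by auto
  have inner: "(\<integral>\<^sup>+z. ennreal (bracket z ^ N) * ennreal (damped_heat \<tau> t z) \<partial>lborel)
      \<le> ennreal (C * K) * ennreal (indicator {0<..} t * exp (- (\<tau> / 2) * t))" for t
  proof (cases "t > 0")
    case True
    have "bracket z ^ N * damped_heat \<tau> t z \<le> C * K * exp (- (\<tau> / 2) * t) * heat (2 * t) z" for z
    proof -
      have "bracket z ^ N * damped_heat \<tau> t z = exp (- \<tau> * t) * (bracket z ^ N * heat t z)"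
        using True by (simp add: damped_heat_def)
      also have "\<dots> \<le> exp (- \<tau> * t) * (C * (K * exp (\<tau> / 2 * t)) * heat (2 * t) z)"
        using C K True heat_nonneg[of "2 * t" z]
        by (intro mult_left_mono order_trans[OF C(2)[OF True]] mult_right_mono) auto
      also have "\<dots> = C * K * exp (- (\<tau> / 2) * t) * heat (2 * t) z"
        by (simp add: mult_ac flip: exp_add)
      finally show ?thesis .
    qed
    then have "(\<integral>\<^sup>+z. ennreal (bracket z ^ N) * ennreal (damped_heat \<tau> t z) \<partial>lborel)
        \<le> (\<integral>\<^sup>+z. ennreal (C * K * exp (- (\<tau> / 2) * t)) * ennreal (heat (2 * t) z) \<partial>lborel)"
      using C K by (intro nn_integral_mono)
        (simp add: ennreal_leI damped_heat_nonneg bracket_pos less_imp_le flip: ennreal_mult' ennreal_mult'')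
    also have "\<dots> = ennreal (C * K * exp (- (\<tau> / 2) * t))"
      using True by (simp add: nn_integral_cmult nn_integral_heat)
    finally show ?thesis using True C K by (simp flip: ennreal_mult')
  qed (simp add: damped_heat_def)
  have "(\<integral>\<^sup>+z. ennreal (bracket z ^ N * green \<tau> z) \<partial>lborel)
      \<le> (\<integral>\<^sup>+z. (\<integral>\<^sup>+t. ennreal (bracket z ^ N) * ennreal (damped_heat \<tau> t z) \<partial>lborel) \<partial>lborel)"
    by (intro nn_integral_mono)
       (simp add: nn_integral_cmult ennreal_mult' bracket_pos less_imp_le mult_left_mono green_le_nn_integral)
  also have "\<dots> = (\<integral>\<^sup>+t. (\<integral>\<^sup>+z. ennreal (bracket z ^ N) * ennreal (damped_heat \<tau> t z) \<partial>lborel) \<partial>lborel)"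
    by (intro lborel_pair.Fubini') measurable
  also have "\<dots> \<le> (\<integral>\<^sup>+t. ennreal (C * K) * ennreal (indicator {0<..} t * exp (- (\<tau> / 2) * t)) \<partial>lborel)"
    by (intro nn_integral_mono inner)
  also have "\<dots> = ennreal (C * K * (1 / (\<tau> / 2)))"
    using C K assms nn_integral_exp_scaled[of "\<tau> / 2"]
    by (subst nn_integral_cmult) (simp_all add: ennreal_mult'[symmetric])
  finally show thesis using that[of "C * K * (1 / (\<tau> / 2))"] C K assms by simp
qed


section \<open>Differentiation under the integral sign\<close>

lemma integral_dominated_convergence_at:
  fixes s :: "real \<Rightarrow> 'a \<Rightarrow> 'b :: {banach, second_countable_topology}"
  assumes f: "f \<in> borel_measurable M"
    and s: "\<forall>\<^sub>F t in at a within S. s t \<in> borel_measurable M"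
    and w: "integrable M w"
    and lim: "AE x in M. ((\<lambda>t. s t x) \<longlongrightarrow> f x) (at a within S)"
    and bound: "\<forall>\<^sub>F t in at a within S. AE x in M. norm (s t x) \<le> w x"
  shows "((\<lambda>t. \<integral>x. s t x \<partial>M) \<longlongrightarrow> (\<integral>x. f x \<partial>M)) (at a within S)"
  unfolding tendsto_at_iff_sequentially
proof (intro allI impI)
  fix X assume "\<forall>i. X i \<in> S - {a}" "X \<longlonglongrightarrow> a"
  then have X: "filterlim X (at a within S) sequentially"
    by (auto simp: filterlim_at)
  have "\<forall>\<^sub>F n in sequentially. s (X n) \<in> borel_measurable M \<and> (AE x in M. norm (s (X n) x) \<le> w x)"
    using filterlim_iff[THEN iffD1, OF X, rule_format, OF eventually_conj[OF s bound]] .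
  then obtain N where N: "\<And>n. N \<le> n \<Longrightarrow> s (X n) \<in> borel_measurable M"
      "\<And>n. N \<le> n \<Longrightarrow> AE x in M. norm (s (X n) x) \<le> w x"
    by (auto simp: eventually_sequentially)
  have "(\<lambda>n. \<integral>x. s (X (n + N)) x \<partial>M) \<longlonglongrightarrow> (\<integral>x. f x \<partial>M)"
  proof (rule integral_dominated_convergence)
    show "AE x in M. (\<lambda>n. s (X (n + N)) x) \<longlonglongrightarrow> f x"
      using lim by eventually_elim (intro LIMSEQ_ignore_initial_segment filterlim_compose[OF _ X])
  qed (use f w N in auto)
  then show "((\<lambda>t. \<integral>x. s t x \<partial>M) \<circ> X) \<longlonglongrightarrow> (\<integral>x. f x \<partial>M)"
    unfolding o_def by (rule LIMSEQ_offset)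
qed

text \<open>Dominated convergence for the difference quotients, which the mean value inequality bounds by the
  dominating function of the derivatives.\<close>

lemma has_vector_derivative_integral:
  fixes f :: "real \<Rightarrow> 'a \<Rightarrow> 'b :: {banach, second_countable_topology}"
  assumes s: "s \<in> {a<..<b}"
    and int: "\<And>t. t \<in> {a<..<b} \<Longrightarrow> integrable M (f t)"
    and deriv: "\<And>t x. t \<in> {a<..<b} \<Longrightarrow> ((\<lambda>t. f t x) has_vector_derivative f' t x) (at t)"
    and bound: "\<And>t x. t \<in> {a<..<b} \<Longrightarrow> norm (f' t x) \<le> w x"
    and w: "integrable M w"
    and f'[measurable]: "f' s \<in> borel_measurable M"
  shows "((\<lambda>t. \<integral>x. f t x \<partial>M) has_vector_derivative (\<integral>x. f' s x \<partial>M)) (at s)"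
proof -
  define q where "q t x = (f t x - f s x) /\<^sub>R (t - s)" for t x
  have near: "\<forall>\<^sub>F t in at s. t \<in> {a<..<b}"
    using s eventually_at_in_open'[of "{a<..<b}" s] by simp
  have deriv_iff: "(g has_vector_derivative D) (at s) \<longleftrightarrow> ((\<lambda>t. (g t - g s) /\<^sub>R (t - s)) \<longlongrightarrow> D) (at s)"
    for g :: "real \<Rightarrow> 'b" and D
  proof -
    have "(g has_vector_derivative D) (at s)
        \<longleftrightarrow> ((\<lambda>t. norm ((g t - g s - (t - s) *\<^sub>R D) /\<^sub>R norm (t - s))) \<longlongrightarrow> 0) (at s)"
      unfolding has_vector_derivative_def has_derivative_at_within tendsto_norm_zero_iff
      by (simp add: bounded_linear_scaleR_left)
    also have "\<dots> \<longleftrightarrow> ((\<lambda>t. norm ((g t - g s) /\<^sub>R (t - s) - D)) \<longlongrightarrow> 0) (at s)"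
    proof (rule tendsto_cong)
      show "\<forall>\<^sub>F t in at s. norm ((g t - g s - (t - s) *\<^sub>R D) /\<^sub>R norm (t - s)) = norm ((g t - g s) /\<^sub>R (t - s) - D)"
        unfolding eventually_at_filter
      proof (intro always_eventually allI impI)
        fix t assume "t \<noteq> s"
        then have "(g t - g s) /\<^sub>R (t - s) - D = (g t - g s - (t - s) *\<^sub>R D) /\<^sub>R (t - s)"
          by (simp add: scaleR_diff_right)
        then show "norm ((g t - g s - (t - s) *\<^sub>R D) /\<^sub>R norm (t - s)) = norm ((g t - g s) /\<^sub>R (t - s) - D)"
          by simp
      qed
    qed
    also have "\<dots> \<longleftrightarrow> ((\<lambda>t. (g t - g s) /\<^sub>R (t - s)) \<longlongrightarrow> D) (at s)"
      by (simp add: tendsto_norm_zero_iff LIM_zero_iff)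
    finally show ?thesis .
  qed
  have "((\<lambda>t. \<integral>x. q t x \<partial>M) \<longlongrightarrow> (\<integral>x. f' s x \<partial>M)) (at s)"
  proof (rule integral_dominated_convergence_at[OF f' _ w])
    show "\<forall>\<^sub>F t in at s. q t \<in> borel_measurable M"
      using near
    proof eventually_elim
      case (elim t)
      then have [measurable]: "f t \<in> borel_measurable M" "f s \<in> borel_measurable M"
        using int s borel_measurable_integrable by blast+
      show ?case unfolding q_def by measurable
    qed
    show "AE x in M. ((\<lambda>t. q t x) \<longlongrightarrow> f' s x) (at s)"
      using deriv[OF s] unfolding deriv_iff q_def by simp
    show "\<forall>\<^sub>F t in at s. AE x in M. norm (q t x) \<le> w x"
      using near
    proof eventually_elim
      case (elim t)
      have "norm (q t x) \<le> w x" for x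
      proof (cases "t = s")
        case True
        then show ?thesis using order_trans[OF norm_ge_zero bound[OF s]] by (simp add: q_def)
      next
        case False
        have "norm (f t x - f s x) \<le> w x * norm (t - s)"
        proof (rule differentiable_bound[of "{a<..<b}" "\<lambda>t. f t x" "\<lambda>t h. h *\<^sub>R f' t x"])
          show "((\<lambda>t. f t x) has_derivative (\<lambda>h. h *\<^sub>R f' t x)) (at t within {a<..<b})"
            if "t \<in> {a<..<b}" for t
            using deriv[OF that] unfolding has_vector_derivative_def by (rule has_derivative_at_withinI)
          show "onorm (\<lambda>h. h *\<^sub>R f' t x) \<le> w x" if "t \<in> {a<..<b}" for t
            using bound[OF that] by (simp add: onorm_scaleR_left onorm_id bounded_linear_ident)
        qed (use elim s in auto)
        then show ?thesis
          using False by (simp add: q_def divide_inverse[symmetric] divide_le_eq mult.commute[of "inverse _"])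
      qed
      then show ?case by simp
    qed
  qed
  moreover have "\<forall>\<^sub>F t in at s. (\<integral>x. q t x \<partial>M) = ((\<integral>x. f t x \<partial>M) - (\<integral>x. f s x \<partial>M)) /\<^sub>R (t - s)"
    using near by eventually_elim (use int s in \<open>simp add: q_def\<close>)
  ultimately show ?thesis
    unfolding deriv_iff by (simp cong: tendsto_cong)
qed

section \<open>Partial derivatives and integration by parts\<close>

lemma partial_eqI: "(f has_derivative D) (at x) \<Longrightarrow> partial i f x = D (axis i 1)"
  unfolding partial_def using frechet_derivative_at by metis

lemma has_vector_derivative_partial:
  assumes "f differentiable (at (x + t *\<^sub>R axis i 1))"
  shows "((\<lambda>t. f (x + t *\<^sub>R axis i 1)) has_vector_derivative partial i f (x + t *\<^sub>R axis i 1)) (at t)"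
proof -
  let ?D = "frechet_derivative f (at (x + t *\<^sub>R axis i 1))"
  have D: "(f has_derivative ?D) (at (x + t *\<^sub>R axis i 1))"
    using assms frechet_derivative_works by blast
  have "((\<lambda>t. x + t *\<^sub>R axis i 1) has_derivative (\<lambda>h. h *\<^sub>R axis i 1)) (at t)"
    by (auto intro!: derivative_eq_intros)
  from has_derivative_compose[OF this D] show ?thesis
    unfolding has_vector_derivative_def partial_def
    using linear_scale[OF has_derivative_linear[OF D]] by simp
qed

lemma integral_plane_translate:
  fixes f :: "plane \<Rightarrow> 'b :: {banach, second_countable_topology}"
  assumes "f \<in> borel_measurable borel"
  shows "(\<integral>x. f (x + a) \<partial>lborel) = (\<integral>x. f x \<partial>lborel)"
  using integral_plane_affine[of f 1 a] assms by (simp add: add.commute)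

lemma integrable_plane_translate:
  fixes f :: "plane \<Rightarrow> 'b :: {banach, second_countable_topology}"
  assumes "integrable lborel f"
  shows "integrable lborel (\<lambda>x. f (x + a))"
proof -
  have [measurable]: "f \<in> borel_measurable borel" using assms by auto
  have "(\<integral>\<^sup>+x. ennreal (norm (f (x + a))) \<partial>lborel) = (\<integral>\<^sup>+x. ennreal (norm (f x)) \<partial>lborel)"
    using nn_integral_plane_affine[of "\<lambda>x. ennreal (norm (f x))" 1 a] by (simp add: add.commute)
  then show ?thesis
    using assms by (simp add: integrable_iff_bounded)
qed

text \<open>Integration by parts without iterated integrals: by translation invariance the integral of
  \<open>F(x + t e)\<close> does not depend on \<open>t\<close>, and its derivative at \<open>t = 0\<close> is the integral of the partial derivative.\<close>

lemma integral_partial_eq_0: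
  fixes F :: "plane \<Rightarrow> complex"
  assumes diff: "\<And>x. F differentiable (at x)" and int: "integrable lborel F"
    and meas: "partial i F \<in> borel_measurable borel"
    and decay: "\<And>x. norm (partial i F x) \<le> C / bracket x ^ 3"
  shows "(\<integral>x. partial i F x \<partial>lborel) = 0"
proof -
  define e :: plane where "e = axis i 1"
  have [measurable]: "F \<in> borel_measurable borel" using int by auto
  have "C \<ge> 0"
    using order_trans[OF norm_ge_zero decay[of 0]] bracket_pos[of 0] by (simp add: zero_le_divide_iff)
  have "((\<lambda>t. \<integral>x. F (x + t *\<^sub>R e) \<partial>lborel) has_vector_derivative (\<integral>x. partial i F (x + 0 *\<^sub>R e) \<partial>lborel)) (at 0)"
  proof (rule has_vector_derivative_integral[where a = "-1" and b = 1 and w = "\<lambda>x. 64 * C * (1 / bracket x ^ 3)"])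
    show "integrable lborel (\<lambda>x. F (x + t *\<^sub>R e))" for t
      using int by (rule integrable_plane_translate)
    show "((\<lambda>t. F (x + t *\<^sub>R e)) has_vector_derivative partial i F (x + t *\<^sub>R e)) (at t)" for t x
      unfolding e_def by (rule has_vector_derivative_partial[OF diff])
    \<comment> \<open>\<open>64\<close> is a factor \<open>2\<close> from Peetre's inequality times \<open>\<langle>t e\<rangle> \<le> 2\<close>, cubed.\<close>
    show "norm (partial i F (x + t *\<^sub>R e)) \<le> 64 * C * (1 / bracket x ^ 3)" if "t \<in> {-1<..<1}" for t x
    proof -
      have "t\<^sup>2 \<le> 1\<^sup>2" using that by (intro power2_le_iff_abs_le[THEN iffD2]) auto
      then have "bracket (t *\<^sub>R e) \<le> 2"
        unfolding bracket_def e_def by (intro real_le_lsqrt) (auto simp: power_mult_distrib)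
      moreover have "bracket (x - (x + t *\<^sub>R e)) = bracket (t *\<^sub>R e)"
        by (simp add: bracket_def)
      ultimately have "bracket x ^ 3 \<le> 2 ^ 3 * bracket (x + t *\<^sub>R e) ^ 3 * 2 ^ 3"
        using bracket_pos[of "t *\<^sub>R e"] bracket_pos[of "x + t *\<^sub>R e"]
        by (intro order_trans[OF bracket_power_le[of x 3 "x + t *\<^sub>R e"]] mult_left_mono power_mono) auto
      then have "1 / bracket (x + t *\<^sub>R e) ^ 3 \<le> 64 / bracket x ^ 3"
        using bracket_pos[of x] bracket_pos[of "x + t *\<^sub>R e"] by (simp add: field_simps)
      from mult_left_mono[OF this \<open>C \<ge> 0\<close>] decay[of "x + t *\<^sub>R e"] show ?thesis
        by (simp add: mult.commute)
    qed
    show "integrable lborel (\<lambda>x. 64 * C * (1 / bracket x ^ 3))"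
      by (intro integrable_mult_right integrable_inverse_bracket_power) simp
    show "(\<lambda>x. partial i F (x + 0 *\<^sub>R e)) \<in> borel_measurable lborel"
      using meas by simp
  qed auto
  then have "((\<lambda>t::real. \<integral>x. F x \<partial>lborel) has_vector_derivative (\<integral>x. partial i F x \<partial>lborel)) (at 0)"
    by (simp add: integral_plane_translate)
  moreover have "((\<lambda>t::real. \<integral>x. F x \<partial>lborel) has_vector_derivative 0) (at 0)"
    by (rule has_vector_derivative_const)
  ultimately show ?thesis
    by (rule vector_derivative_unique_at)
qed

section \<open>Gaussians are Schwartz functions\<close>

lemma real_polynomial_function_has_derivative:
  fixes p :: "'a::real_normed_vector \<Rightarrow> real"
  assumes "real_polynomial_function p"
  shows "\<exists>p'. (\<forall>x. (p has_derivative p' x) (at x)) \<and> (\<forall>v. real_polynomial_function (\<lambda>x. p' x v))"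
  using assms
proof (induction rule: real_polynomial_function.induct)
  case (linear f)
  then show ?case
    by (intro exI[of _ "\<lambda>x. f"]) (auto intro: bounded_linear_imp_has_derivative)
next
  case (const c)
  show ?case by (intro exI[of _ "\<lambda>x v. 0"]) auto
next
  case (add f g)
  then obtain f' g' where "\<forall>x. (f has_derivative f' x) (at x)" "\<forall>v. real_polynomial_function (\<lambda>x. f' x v)"
    "\<forall>x. (g has_derivative g' x) (at x)" "\<forall>v. real_polynomial_function (\<lambda>x. g' x v)"
    by blast
  then show ?case
    by (intro exI[of _ "\<lambda>x v. f' x v + g' x v"]) (auto intro: has_derivative_add)
next
  case (mult f g)
  then obtain f' g' where "\<forall>x. (f has_derivative f' x) (at x)" "\<forall>v. real_polynomial_function (\<lambda>x. f' x v)"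
    "\<forall>x. (g has_derivative g' x) (at x)" "\<forall>v. real_polynomial_function (\<lambda>x. g' x v)"
    by blast
  then show ?case using mult.hyps
    by (intro exI[of _ "\<lambda>x v. f x * g' x v + f' x v * g x"])
       (auto intro!: has_derivative_mult real_polynomial_function.intros(3,4))
qed

lemma real_polynomial_function_growth:
  fixes p :: "plane \<Rightarrow> real"
  assumes "real_polynomial_function p"
  obtains C N where "C \<ge> 0" "\<And>x. \<bar>p x\<bar> \<le> C * bracket x ^ N"
  using assms
proof (induction arbitrary: thesis rule: real_polynomial_function.induct)
  case (linear f)
  obtain K where K: "K \<ge> 0" "\<And>x. norm (f x) \<le> norm x * K"
    using bounded_linear.nonneg_bounded[OF linear.hyps] by blast
  show ?case
  proof (rule linear.prems[of K 1])
    show "\<bar>f x\<bar> \<le> K * bracket x ^ 1" for x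
      using K(2)[of x] mult_right_mono[OF norm_le_bracket[of x] K(1)] by (simp add: mult.commute)
  qed (use K in auto)
next
  case (const c)
  show ?case by (rule const.prems[of "\<bar>c\<bar>" 0]) auto
next
  case (add f g)
  obtain C N where f: "C \<ge> 0" "\<And>x. \<bar>f x\<bar> \<le> C * bracket x ^ N" using add.IH(1) by blast
  obtain D M where g: "D \<ge> 0" "\<And>x. \<bar>g x\<bar> \<le> D * bracket x ^ M" using add.IH(2) by blast
  show ?case
  proof (rule add.prems[of "C + D" "max N M"])
    fix x
    have "\<bar>f x + g x\<bar> \<le> C * bracket x ^ N + D * bracket x ^ M"
      using f(2)[of x] g(2)[of x] by linarith
    also have "\<dots> \<le> C * bracket x ^ max N M + D * bracket x ^ max N M"
      using f g bracket_ge_1[of x] by (intro add_mono mult_left_mono power_increasing) auto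
    finally show "\<bar>f x + g x\<bar> \<le> (C + D) * bracket x ^ max N M" by (simp add: distrib_right)
  qed (use f g in auto)
next
  case (mult f g)
  obtain C N where f: "C \<ge> 0" "\<And>x. \<bar>f x\<bar> \<le> C * bracket x ^ N" using mult.IH(1) by blast
  obtain D M where g: "D \<ge> 0" "\<And>x. \<bar>g x\<bar> \<le> D * bracket x ^ M" using mult.IH(2) by blast
  show ?case
  proof (rule mult.prems[of "C * D" "N + M"])
    fix x
    have "\<bar>f x * g x\<bar> \<le> (C * bracket x ^ N) * (D * bracket x ^ M)"
      unfolding abs_mult using f(1) bracket_pos[of x] by (intro mult_mono f g) auto
    then show "\<bar>f x * g x\<bar> \<le> C * D * bracket x ^ (N + M)" by (simp add: power_add mult_ac)
  qed (use f g in auto)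
qed

lemma has_derivative_heat:
  assumes "t > 0"
  shows "((\<lambda>x. heat t (x - y)) has_derivative (\<lambda>h. - ((x - y) \<bullet> h) / (2 * t) * heat t (x - y))) (at x)"
  unfolding heat_def power2_norm_eq_inner using assms
  by (auto intro!: derivative_eq_intros simp: fun_eq_iff inner_commute field_simps)

lemma has_derivative_polynomial_heat:
  assumes "t > 0" "(p has_derivative D) (at x)"
  shows "((\<lambda>x. complex_of_real (p x * heat t (x - y))) has_derivative
    (\<lambda>h. complex_of_real ((D h - ((x - y) \<bullet> h) / (2 * t) * p x) * heat t (x - y)))) (at x)"
proof -
  have "((\<lambda>x. p x * heat t (x - y)) has_derivative
      (\<lambda>h. p x * (- ((x - y) \<bullet> h) / (2 * t) * heat t (x - y)) + D h * heat t (x - y))) (at x)"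
    by (intro has_derivative_mult assms(2) has_derivative_heat assms(1))
  then have "((\<lambda>x. complex_of_real (p x * heat t (x - y))) has_derivative
      (\<lambda>h. complex_of_real (p x * (- ((x - y) \<bullet> h) / (2 * t) * heat t (x - y)) + D h * heat t (x - y)))) (at x)"
    by (rule has_derivative_of_real)
  moreover have "p x * (- ((x - y) \<bullet> h) / (2 * t) * heat t (x - y)) + D h * heat t (x - y)
      = (D h - ((x - y) \<bullet> h) / (2 * t) * p x) * heat t (x - y)" for h
    unfolding left_diff_distrib by (simp add: mult_ac)
  ultimately show ?thesis by (simp only:)
qed

lemma partial_polynomial_heat:
  assumes "t > 0" "(p has_derivative D) (at x)"
  shows "partial i (\<lambda>x. complex_of_real (p x * heat t (x - y))) x
    = complex_of_real ((D (axis i 1) - ((x - y) \<bullet> axis i 1) / (2 * t) * p x) * heat t (x - y))"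
  using partial_eqI[OF has_derivative_polynomial_heat[OF assms]] .

text \<open>Polynomials times a fixed Gaussian are closed under partial derivatives.\<close>

lemma iter_partial_heat:
  assumes "t > 0"
  shows "\<exists>p. real_polynomial_function p
    \<and> iter_partial is (\<lambda>x. complex_of_real (heat t (x - y))) = (\<lambda>x. complex_of_real (p x * heat t (x - y)))"
proof (induction "is")
  case Nil
  show ?case by (rule exI[of _ "\<lambda>x. 1"]) (auto simp: iter_partial_def)
next
  case (Cons i "is")
  then obtain p where p: "real_polynomial_function p"
    "iter_partial is (\<lambda>x. complex_of_real (heat t (x - y))) = (\<lambda>x. complex_of_real (p x * heat t (x - y)))"
    by blast
  obtain p' where p': "\<And>x. (p has_derivative p' x) (at x)" "\<And>v. real_polynomial_function (\<lambda>x. p' x v)"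
    using real_polynomial_function_has_derivative[OF p(1)] by metis
  define q where "q x = p' x (axis i 1) - ((x - y) \<bullet> axis i 1) / (2 * t) * p x" for x
  have "real_polynomial_function (\<lambda>x. p' x (axis i 1) + (x \<bullet> axis i 1 + - (y \<bullet> axis i 1)) * ((- 1 / (2 * t)) * p x))"
    by (intro real_polynomial_function.intros p' p bounded_linear_inner_left)
  also have "(\<lambda>x. p' x (axis i 1) + (x \<bullet> axis i 1 + - (y \<bullet> axis i 1)) * ((- 1 / (2 * t)) * p x)) = q"
    by (simp add: q_def fun_eq_iff inner_diff_left)
  finally have "real_polynomial_function q" .
  moreover have "iter_partial (i # is) (\<lambda>x. complex_of_real (heat t (x - y)))
      = partial i (iter_partial is (\<lambda>x. complex_of_real (heat t (x - y))))"
    by (simp add: iter_partial_def)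
  then have "iter_partial (i # is) (\<lambda>x. complex_of_real (heat t (x - y))) = (\<lambda>x. complex_of_real (q x * heat t (x - y)))"
    using p(2) partial_polynomial_heat[OF assms p'(1), of i y] by (auto simp: fun_eq_iff q_def)
  ultimately show ?case by blast
qed

lemma bracket_power_heat_bounded:
  assumes "0 < a"
  obtains K where "K \<ge> 0" "\<And>t z. a \<le> t \<Longrightarrow> t \<le> b \<Longrightarrow> bracket z ^ N * heat t z \<le> K"
proof -
  obtain C where C: "C > 0" "\<And>t z. t > 0 \<Longrightarrow> bracket z ^ N * heat t z \<le> C * (1 + t) ^ N * heat (2 * t) z"
    using bracket_power_heat_le by blast
  show thesis
  proof
    show "C * (1 + \<bar>b\<bar>) ^ N * (1 / (4 * pi * (2 * a))) \<ge> 0" using C assms by simp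
    fix t z assume t: "a \<le> t" "t \<le> b"
    have "heat (2 * t) z \<le> 1 / (4 * pi * (2 * t))"
      using assms t by (intro heat_le) auto
    also have "\<dots> \<le> 1 / (4 * pi * (2 * a))"
      using assms t by (intro divide_left_mono mult_left_mono) auto
    finally have "C * (1 + t) ^ N * heat (2 * t) z \<le> C * (1 + \<bar>b\<bar>) ^ N * (1 / (4 * pi * (2 * a)))"
      using C assms t by (intro mult_mono mult_left_mono power_mono) (auto simp: heat_nonneg)
    then show "bracket z ^ N * heat t z \<le> C * (1 + \<bar>b\<bar>) ^ N * (1 / (4 * pi * (2 * a)))"
      using C(2)[of t z] assms t by linarith
  qed
qed

lemma schwartz_heat:
  assumes "t > 0"
  shows "(\<lambda>x. complex_of_real (heat t (x - y))) \<in> schwartz"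
  unfolding schwartz_def
proof (intro CollectI allI conjI)
  fix "is" :: "2 list"
  obtain p where p: "real_polynomial_function p"
    "iter_partial is (\<lambda>x. complex_of_real (heat t (x - y))) = (\<lambda>x. complex_of_real (p x * heat t (x - y)))"
    using iter_partial_heat[OF assms] by blast
  obtain p' where p': "\<forall>x. (p has_derivative p' x) (at x)"
    using real_polynomial_function_has_derivative[OF p(1)] by blast
  show "iter_partial is (\<lambda>x. complex_of_real (heat t (x - y))) differentiable (at x)" for x
    unfolding p(2) by (rule differentiableI[OF has_derivative_polynomial_heat[OF assms p'[rule_format]]])
  fix N :: nat
  obtain C M where C: "C \<ge> 0" "\<And>x. \<bar>p x\<bar> \<le> C * bracket x ^ M"
    using real_polynomial_function_growth[OF p(1)] by blast
  obtain K where "K \<ge> 0" and K': "\<And>s z. t \<le> s \<Longrightarrow> s \<le> t \<Longrightarrow> bracket z ^ (N + M) * heat s z \<le> K"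
    by (rule bracket_power_heat_bounded[OF assms, of t "N + M"]) blast
  then have K: "K \<ge> 0" "\<And>z. bracket z ^ (N + M) * heat t z \<le> K" by simp_all
  show "bounded (range (\<lambda>x. bracket x ^ N *\<^sub>R iter_partial is (\<lambda>x. complex_of_real (heat t (x - y))) x))"
  proof (rule boundedI)
    fix v assume "v \<in> range (\<lambda>x. bracket x ^ N *\<^sub>R iter_partial is (\<lambda>x. complex_of_real (heat t (x - y))) x)"
    then obtain x where v: "v = bracket x ^ N *\<^sub>R complex_of_real (p x * heat t (x - y))"
      unfolding p(2) by blast
    have "norm v = bracket x ^ N * (\<bar>p x\<bar> * heat t (x - y))"
      unfolding v using bracket_pos[of x] assms by (simp add: heat_nonneg norm_mult)
    also have "\<dots> \<le> bracket x ^ N * (C * bracket x ^ M * heat t (x - y))"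
      using C bracket_pos[of x] assms by (intro mult_left_mono mult_right_mono) (auto simp: heat_nonneg)
    also have "\<dots> = C * heat t (x - y) * bracket x ^ (N + M)"
      by (simp add: power_add)
    also have "\<dots> \<le> C * heat t (x - y) * (2 ^ (N + M) * bracket y ^ (N + M) * bracket (x - y) ^ (N + M))"
      using C assms by (intro mult_left_mono bracket_power_le) (auto simp: heat_nonneg)
    also have "\<dots> = C * (2 ^ (N + M) * bracket y ^ (N + M)) * (bracket (x - y) ^ (N + M) * heat t (x - y))"
      by (simp only: mult_ac)
    also have "\<dots> \<le> C * (2 ^ (N + M) * bracket y ^ (N + M)) * K"
      using C K bracket_pos[of y] by (intro mult_left_mono) auto
    finally show "norm v \<le> C * (2 ^ (N + M) * bracket y ^ (N + M)) * K" .
  qed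
qed

text \<open>The time derivative of the heat kernel, which is also its Laplacian: the two computations
  \<open>has_real_derivative_heat\<close> and \<open>laplacian_heat\<close> together are the heat equation.\<close>

definition heat_dot :: "real \<Rightarrow> plane \<Rightarrow> real" where
  "heat_dot t z = ((norm z)\<^sup>2 / (4 * t\<^sup>2) - 1 / t) * heat t z"

lemma has_real_derivative_heat:
  assumes "t > 0"
  shows "((\<lambda>t. heat t z) has_real_derivative heat_dot t z) (at t)"
proof -
  define n where "n = (norm z)\<^sup>2"
  define E where "E = exp (- n / (4 * t))"
  have "((\<lambda>t. - n / (4 * t)) has_real_derivative n / (4 * t\<^sup>2)) (at t)"
    using assms by (auto intro!: derivative_eq_intros simp: field_simps power2_eq_square)
  then have "((\<lambda>t. exp (- n / (4 * t))) has_real_derivative E * (n / (4 * t\<^sup>2))) (at t)"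
    unfolding E_def by (rule DERIV_fun_exp)
  moreover have "((\<lambda>t. 4 * pi * t) has_real_derivative 4 * pi) (at t)"
    by (auto intro!: derivative_eq_intros)
  ultimately have "((\<lambda>t. exp (- n / (4 * t)) / (4 * pi * t)) has_real_derivative
      (E * (n / (4 * t\<^sup>2)) * (4 * pi * t) - exp (- n / (4 * t)) * (4 * pi)) / (4 * pi * t * (4 * pi * t))) (at t)"
    by (rule DERIV_divide) (use assms in simp)
  moreover have "(E * (n / (4 * t\<^sup>2)) * (4 * pi * t) - E * (4 * pi)) / (4 * pi * t * (4 * pi * t))
      = (n / (4 * t\<^sup>2) - 1 / t) * (E / (4 * pi * t))"
    using assms by (simp add: field_simps power2_eq_square)
  ultimately show ?thesis
    unfolding heat_def heat_dot_def by (simp add: E_def n_def)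
qed

lemma partial_heat:
  assumes "t > 0"
  shows "partial i (\<lambda>x. complex_of_real (heat t (x - y)))
    = (\<lambda>x. complex_of_real (- ((x - y) \<bullet> axis i 1) / (2 * t) * heat t (x - y)))"
  using partial_polynomial_heat[OF assms, of "\<lambda>x. 1" "\<lambda>h. 0" _ i y] by (simp add: fun_eq_iff)

lemma partial_partial_heat:
  assumes "t > 0"
  shows "partial i (partial i (\<lambda>x. complex_of_real (heat t (x - y))))
    = (\<lambda>x. complex_of_real ((((x - y) \<bullet> axis i 1)\<^sup>2 / (4 * t\<^sup>2) - 1 / (2 * t)) * heat t (x - y)))"
proof
  fix x
  have "((\<lambda>x. - ((x - y) \<bullet> axis i 1) / (2 * t)) has_derivative (\<lambda>h. - (h \<bullet> axis i 1) / (2 * t))) (at x)"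
    using assms by (auto intro!: derivative_eq_intros)
  note partial_polynomial_heat[OF assms this, of i y]
  also have "- (axis i 1 \<bullet> (axis i 1 :: plane)) / (2 * t) - ((x - y) \<bullet> axis i 1) / (2 * t) * (- ((x - y) \<bullet> axis i 1) / (2 * t))
      = ((x - y) \<bullet> axis i 1)\<^sup>2 / (4 * t\<^sup>2) - 1 / (2 * t)"
    using assms by (simp add: inner_axis_axis power2_eq_square)
  finally show "partial i (partial i (\<lambda>x. complex_of_real (heat t (x - y)))) x
    = complex_of_real ((((x - y) \<bullet> axis i 1)\<^sup>2 / (4 * t\<^sup>2) - 1 / (2 * t)) * heat t (x - y))"
    unfolding partial_heat[OF assms] .
qed

lemma laplacian_heat:
  assumes "t > 0"
  shows "laplacian (\<lambda>x. complex_of_real (heat t (x - y))) = (\<lambda>x. complex_of_real (heat_dot t (x - y)))"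
  unfolding laplacian_def partial_partial_heat[OF assms] heat_dot_def norm_plane sum_2
  unfolding of_real_add[symmetric] distrib_right[symmetric]
  by (simp add: add_divide_distrib)

lemma borel_measurable_heat_dot [measurable (raw)]:
  assumes [measurable]: "f \<in> borel_measurable M" "g \<in> borel_measurable M"
  shows "(\<lambda>x. heat_dot (f x) (g x)) \<in> borel_measurable M"
  unfolding heat_dot_def by measurable


section \<open>Schwartz functions and slowly growing functions\<close>

lemma schwartz_differentiable: "\<phi> \<in> schwartz \<Longrightarrow> iter_partial is \<phi> differentiable (at x)"
  by (simp add: schwartz_def)

lemma schwartz_decay:
  assumes "\<phi> \<in> schwartz"
  obtains C where "C \<ge> 0" "\<And>x. norm (iter_partial is \<phi> x) \<le> C / bracket x ^ N"
proof -
  have "bounded (range (\<lambda>x. bracket x ^ N *\<^sub>R iter_partial is \<phi> x))"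
    using assms by (simp add: schwartz_def)
  then obtain C where C: "\<And>x. norm (bracket x ^ N *\<^sub>R iter_partial is \<phi> x) \<le> C"
    by (auto simp: bounded_iff)
  show thesis
  proof
    show "C \<ge> 0" using order_trans[OF norm_ge_zero C[of 0]] .
    show "norm (iter_partial is \<phi> x) \<le> C / bracket x ^ N" for x
      using C[of x] bracket_pos[of x] by (simp add: pos_le_divide_eq mult.commute)
  qed
qed

lemma borel_measurable_schwartz:
  assumes "\<phi> \<in> schwartz"
  shows "iter_partial is \<phi> \<in> borel_measurable borel"
  using schwartz_differentiable[OF assms]
  by (intro borel_measurable_continuous_onI continuous_at_imp_continuous_on ballI differentiable_imp_continuous_within)

lemma iter_partial_simps:
  "iter_partial [] \<phi> = \<phi>" "iter_partial [i] \<phi> = partial i \<phi>"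
  "iter_partial [i, j] \<phi> = partial i (partial j \<phi>)"
  by (simp_all add: iter_partial_def)

lemmas schwartz_decay0 = schwartz_decay[of _ "[]", unfolded iter_partial_simps]
lemmas schwartz_decay1 = schwartz_decay[of _ "[i]" for i, unfolded iter_partial_simps]
lemmas schwartz_decay2 = schwartz_decay[of _ "[i, j]" for i j, unfolded iter_partial_simps]
lemmas schwartz_differentiable0 = schwartz_differentiable[of _ "[]", unfolded iter_partial_simps]
lemmas schwartz_differentiable1 = schwartz_differentiable[of _ "[i]" for i, unfolded iter_partial_simps]
lemmas borel_measurable_schwartz0 = borel_measurable_schwartz[of _ "[]", unfolded iter_partial_simps]
lemmas borel_measurable_schwartz1 = borel_measurable_schwartz[of _ "[i]" for i, unfolded iter_partial_simps]
lemmas borel_measurable_schwartz2 = borel_measurable_schwartz[of _ "[i, j]" for i j, unfolded iter_partial_simps]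

lemma borel_measurable_laplacian: "\<phi> \<in> schwartz \<Longrightarrow> laplacian \<phi> \<in> borel_measurable borel"
  unfolding laplacian_def by (intro borel_measurable_sum borel_measurable_schwartz2)

lemma laplacian_decay:
  assumes "\<phi> \<in> schwartz"
  obtains C where "C \<ge> 0" "\<And>x. norm (laplacian \<phi> x) \<le> C / bracket x ^ N"
proof -
  obtain C where C: "C \<ge> 0" "\<And>x. norm (partial 1 (partial 1 \<phi>) x) \<le> C / bracket x ^ N"
    by (rule schwartz_decay2[OF assms]) blast
  obtain D where D: "D \<ge> 0" "\<And>x. norm (partial 2 (partial 2 \<phi>) x) \<le> D / bracket x ^ N"
    by (rule schwartz_decay2[OF assms]) blast
  show thesis
  proof
    show "C + D \<ge> 0" using C D by simp
    show "norm (laplacian \<phi> x) \<le> (C + D) / bracket x ^ N" for x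
      unfolding laplacian_def sum_2 add_divide_distrib
      using norm_triangle_le[OF add_mono[OF C(2)[of x] D(2)[of x]]] .
  qed
qed

lemma resolvent_test_decay:
  assumes \<phi>: "\<phi> \<in> schwartz"
  obtains C where "C \<ge> 0" "\<And>x. norm (of_real \<tau> * \<phi> x - laplacian \<phi> x) \<le> C / bracket x ^ N"
proof -
  obtain A where A: "A \<ge> 0" "\<And>x. norm (\<phi> x) \<le> A / bracket x ^ N" by (rule schwartz_decay0[OF \<phi>, where N = N]) blast
  obtain D where D: "D \<ge> 0" "\<And>x. norm (laplacian \<phi> x) \<le> D / bracket x ^ N" by (rule laplacian_decay[OF \<phi>, where N = N]) blast
  have "norm (of_real \<tau> * \<phi> x - laplacian \<phi> x) \<le> (\<bar>\<tau>\<bar> * A + D) / bracket x ^ N" for x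
  proof -
    have "norm (of_real \<tau> * \<phi> x - laplacian \<phi> x) \<le> \<bar>\<tau>\<bar> * norm (\<phi> x) + norm (laplacian \<phi> x)"
      using norm_triangle_ineq4[of "of_real \<tau> * \<phi> x" "laplacian \<phi> x"] by (simp add: norm_mult)
    also have "\<dots> \<le> \<bar>\<tau>\<bar> * (A / bracket x ^ N) + D / bracket x ^ N"
      using A D by (intro add_mono mult_left_mono) auto
    finally show ?thesis by (simp add: add_divide_distrib)
  qed
  then show thesis using that[of "\<bar>\<tau>\<bar> * A + D"] A D by simp
qed

text \<open>The pairing of a slowly growing function with a function of sufficient decay.\<close>

lemma integrable_mult_decay:
  fixes u v :: "plane \<Rightarrow> complex"
  assumes [measurable]: "u \<in> borel_measurable borel" "v \<in> borel_measurable borel"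
    and u: "integrable lborel (\<lambda>x. norm (u x) / bracket x ^ N)"
    and v: "\<And>x. norm (v x) \<le> C / bracket x ^ N"
  shows "integrable lborel (\<lambda>x. u x * v x)"
proof (rule Bochner_Integration.integrable_bound)
  show "integrable lborel (\<lambda>x. C * (norm (u x) / bracket x ^ N))"
    using u by (rule integrable_mult_right)
  have "norm (u x) * norm (v x) \<le> C * (norm (u x) / bracket x ^ N)" for x
    using mult_left_mono[OF v[of x] norm_ge_zero[of "u x"]] by (simp add: mult.commute)
  then show "AE x in lborel. norm (u x * v x) \<le> norm (C * (norm (u x) / bracket x ^ N))"
    by (intro AE_I2) (metis abs_ge_self norm_mult order_trans real_norm_def)
qed simp

lemma integrable_of_decay:
  fixes v :: "plane \<Rightarrow> complex"
  assumes "v \<in> borel_measurable borel" and "\<And>x. norm (v x) \<le> C / bracket x ^ 3"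
  shows "integrable lborel v"
  using integrable_mult_decay[of "\<lambda>x. 1" v 3 C] integrable_inverse_bracket_power[of 3] assms by simp

lemma bounded_slowly_growing:
  fixes v :: "plane \<Rightarrow> complex"
  assumes [measurable]: "v \<in> borel_measurable borel" and "\<And>x. norm (v x) \<le> C"
  shows "v \<in> slowly_growing"
proof -
  have "integrable lborel (\<lambda>x. norm (v x) / bracket x ^ 3)"
  proof (rule Bochner_Integration.integrable_bound)
    show "integrable lborel (\<lambda>x. C * (1 / bracket x ^ 3))"
      by (intro integrable_mult_right integrable_inverse_bracket_power) simp
    have "norm (v x) / bracket x ^ 3 \<le> C * (1 / bracket x ^ 3)" for x
      using assms(2)[of x] bracket_pos[of x] by (simp add: divide_right_mono)
    then show "AE x in lborel. norm (norm (v x) / bracket x ^ 3) \<le> norm (C * (1 / bracket x ^ 3))"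
      by (intro AE_I2) (metis abs_ge_self abs_of_nonneg bracket_pos divide_nonneg_pos norm_ge_zero order_trans
          real_norm_def zero_less_power)
  qed simp
  then show ?thesis unfolding slowly_growing_def by auto
qed

lemma bracket_power_ge_1: "bracket x ^ N \<ge> 1"
  using bracket_ge_1 by (rule one_le_power)

lemma divide_bracket_power_le: "C \<ge> 0 \<Longrightarrow> C / bracket x ^ N \<le> C"
  using bracket_power_ge_1[of x N] mult_left_mono[of 1 "bracket x ^ N" C] bracket_pos[of x]
  by (simp add: divide_le_eq)

lemma schwartz_slowly_growing: "\<phi> \<in> schwartz \<Longrightarrow> \<phi> \<in> slowly_growing"
  by (rule schwartz_decay0[of \<phi> 0])
     (auto intro!: bounded_slowly_growing borel_measurable_schwartz0)

text \<open>Green's identity: \<open>f \<partial>\<^sub>i\<^sup>2 g - (\<partial>\<^sub>i\<^sup>2 f) g\<close> is the \<open>i\<close>-th partial derivative of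
  \<open>F = f \<partial>\<^sub>i g - (\<partial>\<^sub>i f) g\<close> and has integral \<open>0\<close>.\<close>

lemma laplacian_symmetric:
  assumes f: "f \<in> schwartz" and g: "g \<in> schwartz"
  shows "(\<integral>x. f x * laplacian g x \<partial>lborel) = (\<integral>x. laplacian f x * g x \<partial>lborel)"
proof -
  have parts: "(\<integral>x. f x * partial i (partial i g) x \<partial>lborel) = (\<integral>x. partial i (partial i f) x * g x \<partial>lborel)"
    and int: "integrable lborel (\<lambda>x. f x * partial i (partial i g) x)"
      "integrable lborel (\<lambda>x. partial i (partial i f) x * g x)" for i
  proof -
    note [measurable] = borel_measurable_schwartz0[OF f] borel_measurable_schwartz0[OF g]
      borel_measurable_schwartz1[OF f] borel_measurable_schwartz1[OF g]
      borel_measurable_schwartz2[OF f] borel_measurable_schwartz2[OF g]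
    obtain A where A: "A \<ge> 0" "\<And>x. norm (f x) \<le> A / bracket x ^ 3" by (rule schwartz_decay0[OF f, where N = 3]) blast
    obtain A1 where A1: "A1 \<ge> 0" "\<And>x. norm (partial i f x) \<le> A1 / bracket x ^ 3" by (rule schwartz_decay1[OF f, where N = 3]) blast
    obtain A2 where A2: "A2 \<ge> 0" "\<And>x. norm (partial i (partial i f) x) \<le> A2 / bracket x ^ 3"
      by (rule schwartz_decay2[OF f, where N = 3]) blast
    obtain B where B: "B \<ge> 0" "\<And>x. norm (g x) \<le> B / bracket x ^ 3" by (rule schwartz_decay0[OF g, where N = 3]) blast
    obtain B1 where B1: "B1 \<ge> 0" "\<And>x. norm (partial i g x) \<le> B1 / bracket x ^ 3" by (rule schwartz_decay1[OF g, where N = 3]) blast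
    obtain B2 where B2: "B2 \<ge> 0" "\<And>x. norm (partial i (partial i g) x) \<le> B2 / bracket x ^ 3"
      by (rule schwartz_decay2[OF g, where N = 3]) blast
    have prod: "norm (a * b) \<le> P * Q / bracket x ^ 3"
      if "P \<ge> 0" "Q \<ge> 0" "norm a \<le> P / bracket x ^ 3" "norm b \<le> Q / bracket x ^ 3" for a b :: complex and P Q x
    proof -
      have "norm b \<le> Q" using that divide_bracket_power_le order_trans by blast
      then have "norm a * norm b \<le> P / bracket x ^ 3 * Q"
        using that bracket_pos[of x] by (intro mult_mono) auto
      then show ?thesis by (simp add: norm_mult)
    qed
    define F where "F x = f x * partial i g x - partial i f x * g x" for x
    have F': "partial i F x = f x * partial i (partial i g) x - partial i (partial i f) x * g x"
      and Fd: "F differentiable (at x)" for x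
    proof -
      let ?D = "\<lambda>h. frechet_derivative h (at x)"
      have d: "(f has_derivative ?D f) (at x)" "(g has_derivative ?D g) (at x)"
        "(partial i f has_derivative ?D (partial i f)) (at x)" "(partial i g has_derivative ?D (partial i g)) (at x)"
        using f g schwartz_differentiable0 schwartz_differentiable1 frechet_derivative_works by blast+
      have D: "(F has_derivative (\<lambda>h. (f x * ?D (partial i g) h + ?D f h * partial i g x)
          - (partial i f x * ?D g h + ?D (partial i f) h * g x))) (at x)"
        unfolding F_def by (intro has_derivative_diff has_derivative_mult d)
      then show "F differentiable (at x)" by (rule differentiableI)
      show "partial i F x = f x * partial i (partial i g) x - partial i (partial i f) x * g x"
        unfolding partial_eqI[OF D] by (simp add: partial_def)
    qed
    show int1: "integrable lborel (\<lambda>x. f x * partial i (partial i g) x)"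
      using prod[OF A(1) B2(1) A(2) B2(2)] by (intro integrable_of_decay) auto
    show int2: "integrable lborel (\<lambda>x. partial i (partial i f) x * g x)"
      using prod[OF A2(1) B(1) A2(2) B(2)] by (intro integrable_of_decay) auto
    have intF: "integrable lborel F"
      unfolding F_def
    proof (rule Bochner_Integration.integrable_diff)
      show "integrable lborel (\<lambda>x. f x * partial i g x)"
        using prod[OF A(1) B1(1) A(2) B1(2)] by (intro integrable_of_decay) auto
      show "integrable lborel (\<lambda>x. partial i f x * g x)"
        using prod[OF A1(1) B(1) A1(2) B(2)] by (intro integrable_of_decay) auto
    qed
    have "(\<integral>x. partial i F x \<partial>lborel) = 0"
    proof (rule integral_partial_eq_0[OF Fd intF])
      show "partial i F \<in> borel_measurable borel"
        unfolding F'[abs_def] by measurable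
      show "norm (partial i F x) \<le> (A * B2 + A2 * B) / bracket x ^ 3" for x
        unfolding F' add_divide_distrib
        using norm_triangle_ineq4 add_mono[OF prod[OF A(1) B2(1) A(2) B2(2)] prod[OF A2(1) B(1) A2(2) B(2)], of x x]
          order_trans by blast
    qed
    then show "(\<integral>x. f x * partial i (partial i g) x \<partial>lborel) = (\<integral>x. partial i (partial i f) x * g x \<partial>lborel)"
      unfolding F' using int1 int2 by simp
  qed
  show ?thesis
    unfolding laplacian_def sum_2 distrib_left distrib_right using int parts by simp
qed

section \<open>The heat flow of a slowly growing function\<close>

text \<open>Uniform on compact time intervals, as needed to differentiate the heat flow in time.\<close>

lemma heat_dot_bound:
  assumes "0 < a"
  obtains K where "K \<ge> 0" "\<And>t z. a \<le> t \<Longrightarrow> t \<le> b \<Longrightarrow> \<bar>heat_dot t z\<bar> \<le> K / bracket z ^ N"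
proof -
  obtain K where K: "K \<ge> 0" "\<And>t z. a \<le> t \<Longrightarrow> t \<le> b \<Longrightarrow> bracket z ^ (2 + N) * heat t z \<le> K"
    by (rule bracket_power_heat_bounded[OF assms, of b "2 + N"]) blast
  define L where "L = 1 / (4 * a\<^sup>2) + 1 / a"
  have L: "L \<ge> 0" using assms by (simp add: L_def)
  have "\<bar>heat_dot t z\<bar> \<le> L * K / bracket z ^ N" if t: "a \<le> t" "t \<le> b" for t z
  proof -
    have tpos: "t > 0" using assms t by simp
    have "(norm z)\<^sup>2 / (4 * t\<^sup>2) \<le> (bracket z)\<^sup>2 / (4 * a\<^sup>2)"
      using t assms by (intro frac_le mult_left_mono power_mono) (auto simp: norm_le_bracket)
    moreover have "1 / t \<le> (bracket z)\<^sup>2 / a"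
      using t assms by (intro frac_le) (auto simp: bracket_squared)
    moreover have "\<bar>(norm z)\<^sup>2 / (4 * t\<^sup>2) - 1 / t\<bar> \<le> (norm z)\<^sup>2 / (4 * t\<^sup>2) + 1 / t"
      using tpos by (intro abs_triangle_ineq4[THEN order_trans]) simp
    moreover have "(bracket z)\<^sup>2 / (4 * a\<^sup>2) + (bracket z)\<^sup>2 / a = L * (bracket z)\<^sup>2"
      by (simp add: L_def distrib_right)
    ultimately have "\<bar>(norm z)\<^sup>2 / (4 * t\<^sup>2) - 1 / t\<bar> \<le> L * (bracket z)\<^sup>2"
      by linarith
    then have "\<bar>heat_dot t z\<bar> \<le> L * (bracket z)\<^sup>2 * heat t z"
      unfolding heat_dot_def abs_mult using heat_nonneg[OF tpos] by (simp add: mult_right_mono)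
    then have "\<bar>heat_dot t z\<bar> * bracket z ^ N \<le> L * (bracket z)\<^sup>2 * heat t z * bracket z ^ N"
      using bracket_pos[of z] by (intro mult_right_mono) auto
    also have "\<dots> = L * (bracket z ^ (2 + N) * heat t z)"
      by (simp only: power_add mult_ac)
    also have "\<dots> \<le> L * K" using K t L by (intro mult_left_mono) auto
    finally show ?thesis using bracket_pos[of z] by (simp add: pos_le_divide_eq)
  qed
  then show thesis using that[of "L * K"] L K by simp
qed

lemma heat_bound:
  assumes "0 < a"
  obtains K where "K \<ge> 0" "\<And>t z. a \<le> t \<Longrightarrow> t \<le> b \<Longrightarrow> heat t z \<le> K / bracket z ^ N"
proof -
  obtain K where K: "K \<ge> 0" "\<And>t z. a \<le> t \<Longrightarrow> t \<le> b \<Longrightarrow> bracket z ^ N * heat t z \<le> K"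
    by (rule bracket_power_heat_bounded[OF assms, of b N]) blast
  then show thesis using that[of K] bracket_pos by (simp add: pos_le_divide_eq mult.commute)
qed

lemma divide_bracket_translate:
  assumes "K \<ge> 0"
  shows "K / bracket (x - y) ^ N \<le> K * (2 ^ N * bracket y ^ N) / bracket x ^ N"
proof -
  have "K * bracket x ^ N \<le> K * (2 ^ N * bracket y ^ N * bracket (x - y) ^ N)"
    using assms bracket_power_le by (intro mult_left_mono) auto
  then show ?thesis
    using bracket_pos[of x] bracket_pos[of "x - y"] by (simp add: field_simps)
qed

definition heat_flow :: "(plane \<Rightarrow> complex) \<Rightarrow> real \<Rightarrow> plane \<Rightarrow> complex" where
  "heat_flow u t y = (\<integral>x. u x * of_real (heat t (x - y)) \<partial>lborel)"

lemma slowly_growingE: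
  assumes "u \<in> slowly_growing"
  obtains N :: nat where "u \<in> borel_measurable borel" "integrable lborel (\<lambda>x. norm (u x) / bracket x ^ N)"
  using assms by (auto simp: slowly_growing_def)

lemma integrable_heat_flow:
  assumes "u \<in> slowly_growing" "t > 0"
  shows "integrable lborel (\<lambda>x. u x * of_real (heat t (x - y)))"
proof -
  obtain N :: nat where u: "u \<in> borel_measurable borel" "integrable lborel (\<lambda>x. norm (u x) / bracket x ^ N)"
    using assms slowly_growingE by blast
  obtain K where K: "K \<ge> 0" "\<And>s z. t \<le> s \<Longrightarrow> s \<le> t \<Longrightarrow> heat s z \<le> K / bracket z ^ N"
    by (rule heat_bound[OF assms(2), of t N]) blast
  show ?thesis
  proof (rule integrable_mult_decay[OF u(1) _ u(2)])
    show "norm (complex_of_real (heat t (x - y))) \<le> K * (2 ^ N * bracket y ^ N) / bracket x ^ N" for x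
      using K(2)[of t "x - y"] divide_bracket_translate[OF K(1), of x y N] assms by (simp add: heat_nonneg)
  qed measurable
qed

lemma heat_flow_has_derivative:
  assumes "u \<in> slowly_growing" "t > 0"
  shows "((\<lambda>t. heat_flow u t y) has_vector_derivative (\<integral>x. u x * of_real (heat_dot t (x - y)) \<partial>lborel)) (at t)"
proof -
  obtain N :: nat where u: "u \<in> borel_measurable borel" "integrable lborel (\<lambda>x. norm (u x) / bracket x ^ N)"
    using assms slowly_growingE by blast
  note [measurable] = u(1)
  obtain K where K: "K \<ge> 0" "\<And>s z. t / 2 \<le> s \<Longrightarrow> s \<le> 2 * t \<Longrightarrow> \<bar>heat_dot s z\<bar> \<le> K / bracket z ^ N"
    by (rule heat_dot_bound[of "t / 2" "2 * t" N]) (use assms in auto)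
  define L where "L = K * (2 ^ N * bracket y ^ N)"
  show ?thesis
    unfolding heat_flow_def
  proof (rule has_vector_derivative_integral[where a = "t / 2" and b = "2 * t" and w = "\<lambda>x. L * (norm (u x) / bracket x ^ N)"])
    show "integrable lborel (\<lambda>x. L * (norm (u x) / bracket x ^ N))"
      using u by (intro integrable_mult_right)
    fix s :: real assume "s \<in> {t / 2<..<2 * t}"
    then have s: "t / 2 \<le> s" "s \<le> 2 * t" "s > 0" using assms by auto
    show "integrable lborel (\<lambda>x. u x * complex_of_real (heat s (x - y)))"
      using integrable_heat_flow[OF assms(1) s(3)] .
    show "((\<lambda>t. u x * complex_of_real (heat t (x - y))) has_vector_derivative u x * complex_of_real (heat_dot s (x - y))) (at s)" for x
      by (intro has_vector_derivative_mult_right has_vector_derivative_of_real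
          has_real_derivative_iff_has_vector_derivative[THEN iffD1] has_real_derivative_heat s)
    show "norm (u x * complex_of_real (heat_dot s (x - y))) \<le> L * (norm (u x) / bracket x ^ N)" for x
    proof -
      have "\<bar>heat_dot s (x - y)\<bar> \<le> L / bracket x ^ N"
        using K(2)[OF s(1,2), of "x - y"] divide_bracket_translate[OF K(1), of x y N] by (simp add: L_def)
      from mult_left_mono[OF this norm_ge_zero[of "u x"]] show ?thesis
        by (simp add: norm_mult mult.commute)
    qed
  qed (use assms in auto)
qed

text \<open>For \<open>t \<ge> 1\<close> the heat kernel is bounded, so \<open>bracket_power_heat_le\<close> leaves only a power of \<open>1 + t\<close>.\<close>

lemma heat_flow_growth:
  assumes "u \<in> slowly_growing"
  obtains C and N :: nat where "C \<ge> 0" "\<And>t. t \<ge> 1 \<Longrightarrow> norm (heat_flow u t y) \<le> C * (1 + t) ^ N"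
proof -
  obtain N :: nat where u: "u \<in> borel_measurable borel" "integrable lborel (\<lambda>x. norm (u x) / bracket x ^ N)"
    using assms slowly_growingE by blast
  note [measurable] = u(1)
  obtain C where C: "C > 0" "\<And>t z. t > 0 \<Longrightarrow> bracket z ^ N * heat t z \<le> C * (1 + t) ^ N * heat (2 * t) z"
    using bracket_power_heat_le by blast
  define D where "D = 2 ^ N * bracket y ^ N * (\<integral>x. norm (u x) / bracket x ^ N \<partial>lborel)"
  have "D \<ge> 0" using bracket_pos by (auto simp: D_def less_imp_le intro!: mult_nonneg_nonneg integral_nonneg)
  have "norm (heat_flow u t y) \<le> C * D * (1 + t) ^ N" if t: "t \<ge> 1" for t
  proof -
    define E where "E = C * (1 + t) ^ N * (2 ^ N * bracket y ^ N)"
    have bound: "heat t (x - y) \<le> E / bracket x ^ N" for x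
    proof -
      have "1 \<le> pi * t" using pi_gt3 t mult_mono[of 1 pi 1 t] by simp
      then have "1 / (4 * pi * (2 * t)) \<le> 1" by (simp add: field_simps)
      moreover have "heat (2 * t) (x - y) \<le> 1 / (4 * pi * (2 * t))" using t by (intro heat_le) simp
      ultimately have "heat (2 * t) (x - y) \<le> 1" by linarith
      then have "C * (1 + t) ^ N * heat (2 * t) (x - y) \<le> C * (1 + t) ^ N"
        using C t by (simp add: mult_left_le)
      then have "heat t (x - y) \<le> C * (1 + t) ^ N / bracket (x - y) ^ N"
        using C(2)[of t "x - y"] t bracket_pos[of "x - y"] by (simp add: pos_le_divide_eq mult.commute)
      also have "\<dots> \<le> E / bracket x ^ N"
        unfolding E_def using C t by (intro divide_bracket_translate) auto
      finally show ?thesis .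
    qed
    have "norm (heat_flow u t y) \<le> (\<integral>x. E * (norm (u x) / bracket x ^ N) \<partial>lborel)"
      unfolding heat_flow_def
    proof (rule Bochner_Integration.integral_norm_bound_integral)
      show "integrable lborel (\<lambda>x. u x * complex_of_real (heat t (x - y)))"
        using integrable_heat_flow[OF assms] t by simp
      show "integrable lborel (\<lambda>x. E * (norm (u x) / bracket x ^ N))"
        using u by (intro integrable_mult_right)
      show "norm (u x * complex_of_real (heat t (x - y))) \<le> E * (norm (u x) / bracket x ^ N)" for x
        using mult_left_mono[OF bound[of x] norm_ge_zero[of "u x"]] t by (simp add: norm_mult heat_nonneg mult.commute)
    qed
    also have "\<dots> = E * (\<integral>x. norm (u x) / bracket x ^ N \<partial>lborel)"
      by (rule integral_mult_right_zero)
    also have "\<dots> = C * D * (1 + t) ^ N" by (simp add: E_def D_def mult_ac)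
    finally show ?thesis .
  qed
  then show thesis using that[of "C * D" N] C \<open>D \<ge> 0\<close> by simp
qed

text \<open>The heat kernel is an approximate identity: the substitution \<open>x = y + \<surd>t z\<close> moves the time
  dependence from the kernel to \<open>h\<close>, where continuity at the single point \<open>y\<close> is enough.\<close>

lemma heat_flow_tendsto:
  assumes [measurable]: "h \<in> borel_measurable borel" and B: "\<And>x. norm (h x) \<le> B" and cont: "isCont h y"
  shows "((\<lambda>t. heat_flow h t y) \<longlongrightarrow> h y) (at_right 0)"
proof -
  have subst: "heat_flow h t y = (\<integral>z. h (y + sqrt t *\<^sub>R z) * of_real (heat 1 z) \<partial>lborel)" if "t > 0" for t
  proof -
    have "heat_flow h t y = (\<integral>z. t *\<^sub>R (h (y + sqrt t *\<^sub>R z) * of_real (heat t (y + sqrt t *\<^sub>R z - y))) \<partial>lborel)"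
      unfolding heat_flow_def using integral_plane_affine[of "\<lambda>x. h x * of_real (heat t (x - y))" "sqrt t" y] that by simp
    also have "\<dots> = (\<integral>z. h (y + sqrt t *\<^sub>R z) * of_real (heat 1 z) \<partial>lborel)"
    proof (rule Bochner_Integration.integral_cong[OF refl])
      fix z :: plane
      have "t * heat t (sqrt t *\<^sub>R z) = heat 1 z"
        using that by (simp add: heat_def power_mult_distrib)
      then have "complex_of_real t * of_real (heat t (sqrt t *\<^sub>R z)) = of_real (heat 1 z)"
        by (metis of_real_mult)
      then show "t *\<^sub>R (h (y + sqrt t *\<^sub>R z) * of_real (heat t (y + sqrt t *\<^sub>R z - y)))
          = h (y + sqrt t *\<^sub>R z) * of_real (heat 1 z)"
        by (simp add: scaleR_conv_of_real mult.left_commute)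
    qed
    finally show ?thesis .
  qed
  have "((\<lambda>t. \<integral>z. h (y + sqrt t *\<^sub>R z) * of_real (heat 1 z) \<partial>lborel) \<longlongrightarrow> (\<integral>z. h y * of_real (heat 1 z) \<partial>lborel)) (at_right 0)"
  proof (rule integral_dominated_convergence_at[where w = "\<lambda>z. B * heat 1 z"])
    show "integrable lborel (\<lambda>z. B * heat 1 z)"
      using integrable_heat_minus[of 1 0] by (intro integrable_mult_right) simp
    show "AE z in lborel. ((\<lambda>t. h (y + sqrt t *\<^sub>R z) * of_real (heat 1 z)) \<longlongrightarrow> h y * of_real (heat 1 z)) (at_right 0)"
    proof (intro AE_I2 tendsto_mult tendsto_const)
      fix z :: plane
      have "((\<lambda>t. y + sqrt t *\<^sub>R z) \<longlongrightarrow> y + sqrt 0 *\<^sub>R z) (at_right 0)"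
        by (intro tendsto_intros)
      then show "((\<lambda>t. h (y + sqrt t *\<^sub>R z)) \<longlongrightarrow> h y) (at_right 0)"
        using cont isCont_tendsto_compose by fastforce
    qed
    show "\<forall>\<^sub>F t in at_right 0. AE z in lborel. norm (h (y + sqrt t *\<^sub>R z) * of_real (heat 1 z)) \<le> B * heat 1 z"
      using B by (intro always_eventually allI AE_I2) (simp add: norm_mult heat_nonneg mult_right_mono)
  qed auto
  also have "(\<integral>z. h y * of_real (heat 1 z) \<partial>lborel) = h y"
  proof -
    have "(\<integral>z. heat 1 z \<partial>lborel) = 1"
      using nn_integral_heat[of 1] by (subst integral_eq_nn_integral) (auto simp: heat_nonneg)
    then show ?thesis by simp
  qed
  finally show ?thesis
    by (rule Lim_transform_eventually) (use subst in \<open>auto simp: eventually_at_filter\<close>)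
qed

lemma exp_power_tendsto_0:
  fixes \<tau> :: real
  assumes "\<tau> > 0"
  shows "((\<lambda>t. exp (- \<tau> * t) * (1 + t) ^ N) \<longlongrightarrow> 0) at_top"
proof -
  obtain K where K: "K > 0" "\<And>t. t \<ge> 0 \<Longrightarrow> (1 + t) ^ N \<le> K * exp (\<tau> / 2 * t)"
    using power_le_exp[of "\<tau> / 2" N] assms by auto
  have "((\<lambda>t. K * exp (- (\<tau> / 2 * t))) \<longlongrightarrow> 0) at_top"
    using assms by (intro tendsto_mult_right_zero filterlim_compose[OF exp_at_bot]
        filterlim_compose[OF filterlim_uminus_at_bot_at_top] filterlim_tendsto_pos_mult_at_top[OF tendsto_const]
        filterlim_ident) auto
  show ?thesis
  proof (rule tendsto_sandwich[OF _ _ tendsto_const \<open>((\<lambda>t. K * exp (- (\<tau> / 2 * t))) \<longlongrightarrow> 0) at_top\<close>])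
    show "\<forall>\<^sub>F t in at_top. 0 \<le> exp (- \<tau> * t) * (1 + t) ^ N"
      using eventually_ge_at_top[of 0] by eventually_elim auto
    show "\<forall>\<^sub>F t in at_top. exp (- \<tau> * t) * (1 + t) ^ N \<le> K * exp (- (\<tau> / 2 * t))"
      using eventually_ge_at_top[of 0]
    proof eventually_elim
      case (elim t)
      have "exp (- \<tau> * t) * (1 + t) ^ N \<le> exp (- \<tau> * t) * (K * exp (\<tau> / 2 * t))"
        using K elim by (intro mult_left_mono) auto
      also have "\<dots> = K * exp (- (\<tau> / 2 * t))" by (simp flip: exp_add)
      finally show ?case .
    qed
  qed
qed


section \<open>Uniqueness of solutions\<close>

lemma integrable_lborel_pair:
  fixes f :: "'a::euclidean_space \<Rightarrow> 'b::euclidean_space \<Rightarrow> 'c :: {banach, second_countable_topology}"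
  assumes [measurable]: "case_prod f \<in> borel_measurable (borel \<Otimes>\<^sub>M borel)"
    and fin: "(\<integral>\<^sup>+x. (\<integral>\<^sup>+y. ennreal (norm (f x y)) \<partial>lborel) \<partial>lborel) < \<infinity>"
  shows "integrable (lborel \<Otimes>\<^sub>M lborel) (case_prod f)"
proof (rule integrableI_bounded)
  have "(\<integral>\<^sup>+p. ennreal (norm (case_prod f p)) \<partial>(lborel \<Otimes>\<^sub>M lborel))
      = (\<integral>\<^sup>+x. (\<integral>\<^sup>+y. ennreal (norm (case_prod f (x, y))) \<partial>lborel) \<partial>lborel)"
    by (rule lborel.nn_integral_fst[symmetric]) measurable
  then show "(\<integral>\<^sup>+p. ennreal (norm (case_prod f p)) \<partial>(lborel \<Otimes>\<^sub>M lborel)) < \<infinity>"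
    using fin by simp
qed simp

text \<open>The heat equation turns the homogeneous resolvent equation, tested with Gaussians, into the ordinary
  differential equation \<open>H' = \<tau> H\<close> for the heat flow at a fixed point. Its nonzero solutions grow exponentially,
  the heat flow of a slowly growing function only polynomially.\<close>

lemma heat_flow_eq_0:
  assumes u: "u \<in> slowly_growing" and \<tau>: "\<tau> > 0"
    and eq: "\<And>\<phi>. \<phi> \<in> schwartz \<Longrightarrow> (\<integral>x. u x * (of_real \<tau> * \<phi> x - laplacian \<phi> x) \<partial>lborel) = 0"
    and t: "t > 0"
  shows "heat_flow u t y = 0"
proof -
  obtain N :: nat where N: "u \<in> borel_measurable borel" "integrable lborel (\<lambda>x. norm (u x) / bracket x ^ N)"
    using u slowly_growingE by blast
  note [measurable] = N(1)
  have deriv: "(\<integral>x. u x * of_real (heat_dot s (x - y)) \<partial>lborel) = of_real \<tau> * heat_flow u s y" if s: "s > 0" for s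
  proof -
    obtain K where K: "K \<ge> 0" "\<And>r z. s \<le> r \<Longrightarrow> r \<le> s \<Longrightarrow> \<bar>heat_dot r z\<bar> \<le> K / bracket z ^ N"
      by (rule heat_dot_bound[OF s, of s N]) blast
    have int: "integrable lborel (\<lambda>x. u x * of_real (heat_dot s (x - y)))"
    proof (rule integrable_mult_decay[OF N(1) _ N(2)])
      show "norm (complex_of_real (heat_dot s (x - y))) \<le> K * (2 ^ N * bracket y ^ N) / bracket x ^ N" for x
        using K(2)[of s "x - y"] divide_bracket_translate[OF K(1), of x y N] by simp
    qed measurable
    have "0 = (\<integral>x. of_real \<tau> * (u x * of_real (heat s (x - y))) - u x * of_real (heat_dot s (x - y)) \<partial>lborel)"
      using eq[OF schwartz_heat[OF that, of y]] unfolding laplacian_heat[OF that]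
      by (simp add: right_diff_distrib mult.left_commute)
    also have "\<dots> = of_real \<tau> * heat_flow u s y - (\<integral>x. u x * of_real (heat_dot s (x - y)) \<partial>lborel)"
      using int integrable_heat_flow[OF u that] by (simp add: heat_flow_def)
    finally show ?thesis by simp
  qed
  \<comment> \<open>\<open>g\<close> is constant by the differential equation and tends to \<open>0\<close> by the growth bound.\<close>
  define g where "g s = exp (- \<tau> * s) *\<^sub>R heat_flow u s y" for s
  have "(g has_vector_derivative 0) (at s within {0<..})" if "s \<in> {0<..}" for s
  proof -
    have s: "s > 0" using that by simp
    have "((\<lambda>s. exp (- \<tau> * s)) has_real_derivative exp (- \<tau> * s) * (- \<tau>)) (at s)"
      by (auto intro!: derivative_eq_intros)
    from has_vector_derivative_scaleR[OF this heat_flow_has_derivative[OF u s, of y]]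
    have "(g has_vector_derivative 0) (at s)"
      unfolding deriv[OF s] g_def by (simp add: scaleR_conv_of_real)
    then show ?thesis by (rule has_vector_derivative_at_within)
  qed
  then obtain c where c: "\<And>s. s \<in> {0<..} \<Longrightarrow> g s = c"
    using has_vector_derivative_zero_constant[of "{0<..}" g] by auto
  obtain C and M :: nat where C: "C \<ge> 0" "\<And>s. s \<ge> 1 \<Longrightarrow> norm (heat_flow u s y) \<le> C * (1 + s) ^ M"
    by (rule heat_flow_growth[OF u]) blast
  have "((\<lambda>s. C * (exp (- \<tau> * s) * (1 + s) ^ M)) \<longlongrightarrow> C * 0) at_top"
    by (intro tendsto_mult tendsto_const exp_power_tendsto_0 \<tau>)
  moreover have "\<forall>\<^sub>F s in at_top. norm c \<le> C * (exp (- \<tau> * s) * (1 + s) ^ M)"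
    using eventually_ge_at_top[of 1]
  proof eventually_elim
    case (elim s)
    then have "c = exp (- \<tau> * s) *\<^sub>R heat_flow u s y"
      using c[of s] by (simp add: g_def)
    then have "norm c = exp (- \<tau> * s) * norm (heat_flow u s y)"
      by (simp only: norm_scaleR abs_exp_cancel)
    also have "\<dots> \<le> exp (- \<tau> * s) * (C * (1 + s) ^ M)"
      using C(2)[OF elim] by (intro mult_left_mono) auto
    finally show ?case by (simp add: mult.left_commute)
  qed
  ultimately have "norm c \<le> C * 0"
    by (intro tendsto_lowerbound[of _ _ at_top]) auto
  then have "g t = 0" using c[of t] t by simp
  then show ?thesis by (simp add: g_def)
qed

lemma frontier_box_AE: "AE x in lborel. x \<notin> frontier (box a b :: plane set)"
proof -
  have "frontier (box a b) \<in> null_sets (lborel :: plane measure)"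
    using negligible_convex_frontier[OF convex_box(2), of a b]
    by (auto simp: null_sets_completion_iff negligible_iff_null_sets)
  then show ?thesis by (rule AE_not_in)
qed

lemma indicator_box_decay:
  obtains D where "D \<ge> 0" "\<And>x::plane. indicator (box a b) x \<le> D / bracket x ^ N"
proof -
  have "bounded (box a b)" by simp
  then obtain B where B: "\<And>y. y \<in> box a b \<Longrightarrow> norm y \<le> B" by (auto simp: bounded_iff)
  have "indicator (box a b) x \<le> sqrt (1 + B\<^sup>2) ^ N / bracket x ^ N" for x
  proof (cases "x \<in> box a b")
    case True
    have "bracket x \<le> sqrt (1 + B\<^sup>2)"
      unfolding bracket_def using B[OF True] by (simp add: power_mono)
    then have "bracket x ^ N \<le> sqrt (1 + B\<^sup>2) ^ N"
      using bracket_pos[of x] by (intro power_mono) auto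
    then show ?thesis using True bracket_pos[of x] by (simp add: pos_le_divide_eq)
  qed (use bracket_pos[of x] in \<open>simp add: less_imp_le\<close>)
  then show thesis using that[of "sqrt (1 + B\<^sup>2) ^ N"] by simp
qed

text \<open>The heat flow of a box is bounded, uniformly for \<open>t \<le> 1\<close>, by any power of \<open>1/\<langle>x\<rangle>\<close>; this is the
  domination which allows \<open>t \<longrightarrow> 0\<close> against a slowly growing function.\<close>

lemma heat_integral_over_box_bound:
  obtains K where "K \<ge> 0"
    "\<And>t x. 0 < t \<Longrightarrow> t \<le> 1 \<Longrightarrow> (\<integral>\<^sup>+y. ennreal (indicator (box a b) y * heat t (x - y)) \<partial>lborel) \<le> ennreal (K / bracket (x::plane) ^ N)"
proof -
  obtain C where C: "C > 0" "\<And>t z. t > 0 \<Longrightarrow> bracket z ^ N * heat t z \<le> C * (1 + t) ^ N * heat (2 * t) z"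
    using bracket_power_heat_le by blast
  obtain E where E: "E \<ge> 0" "\<And>y::plane. indicator (box a b) y \<le> E / bracket y ^ N"
    by (rule indicator_box_decay[of a b N]) blast
  define D where "D = 2 ^ N * E"
  have D: "D \<ge> 0" using E by (simp add: D_def)
  have "(\<integral>\<^sup>+y. ennreal (indicator (box a b) y * heat t (x - y)) \<partial>lborel) \<le> ennreal (D * C * 2 ^ N / bracket x ^ N)"
    if t: "0 < t" "t \<le> 1" for t x
  proof -
    have "indicator (box a b) y * heat t (x - y) \<le> D * C * 2 ^ N / bracket x ^ N * heat (2 * t) (y - x)" for y
    proof (cases "y \<in> box a b")
      case True
      have "bracket y ^ N \<le> E"
        using E(2)[of y] True bracket_pos[of y] by (simp add: pos_le_divide_eq)
      then have "2 ^ N * bracket y ^ N * bracket (x - y) ^ N \<le> D * bracket (x - y) ^ N"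
        unfolding D_def using bracket_pos[of "x - y"] by (intro mult_right_mono mult_left_mono) auto
      then have "bracket x ^ N \<le> D * bracket (x - y) ^ N"
        using bracket_power_le[of x N y] by linarith
      then have "bracket x ^ N * heat t (x - y) \<le> D * bracket (x - y) ^ N * heat t (x - y)"
        using heat_nonneg[OF t(1)] by (rule mult_right_mono)
      also have "\<dots> \<le> D * (C * (1 + t) ^ N * heat (2 * t) (x - y))"
        using C(2)[OF t(1), of "x - y"] D by (simp add: mult.assoc mult_left_mono)
      also have "\<dots> \<le> D * (C * 2 ^ N * heat (2 * t) (x - y))"
        using C D t by (intro mult_left_mono mult_right_mono power_mono) (auto simp: heat_nonneg)
      finally have "heat t (x - y) \<le> D * (C * 2 ^ N * heat (2 * t) (x - y)) / bracket x ^ N"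
        using bracket_pos[of x] by (simp add: pos_le_divide_eq mult.commute)
      then show ?thesis using True by (simp add: heat_minus_commute[of _ x] mult.assoc)
    qed (use C D t bracket_pos[of x] in \<open>simp add: heat_nonneg less_imp_le\<close>)
    then have "(\<integral>\<^sup>+y. ennreal (indicator (box a b) y * heat t (x - y)) \<partial>lborel)
        \<le> (\<integral>\<^sup>+y. ennreal (D * C * 2 ^ N / bracket x ^ N) * ennreal (heat (2 * t) (y - x)) \<partial>lborel)"
      using C D t bracket_pos[of x]
      by (intro nn_integral_mono) (simp add: ennreal_leI heat_nonneg less_imp_le flip: ennreal_mult'')
    also have "\<dots> = ennreal (D * C * 2 ^ N / bracket x ^ N)"
      using t by (simp add: nn_integral_cmult nn_integral_heat_minus)
    finally show ?thesis .
  qed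
  then show thesis using that[of "D * C * 2 ^ N"] C D by simp
qed

text \<open>The heat kernel is symmetric, so the heat flow can be moved from \<open>u\<close> to the indicator \<open>h\<close> of the
  box. The heat flow of \<open>h\<close> tends to \<open>h\<close> off the boundary of the box, a null set.\<close>

lemma integral_box_eq_0:
  assumes u: "u \<in> slowly_growing" and zero: "\<And>t y. t > 0 \<Longrightarrow> heat_flow u t y = 0"
  shows "(\<integral>x. u x * indicator (box a b) x \<partial>lborel) = 0"
proof -
  obtain N :: nat where N: "u \<in> borel_measurable borel" "integrable lborel (\<lambda>x. norm (u x) / bracket x ^ N)"
    using u slowly_growingE by blast
  note [measurable] = N(1)
  define h :: "plane \<Rightarrow> complex" where "h = indicator (box a b)"
  have [measurable]: "h \<in> borel_measurable borel" by (simp add: h_def)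
  have h_norm: "norm (h y) = indicator (box a b) y" for y by (simp add: h_def indicator_def)
  obtain K where K: "K \<ge> 0" "\<And>t x. 0 < t \<Longrightarrow> t \<le> 1 \<Longrightarrow>
      (\<integral>\<^sup>+y. ennreal (indicator (box a b) y * heat t (x - y)) \<partial>lborel) \<le> ennreal (K / bracket x ^ N)"
    by (rule heat_integral_over_box_bound[of a b N]) blast
  have bound: "norm (u x * heat_flow h t x) \<le> K * (norm (u x) / bracket x ^ N)" if t: "0 < t" "t \<le> 1" for t x
  proof -
    have "ennreal (norm (heat_flow h t x)) \<le> (\<integral>\<^sup>+y. ennreal (norm (h y * of_real (heat t (y - x)))) \<partial>lborel)"
      unfolding heat_flow_def by (rule integral_norm_bound_ennreal)
        (rule integrable_heat_flow[OF _ t(1)], rule bounded_slowly_growing[of _ 1], auto simp: h_norm)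
    also have "\<dots> \<le> ennreal (K / bracket x ^ N)"
      using K(2)[OF t, of x] t by (simp add: norm_mult h_norm heat_nonneg heat_minus_commute[of _ x])
    finally have "norm (heat_flow h t x) \<le> K / bracket x ^ N"
      using K bracket_pos[of x] by (subst (asm) ennreal_le_iff) (auto simp: less_imp_le)
    from mult_left_mono[OF this norm_ge_zero[of "u x"]] show ?thesis
      by (simp add: norm_mult mult.commute)
  qed
  have flow0: "(\<integral>x. u x * heat_flow h t x \<partial>lborel) = 0" if t: "0 < t" "t \<le> 1" for t
  proof -
    define k where "k x y = u x * (h y * of_real (heat t (y - x)))" for x y
    have "integrable (lborel \<Otimes>\<^sub>M lborel) (case_prod k)"
    proof (rule integrable_lborel_pair)
      show "case_prod k \<in> borel_measurable (borel \<Otimes>\<^sub>M borel)" unfolding k_def by measurable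
      have "(\<integral>\<^sup>+y. ennreal (norm (k x y)) \<partial>lborel) \<le> ennreal (K * (norm (u x) / bracket x ^ N))" for x
      proof -
        have "(\<integral>\<^sup>+y. ennreal (norm (k x y)) \<partial>lborel)
            = ennreal (norm (u x)) * (\<integral>\<^sup>+y. ennreal (indicator (box a b) y * heat t (x - y)) \<partial>lborel)"
          using t by (subst nn_integral_cmult[symmetric])
            (auto intro!: nn_integral_cong simp: k_def norm_mult h_norm heat_nonneg heat_minus_commute[of _ x] ennreal_mult')
        also have "\<dots> \<le> ennreal (norm (u x)) * ennreal (K / bracket x ^ N)"
          by (intro mult_left_mono K t) simp
        finally show ?thesis by (simp add: mult.commute flip: ennreal_mult')
      qed
      then have "(\<integral>\<^sup>+x. (\<integral>\<^sup>+y. ennreal (norm (k x y)) \<partial>lborel) \<partial>lborel) \<le> (\<integral>\<^sup>+x. ennreal (K * (norm (u x) / bracket x ^ N)) \<partial>lborel)"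
        by (intro nn_integral_mono)
      also have "\<dots> < \<infinity>"
        using integrable_mult_right[OF N(2), of K] K bracket_pos
        by (auto simp: integrable_iff_bounded less_imp_le abs_mult)
      finally show "(\<integral>\<^sup>+x. (\<integral>\<^sup>+y. ennreal (norm (k x y)) \<partial>lborel) \<partial>lborel) < \<infinity>" .
    qed
    then have "(\<integral>x. (\<integral>y. k x y \<partial>lborel) \<partial>lborel) = (\<integral>y. (\<integral>x. k x y \<partial>lborel) \<partial>lborel)"
      by (rule lborel_pair.Fubini_integral[symmetric])
    moreover have "(\<integral>y. k x y \<partial>lborel) = u x * heat_flow h t x" for x
      by (simp add: k_def heat_flow_def)
    moreover have "(\<integral>x. k x y \<partial>lborel) = h y * heat_flow u t y" for y
      by (simp add: k_def heat_flow_def heat_minus_commute[of _ y] mult.left_commute)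
    ultimately show ?thesis using zero[OF t(1)] by simp
  qed
  have near0: "\<forall>\<^sub>F t in at_right 0. 0 < t \<and> t \<le> (1::real)"
    unfolding eventually_at_right_field by (rule exI[of _ 1]) auto
  have "((\<lambda>t. \<integral>x. u x * heat_flow h t x \<partial>lborel) \<longlongrightarrow> (\<integral>x. u x * h x \<partial>lborel)) (at_right 0)"
  proof (rule integral_dominated_convergence_at[where w = "\<lambda>x. K * (norm (u x) / bracket x ^ N)"])
    show "integrable lborel (\<lambda>x. K * (norm (u x) / bracket x ^ N))"
      using N by (intro integrable_mult_right)
    show "AE x in lborel. ((\<lambda>t. u x * heat_flow h t x) \<longlongrightarrow> u x * h x) (at_right 0)"
      using frontier_box_AE[of a b]
    proof eventually_elim
      case (elim x)
      have "isCont (\<lambda>x. complex_of_real (indicator (box a b) x)) x"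
        using elim isCont_indicator[of x "box a b"] by (intro continuous_intros) auto
      moreover have "(\<lambda>x. complex_of_real (indicator (box a b) x)) = h"
        by (auto simp: h_def indicator_def)
      ultimately have "isCont h x" by simp
      then show ?case
        using heat_flow_tendsto[of h 1 x] by (intro tendsto_mult tendsto_const) (auto simp: h_norm)
    qed
    show "\<forall>\<^sub>F t in at_right 0. AE x in lborel. norm (u x * heat_flow h t x) \<le> K * (norm (u x) / bracket x ^ N)"
      using near0 by eventually_elim (use bound in auto)
    show "\<forall>\<^sub>F t in at_right 0. (\<lambda>x. u x * heat_flow h t x) \<in> borel_measurable lborel"
      by (intro always_eventually allI) (unfold heat_flow_def, measurable)
  qed measurable
  moreover have "((\<lambda>t. \<integral>x. u x * heat_flow h t x \<partial>lborel) \<longlongrightarrow> 0) (at_right 0)"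
    by (rule Lim_transform_eventually[OF tendsto_const]) (use near0 flow0 in \<open>auto elim!: eventually_mono\<close>)
  ultimately show ?thesis
    using tendsto_unique[of "at_right (0::real)"] by (auto simp: h_def)
qed

text \<open>On a fixed box \<open>u\<close> is integrable, and the Borel sets over which the integral of its restriction
  vanishes form a Dynkin system containing the boxes, which are stable under intersection and generate.\<close>

lemma AE_eq_0_if_box_integrals_eq_0:
  assumes u: "u \<in> slowly_growing" and zero: "\<And>a b. (\<integral>x. u x * indicator (box a b) x \<partial>lborel) = 0"
  shows "AE x in lborel. u x = 0"
proof -
  obtain N :: nat where N: "u \<in> borel_measurable borel" "integrable lborel (\<lambda>x. norm (u x) / bracket x ^ N)"
    using u slowly_growingE by blast
  note [measurable] = N(1)
  have "AE x in lborel. u x * indicator (box a b) x = 0" for a b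
  proof (rule sigma_finite_measure.density_zero[OF sigma_finite_lborel])
    obtain D where D: "\<And>x::plane. indicator (box a b) x \<le> D / bracket x ^ N"
      by (rule indicator_box_decay[of a b N]) blast
    show int: "integrable lborel (\<lambda>x. u x * indicator (box a b) x)"
    proof (rule integrable_mult_decay[OF N(1) _ N(2)])
      show "norm (indicator (box a b) x :: complex) \<le> D / bracket x ^ N" for x
        using D[of x] by (cases "x \<in> box a b") simp_all
    qed simp
    fix A assume A: "A \<in> sets (lborel :: plane measure)"
    let ?v = "\<lambda>x. u x * indicator (box a b) x"
    have gen: "A \<in> sigma_sets UNIV (range (\<lambda>(a, b). box a b))"
      using A unfolding sets_lborel borel_eq_box by simp
    have "Int_stable (range (\<lambda>(a, b). box a b :: plane set))"
      by (auto simp: Int_stable_def box_Int_box)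
    moreover have "range (\<lambda>(a, b). box a b :: plane set) \<subseteq> Pow UNIV" by auto
    ultimately have "A \<in> sets borel \<and> (\<integral>x. indicator A x *\<^sub>R ?v x \<partial>lborel) = 0"
      using gen
    proof (induction rule: sigma_sets_induct_disjoint)
      case (basic A)
      then obtain c d where A: "A = box c d" by auto
      have "A \<inter> box a b \<in> range (\<lambda>(a, b). box a b)" unfolding A by (auto simp: box_Int_box)
      then obtain c' d' where "A \<inter> box a b = box c' d'" by auto
      then have "indicator A x *\<^sub>R ?v x = u x * indicator (box c' d') x" for x
        by (auto simp: indicator_def set_eq_iff)
      then show ?case using zero A by simp
    next
      case empty
      show ?case by simp
    next
      case (compl A)
      then have [measurable]: "A \<in> sets borel" by simp
      have "indicator (UNIV - A) x *\<^sub>R ?v x = ?v x - indicator A x *\<^sub>R ?v x" for x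
        by (simp add: indicator_def)
      moreover have "integrable lborel (\<lambda>x. indicator A x *\<^sub>R ?v x)"
        using int by (intro integrable_mult_indicator) auto
      ultimately show ?case using compl zero int by simp
    next
      case (union F)
      then have [measurable]: "\<And>i. F i \<in> sets borel" by blast
      have "(\<integral>x. indicator (\<Union>i. F i) x *\<^sub>R ?v x \<partial>lborel) = (\<Sum>i. \<integral>x. indicator (F i) x *\<^sub>R ?v x \<partial>lborel)"
      proof -
        have "set_lebesgue_integral lborel (\<Union>i. F i) ?v = (\<Sum>i. set_lebesgue_integral lborel (F i) ?v)"
        proof (rule lebesgue_integral_countable_add)
          show "set_integrable lborel (\<Union>i. F i) ?v"
            unfolding set_integrable_def using int by (intro integrable_mult_indicator) auto
        qed (use union.hyps in \<open>auto simp: disjoint_family_on_def\<close>)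
        then show ?thesis by (simp add: set_lebesgue_integral_def)
      qed
      then show ?case using union by simp
    qed
    then show "set_lebesgue_integral lborel A ?v = 0" by (simp add: set_lebesgue_integral_def)
  qed
  then have "AE x in lborel. \<forall>n::nat. u x * indicator (box (- (real n *\<^sub>R One)) (real n *\<^sub>R One)) x = 0"
    unfolding AE_all_countable by blast
  then show ?thesis
  proof eventually_elim
    case (elim x)
    have "x \<in> (\<Union>n::nat. box (- (real n *\<^sub>R One)) (real n *\<^sub>R One))" using UN_box_eq_UNIV by auto
    then obtain n :: nat where "x \<in> box (- (real n *\<^sub>R One)) (real n *\<^sub>R One)" by blast
    then show ?case using elim[rule_format, of n] by simp
  qed
qed

lemma slowly_growing_diff:
  assumes "u \<in> slowly_growing" "v \<in> slowly_growing"
  shows "(\<lambda>x. u x - v x) \<in> slowly_growing"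
proof -
  obtain N :: nat where u: "u \<in> borel_measurable borel" "integrable lborel (\<lambda>x. norm (u x) / bracket x ^ N)"
    using assms(1) slowly_growingE by blast
  obtain M :: nat where v: "v \<in> borel_measurable borel" "integrable lborel (\<lambda>x. norm (v x) / bracket x ^ M)"
    using assms(2) slowly_growingE by blast
  note [measurable] = u(1) v(1)
  have "integrable lborel (\<lambda>x. norm (u x - v x) / bracket x ^ (N + M))"
  proof (rule Bochner_Integration.integrable_bound[OF Bochner_Integration.integrable_add[OF u(2) v(2)]])
    have "norm (u x - v x) / bracket x ^ (N + M) \<le> norm (u x) / bracket x ^ N + norm (v x) / bracket x ^ M" for x
    proof -
      have "norm (u x - v x) / bracket x ^ (N + M) \<le> (norm (u x) + norm (v x)) / bracket x ^ (N + M)"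
        using bracket_pos[of x] by (intro divide_right_mono norm_triangle_ineq4) (auto simp: less_imp_le)
      also have "\<dots> \<le> norm (u x) / bracket x ^ N + norm (v x) / bracket x ^ M"
        unfolding add_divide_distrib using bracket_ge_1[of x] bracket_pos[of x]
        by (intro add_mono divide_left_mono power_increasing) auto
      finally show ?thesis .
    qed
    then show "AE x in lborel. norm (norm (u x - v x) / bracket x ^ (N + M))
        \<le> norm (norm (u x) / bracket x ^ N + norm (v x) / bracket x ^ M)"
      using bracket_pos by (intro AE_I2) (simp add: less_imp_le add_nonneg_nonneg)
  qed measurable
  then show ?thesis unfolding slowly_growing_def by auto
qed

lemma integrable_slowly_growing_test:
  assumes "u \<in> slowly_growing" "\<phi> \<in> schwartz"
  shows "integrable lborel (\<lambda>x. u x * (of_real \<tau> * \<phi> x - laplacian \<phi> x))"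
proof -
  obtain N :: nat where u: "u \<in> borel_measurable borel" "integrable lborel (\<lambda>x. norm (u x) / bracket x ^ N)"
    using assms(1) slowly_growingE by blast
  obtain C where C: "\<And>x. norm (of_real \<tau> * \<phi> x - laplacian \<phi> x) \<le> C / bracket x ^ N"
    by (rule resolvent_test_decay[OF assms(2), where N = N and \<tau> = \<tau>]) blast
  note [measurable] = u(1) borel_measurable_schwartz0[OF assms(2)] borel_measurable_laplacian[OF assms(2)]
  show ?thesis
    by (rule integrable_mult_decay[OF u(1) _ u(2) C]) measurable
qed

lemma resolvent_eq_unique:
  assumes \<tau>: "\<tau> > 0" and "solves_resolvent_eq \<tau> f u" "solves_resolvent_eq \<tau> f v"
  shows "AE x in lborel. u x = v x"
proof -
  have u: "u \<in> slowly_growing" and v: "v \<in> slowly_growing"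
    using assms by (auto simp: solves_resolvent_eq_def)
  define w where "w x = u x - v x" for x
  have w: "w \<in> slowly_growing" unfolding w_def[abs_def] using u v by (rule slowly_growing_diff)
  have "(\<integral>x. w x * (of_real \<tau> * \<phi> x - laplacian \<phi> x) \<partial>lborel) = 0" if "\<phi> \<in> schwartz" for \<phi>
    using assms(2,3) that integrable_slowly_growing_test[OF u that, of \<tau>] integrable_slowly_growing_test[OF v that, of \<tau>]
    by (simp add: w_def left_diff_distrib solves_resolvent_eq_def)
  then have "heat_flow w t y = 0" if "t > 0" for t y
    using heat_flow_eq_0[OF w \<tau> _ that] by blast
  then have "AE x in lborel. w x = 0"
    by (intro AE_eq_0_if_box_integrals_eq_0[OF w] integral_box_eq_0[OF w])
  then show ?thesis by (simp add: w_def)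
qed


section \<open>Existence of solutions\<close>

definition green_conv :: "real \<Rightarrow> (plane \<Rightarrow> complex) \<Rightarrow> plane \<Rightarrow> complex" where
  "green_conv \<tau> f x = (\<integral>y. f y * of_real (green \<tau> (x - y)) \<partial>lborel)"

lemma borel_measurable_green_conv [measurable]:
  assumes [measurable]: "f \<in> borel_measurable borel"
  shows "green_conv \<tau> f \<in> borel_measurable borel"
  unfolding green_conv_def by measurable

text \<open>Peetre's inequality moves the decay of \<open>v\<close> to \<open>f\<close> at the price of a polynomial weight on the
  kernel. With \<open>v = 1/\<langle>x\<rangle>\<^sup>N\<close> this yields the slow growth of the convolution, with a test function in place
  of \<open>v\<close> the exchange of integrals in the weak equation.\<close>

lemma integrable_green_pair:
  fixes f v :: "plane \<Rightarrow> complex"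
  assumes \<tau>: "\<tau> > 0" and [measurable]: "f \<in> borel_measurable borel" "v \<in> borel_measurable borel"
    and f: "integrable lborel (\<lambda>x. norm (f x) / bracket x ^ N)"
    and C: "C \<ge> 0" and v: "\<And>x. norm (v x) \<le> C / bracket x ^ N"
  shows "integrable (lborel \<Otimes>\<^sub>M lborel) (\<lambda>(y, x). v x * (f y * of_real (green \<tau> (x - y))))"
proof (rule integrable_lborel_pair)
  show "(\<lambda>(y, x). v x * (f y * of_real (green \<tau> (x - y)))) \<in> borel_measurable (borel \<Otimes>\<^sub>M borel)" by measurable
  obtain K where K: "K \<ge> 0" "(\<integral>\<^sup>+z. ennreal (bracket z ^ N * green \<tau> z) \<partial>lborel) \<le> ennreal K"
    by (rule nn_integral_bracket_power_green[OF \<tau>, of N]) blast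
  define L where "L = C * 2 ^ N"
  have inner: "(\<integral>\<^sup>+x. ennreal (norm (v x * (f y * of_real (green \<tau> (x - y))))) \<partial>lborel)
      \<le> ennreal (L * K * (norm (f y) / bracket y ^ N))" for y
  proof -
    have "norm (v x * (f y * of_real (green \<tau> (x - y))))
        \<le> L * (norm (f y) / bracket y ^ N) * (bracket (x - y) ^ N * green \<tau> (x - y))" for x
    proof -
      have "C * bracket y ^ N \<le> C * (2 ^ N * bracket x ^ N * bracket (x - y) ^ N)"
        using bracket_power_le[of y N x] C by (intro mult_left_mono) (simp_all add: bracket_minus_commute[of y])
      then have "C / bracket x ^ N \<le> L / bracket y ^ N * bracket (x - y) ^ N"
        using bracket_pos[of x] bracket_pos[of y] by (simp add: L_def field_simps)
      then have "norm (v x) \<le> L / bracket y ^ N * bracket (x - y) ^ N"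
        using v[of x] by linarith
      then have "norm (v x) * (norm (f y) * green \<tau> (x - y))
          \<le> L / bracket y ^ N * bracket (x - y) ^ N * (norm (f y) * green \<tau> (x - y))"
        by (intro mult_right_mono mult_nonneg_nonneg green_nonneg) auto
      then show ?thesis by (simp add: norm_mult green_nonneg mult_ac)
    qed
    then have "(\<integral>\<^sup>+x. ennreal (norm (v x * (f y * of_real (green \<tau> (x - y))))) \<partial>lborel)
        \<le> (\<integral>\<^sup>+x. ennreal (L * (norm (f y) / bracket y ^ N)) * ennreal (bracket (x - y) ^ N * green \<tau> (x - y)) \<partial>lborel)"
      using C bracket_pos by (intro nn_integral_mono)
        (simp add: L_def ennreal_leI less_imp_le flip: ennreal_mult')
    also have "\<dots> = ennreal (L * (norm (f y) / bracket y ^ N)) * (\<integral>\<^sup>+z. ennreal (bracket z ^ N * green \<tau> z) \<partial>lborel)"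
      using nn_integral_plane_minus(2)[of "\<lambda>z. ennreal (bracket z ^ N * green \<tau> z)" y]
      by (simp add: nn_integral_cmult)
    also have "\<dots> \<le> ennreal (L * (norm (f y) / bracket y ^ N)) * ennreal K"
      using K by (intro mult_left_mono) auto
    finally show ?thesis
      using C K bracket_pos[of y] by (simp add: L_def mult_ac flip: ennreal_mult')
  qed
  have "(\<integral>\<^sup>+y. (\<integral>\<^sup>+x. ennreal (norm (v x * (f y * of_real (green \<tau> (x - y))))) \<partial>lborel) \<partial>lborel)
      \<le> (\<integral>\<^sup>+y. ennreal (L * K * (norm (f y) / bracket y ^ N)) \<partial>lborel)"
    by (intro nn_integral_mono inner)
  also have "\<dots> < \<infinity>"
    using integrable_mult_right[OF f, of "L * K"] K C bracket_pos
    by (auto simp: integrable_iff_bounded less_imp_le abs_mult L_def)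
  finally show "(\<integral>\<^sup>+y. (\<integral>\<^sup>+x. ennreal (norm (v x * (f y * of_real (green \<tau> (x - y))))) \<partial>lborel) \<partial>lborel) < \<infinity>" .
qed

lemma green_conv_slowly_growing:
  assumes \<tau>: "\<tau> > 0" and "f \<in> slowly_growing"
  shows "green_conv \<tau> f \<in> slowly_growing"
proof -
  obtain N :: nat where f: "f \<in> borel_measurable borel" "integrable lborel (\<lambda>x. norm (f x) / bracket x ^ N)"
    using assms(2) slowly_growingE by blast
  note [measurable] = f(1)
  let ?v = "\<lambda>x. complex_of_real (1 / bracket x ^ N)"
  have "norm (?v x) \<le> 1 / bracket x ^ N" for x
    using bracket_pos[of x] by (simp add: norm_divide norm_power)
  then have "integrable (lborel \<Otimes>\<^sub>M lborel) (\<lambda>(y, x). ?v x * (f y * of_real (green \<tau> (x - y))))"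
    using f by (intro integrable_green_pair[OF \<tau>, where C = 1 and N = N]) auto
  from lborel_pair.integrable_snd[OF this]
  have "integrable lborel (\<lambda>x. ?v x * green_conv \<tau> f x)"
    by (simp add: green_conv_def)
  then have "integrable lborel (\<lambda>x. norm (?v x * green_conv \<tau> f x))" by (rule integrable_norm)
  moreover have "norm (?v x * green_conv \<tau> f x) = norm (green_conv \<tau> f x) / bracket x ^ N" for x
    using bracket_pos[of x] by (simp add: norm_divide norm_power norm_mult)
  ultimately show ?thesis
    unfolding slowly_growing_def by auto
qed

lemma heat_flow_norm_le:
  assumes [measurable]: "h \<in> borel_measurable borel" and B: "\<And>x. norm (h x) \<le> B" and t: "t > 0"
  shows "norm (heat_flow h t y) \<le> B"
proof -
  have "norm (heat_flow h t y) \<le> (\<integral>x. B * heat t (x - y) \<partial>lborel)"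
    unfolding heat_flow_def
  proof (rule Bochner_Integration.integral_norm_bound_integral)
    show "integrable lborel (\<lambda>x. h x * complex_of_real (heat t (x - y)))"
      by (rule integrable_heat_flow[OF bounded_slowly_growing[OF assms(1) B] t])
    show "norm (h x * complex_of_real (heat t (x - y))) \<le> B * heat t (x - y)" for x
      using B[of x] t by (simp add: norm_mult heat_nonneg mult_right_mono)
  qed (use integrable_heat_minus[OF t] in simp)
  also have "(\<integral>x. heat t (x - y) \<partial>lborel) = 1"
    using nn_integral_heat_minus[OF t] t by (subst integral_eq_nn_integral) (auto simp: heat_nonneg)
  then have "(\<integral>x. B * heat t (x - y) \<partial>lborel) = B" by simp
  finally show ?thesis .
qed

text \<open>The integrand is the derivative of \<open>F(t) = - e\<^sup>-\<^sup>\<tau>\<^sup>t (h\<^sub>t * \<phi>)(y)\<close>: the time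
  derivative falls on the heat kernel, becomes its Laplacian, and is moved to \<open>\<phi>\<close> by Green's identity.
  The value at \<open>t = 0\<close> is \<open>- \<phi>(y)\<close> by the approximate identity, and \<open>F\<close> vanishes at infinity.\<close>

lemma integral_exp_heat_flow_test:
  assumes \<phi>: "\<phi> \<in> schwartz" and \<tau>: "\<tau> > 0"
  defines "\<psi> \<equiv> \<lambda>x. of_real \<tau> * \<phi> x - laplacian \<phi> x"
  shows "(\<integral>t. indicator {0<..} t *\<^sub>R (exp (- \<tau> * t) *\<^sub>R heat_flow \<psi> t y) \<partial>lborel) = \<phi> y"
proof -
  note [measurable] = borel_measurable_schwartz0[OF \<phi>] borel_measurable_laplacian[OF \<phi>]
  have \<psi>m[measurable]: "\<psi> \<in> borel_measurable borel" unfolding \<psi>_def by measurable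
  obtain A where A: "A \<ge> 0" "\<And>x. norm (\<phi> x) \<le> A / bracket x ^ 0" by (rule schwartz_decay0[OF \<phi>, where N = 0]) blast
  obtain D where D: "D \<ge> 0" "\<And>x. norm (laplacian \<phi> x) \<le> D / bracket x ^ 0" by (rule laplacian_decay[OF \<phi>, where N = 0]) blast
  obtain B where "B \<ge> 0" "\<And>x. norm (\<psi> x) \<le> B / bracket x ^ 0"
    unfolding \<psi>_def by (rule resolvent_test_decay[OF \<phi>, where N = 0 and \<tau> = \<tau>]) blast
  then have B: "\<And>x. norm (\<psi> x) \<le> B" by simp
  have sg: "\<phi> \<in> slowly_growing" "laplacian \<phi> \<in> slowly_growing" "\<psi> \<in> slowly_growing"
    using \<phi> bounded_slowly_growing[OF \<psi>m B] bounded_slowly_growing[of "laplacian \<phi>" D] D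
    by (auto intro: schwartz_slowly_growing)
  define f where "f t = exp (- \<tau> * t) *\<^sub>R heat_flow \<psi> t y" for t
  define F where "F t = - (exp (- \<tau> * t) *\<^sub>R heat_flow \<phi> t y)" for t
  have deriv: "(F has_vector_derivative f t) (at t)" if t: "t > 0" for t
  proof -
    have "(\<integral>x. \<phi> x * of_real (heat_dot t (x - y)) \<partial>lborel) = heat_flow (laplacian \<phi>) t y"
      using laplacian_symmetric[OF \<phi> schwartz_heat[OF t, of y]] by (simp add: laplacian_heat[OF t] heat_flow_def)
    then have H: "((\<lambda>t. heat_flow \<phi> t y) has_vector_derivative heat_flow (laplacian \<phi>) t y) (at t)"
      using heat_flow_has_derivative[OF sg(1) t, of y] by simp
    have "((\<lambda>s. exp (- \<tau> * s)) has_real_derivative exp (- \<tau> * t) * (- \<tau>)) (at t)"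
      by (auto intro!: derivative_eq_intros)
    from has_vector_derivative_minus[OF has_vector_derivative_scaleR[OF this H]]
    have "(F has_vector_derivative - (exp (- \<tau> * t) *\<^sub>R heat_flow (laplacian \<phi>) t y + (exp (- \<tau> * t) * (- \<tau>)) *\<^sub>R heat_flow \<phi> t y)) (at t)"
      unfolding F_def .
    also have "- (exp (- \<tau> * t) *\<^sub>R heat_flow (laplacian \<phi>) t y + (exp (- \<tau> * t) * (- \<tau>)) *\<^sub>R heat_flow \<phi> t y) = f t"
    proof -
      have "heat_flow \<psi> t y = of_real \<tau> * heat_flow \<phi> t y - heat_flow (laplacian \<phi>) t y"
        using integrable_heat_flow[OF sg(1) t, of y] integrable_heat_flow[OF sg(2) t, of y]
        by (simp add: heat_flow_def \<psi>_def left_diff_distrib mult.assoc)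
      then show ?thesis by (simp add: f_def scaleR_conv_of_real mult.left_commute right_diff_distrib)
    qed
    finally show ?thesis .
  qed
  have int: "integrable lborel (\<lambda>t. indicator {0<..} t *\<^sub>R f t)"
  proof (rule Bochner_Integration.integrable_bound)
    show "integrable lborel (\<lambda>t. B * (indicator {0<..} t * exp (- \<tau> * t)))"
    proof (rule integrable_mult_right, rule integrableI_bounded)
      show "(\<integral>\<^sup>+t. ennreal (norm (indicator {0<..} t * exp (- \<tau> * t))) \<partial>lborel) < \<infinity>"
        using nn_integral_exp_scaled[OF \<tau>] by simp
    qed simp
    have "norm (indicator {0<..} t *\<^sub>R f t) \<le> B * (indicator {0<..} t * exp (- \<tau> * t))" for t
    proof (cases "t > 0")
      case True
      show ?thesis
        using True heat_flow_norm_le[OF \<psi>m B True, of y] by (simp add: f_def mult.commute mult_left_mono)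
    qed simp
    then show "AE t in lborel. norm (indicator {0<..} t *\<^sub>R f t) \<le> norm (B * (indicator {0<..} t * exp (- \<tau> * t)))"
      by (intro AE_I2) (metis abs_ge_self order_trans real_norm_def)
    show "(\<lambda>t. indicator {0<..} t *\<^sub>R f t) \<in> borel_measurable lborel"
      unfolding f_def heat_flow_def by measurable
  qed
  have "(LBINT t=0..\<infinity>. f t) = 0 - (- \<phi> y)"
  proof (rule interval_integral_FTC_integrable)
    show "(0::ereal) < \<infinity>" by simp
    fix t :: real assume "0 < ereal t"
    then have t: "t > 0" by simp
    show "(F has_vector_derivative f t) (at t)" by (rule deriv[OF t])
    show "isCont f t"
      unfolding f_def using has_vector_derivative_continuous[OF heat_flow_has_derivative[OF sg(3) t, of y]]
      by (intro continuous_intros)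
  next
    show "set_integrable lborel (einterval 0 \<infinity>) f"
      using int by (simp add: set_integrable_def zero_ereal_def)
    have "((\<lambda>t. - (exp (- \<tau> * t) *\<^sub>R heat_flow \<phi> t y)) \<longlongrightarrow> - (exp (- \<tau> * 0) *\<^sub>R \<phi> y)) (at_right 0)"
      using heat_flow_tendsto[of \<phi> A y] A schwartz_differentiable0[OF \<phi>, of y] differentiable_imp_continuous_within
      by (intro tendsto_intros) auto
    then have "(F \<longlongrightarrow> - \<phi> y) (at_right 0)" by (simp add: F_def[abs_def])
    then show "((F \<circ> real_of_ereal) \<longlongrightarrow> - \<phi> y) (at_right 0)"
      by (simp add: zero_ereal_def ereal_tendsto_simps)
    have "(F \<longlongrightarrow> 0) at_top"
    proof (rule Lim_null_comparison)
      show "((\<lambda>t. A * (exp (- \<tau> * t) * (1 + t) ^ 0)) \<longlongrightarrow> 0) at_top"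
        by (intro tendsto_mult_right_zero exp_power_tendsto_0 \<tau>)
      show "\<forall>\<^sub>F t in at_top. norm (F t) \<le> A * (exp (- \<tau> * t) * (1 + t) ^ 0)"
        using eventually_gt_at_top[of 0]
      proof eventually_elim
        case (elim t)
        then show ?case
          using heat_flow_norm_le[of \<phi> A t y] A by (simp add: F_def mult.commute mult_left_mono)
      qed
    qed
    then show "((F \<circ> real_of_ereal) \<longlongrightarrow> 0) (at_left \<infinity>)"
      by (simp add: ereal_tendsto_simps)
  qed
  then show ?thesis
    by (simp add: interval_lebesgue_integral_def set_lebesgue_integral_def zero_ereal_def f_def)
qed

lemma integral_green_test:
  assumes \<phi>: "\<phi> \<in> schwartz" and \<tau>: "\<tau> > 0"
  defines "\<psi> \<equiv> \<lambda>x. of_real \<tau> * \<phi> x - laplacian \<phi> x"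
  shows "(\<integral>x. \<psi> x * of_real (green \<tau> (x - y)) \<partial>lborel) = \<phi> y"
proof -
  note [measurable] = borel_measurable_schwartz0[OF \<phi>] borel_measurable_laplacian[OF \<phi>]
  have \<psi>m[measurable]: "\<psi> \<in> borel_measurable borel" unfolding \<psi>_def by measurable
  obtain B where "B \<ge> 0" "\<And>x. norm (\<psi> x) \<le> B / bracket x ^ 0"
    unfolding \<psi>_def by (rule resolvent_test_decay[OF \<phi>, where N = 0 and \<tau> = \<tau>]) blast
  then have B: "\<And>x. norm (\<psi> x) \<le> B" by simp
  define k where "k t x = \<psi> x * complex_of_real (damped_heat \<tau> t (x - y))" for t x
  have "integrable (lborel \<Otimes>\<^sub>M lborel) (case_prod k)"
  proof (rule integrable_lborel_pair)
    show "case_prod k \<in> borel_measurable (borel \<Otimes>\<^sub>M borel)" unfolding k_def by measurable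
    have "(\<integral>\<^sup>+x. ennreal (norm (k t x)) \<partial>lborel) \<le> ennreal B * ennreal (indicator {0<..} t * exp (- \<tau> * t))" for t
    proof (cases "t > 0")
      case True
      have "(\<integral>\<^sup>+x. ennreal (norm (k t x)) \<partial>lborel) \<le> (\<integral>\<^sup>+x. ennreal (B * exp (- \<tau> * t)) * ennreal (heat t (x - y)) \<partial>lborel)"
      proof (rule nn_integral_mono)
        fix x
        have "norm (k t x) \<le> B * exp (- \<tau> * t) * heat t (x - y)"
          using B[of x] True by (simp add: k_def norm_mult damped_heat_def heat_nonneg mult.assoc mult_right_mono)
        then show "ennreal (norm (k t x)) \<le> ennreal (B * exp (- \<tau> * t)) * ennreal (heat t (x - y))"
          using \<open>B \<ge> 0\<close> by (simp add: ennreal_leI flip: ennreal_mult')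
      qed
      also have "\<dots> = ennreal (B * exp (- \<tau> * t))"
        using True by (simp add: nn_integral_cmult nn_integral_heat_minus)
      finally show ?thesis using True \<open>B \<ge> 0\<close> by (simp add: ennreal_mult')
    qed (simp add: k_def damped_heat_def)
    then have "(\<integral>\<^sup>+t. (\<integral>\<^sup>+x. ennreal (norm (k t x)) \<partial>lborel) \<partial>lborel)
        \<le> (\<integral>\<^sup>+t. ennreal B * ennreal (indicator {0<..} t * exp (- \<tau> * t)) \<partial>lborel)"
      by (intro nn_integral_mono)
    also have "\<dots> = ennreal B * ennreal (1 / \<tau>)"
      using nn_integral_exp_scaled[OF \<tau>] by (subst nn_integral_cmult) simp_all
    also have "\<dots> < \<infinity>" by (simp add: ennreal_mult_less_top)
    finally show "(\<integral>\<^sup>+t. (\<integral>\<^sup>+x. ennreal (norm (k t x)) \<partial>lborel) \<partial>lborel) < \<infinity>" .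
  qed
  then have Fubini: "(\<integral>x. (\<integral>t. k t x \<partial>lborel) \<partial>lborel) = (\<integral>t. (\<integral>x. k t x \<partial>lborel) \<partial>lborel)"
    by (rule lborel_pair.Fubini_integral)
  have inner_t: "(\<integral>t. k t x \<partial>lborel) = \<psi> x * of_real (green \<tau> (x - y))" for x
    by (simp add: k_def green_def)
  have inner_x: "(\<integral>x. k t x \<partial>lborel) = indicator {0<..} t *\<^sub>R (exp (- \<tau> * t) *\<^sub>R heat_flow \<psi> t y)" for t
  proof -
    have "(\<integral>x. k t x \<partial>lborel) = (\<integral>x. (indicator {0<..} t * exp (- \<tau> * t)) *\<^sub>R (\<psi> x * of_real (heat t (x - y))) \<partial>lborel)"
      by (intro Bochner_Integration.integral_cong refl) (simp add: k_def damped_heat_def scaleR_conv_of_real mult_ac)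
    then show ?thesis by (simp add: heat_flow_def)
  qed
  show ?thesis
    using Fubini integral_exp_heat_flow_test[OF \<phi> \<tau>, of y] unfolding inner_t inner_x \<psi>_def by simp
qed

text \<open>Fubini moves the kernel, which is even, from \<open>f\<close> to the test function.\<close>

lemma green_conv_solves:
  assumes \<tau>: "\<tau> > 0" and f: "f \<in> slowly_growing"
  shows "solves_resolvent_eq \<tau> f (green_conv \<tau> f)"
  unfolding solves_resolvent_eq_def
proof (intro conjI ballI f green_conv_slowly_growing \<tau>)
  fix \<phi> assume \<phi>: "\<phi> \<in> schwartz"
  obtain N :: nat where N: "f \<in> borel_measurable borel" "integrable lborel (\<lambda>x. norm (f x) / bracket x ^ N)"
    using f slowly_growingE by blast
  define \<psi> where "\<psi> x = of_real \<tau> * \<phi> x - laplacian \<phi> x" for x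
  obtain C where C: "C \<ge> 0" "\<And>x. norm (\<psi> x) \<le> C / bracket x ^ N"
    unfolding \<psi>_def by (rule resolvent_test_decay[OF \<phi>, where N = N and \<tau> = \<tau>]) blast
  note [measurable] = borel_measurable_schwartz0[OF \<phi>] borel_measurable_laplacian[OF \<phi>]
  have [measurable]: "\<psi> \<in> borel_measurable borel" unfolding \<psi>_def by measurable
  have "integrable (lborel \<Otimes>\<^sub>M lborel) (\<lambda>(y, x). \<psi> x * (f y * of_real (green \<tau> (x - y))))"
    by (intro integrable_green_pair[OF \<tau> N(1) _ N(2) C]) auto
  then have Fubini: "(\<integral>x. (\<integral>y. \<psi> x * (f y * of_real (green \<tau> (x - y))) \<partial>lborel) \<partial>lborel)
      = (\<integral>y. (\<integral>x. \<psi> x * (f y * of_real (green \<tau> (x - y))) \<partial>lborel) \<partial>lborel)"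
    by (rule lborel_pair.Fubini_integral)
  have inner_y: "(\<integral>y. \<psi> x * (f y * of_real (green \<tau> (x - y))) \<partial>lborel) = green_conv \<tau> f x * \<psi> x" for x
    by (simp add: green_conv_def mult.commute)
  have inner_x: "(\<integral>x. \<psi> x * (f y * of_real (green \<tau> (x - y))) \<partial>lborel) = f y * \<phi> y" for y
  proof -
    have "(\<integral>x. \<psi> x * (f y * of_real (green \<tau> (x - y))) \<partial>lborel) = (\<integral>x. f y * (\<psi> x * of_real (green \<tau> (x - y))) \<partial>lborel)"
      by (simp only: mult_ac)
    also have "\<dots> = f y * (\<integral>x. \<psi> x * of_real (green \<tau> (x - y)) \<partial>lborel)" by (rule integral_mult_right_zero)
    also have "(\<integral>x. \<psi> x * of_real (green \<tau> (x - y)) \<partial>lborel) = \<phi> y"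
      unfolding \<psi>_def by (rule integral_green_test[OF \<phi> \<tau>])
    finally show ?thesis .
  qed
  show "(\<integral>x. green_conv \<tau> f x * (of_real \<tau> * \<phi> x - laplacian \<phi> x) \<partial>lborel) = (\<integral>x. f x * \<phi> x \<partial>lborel)"
    using Fubini unfolding inner_y inner_x unfolding \<psi>_def .
qed

lemma resolvent_eq_green_conv:
  assumes "\<tau> > 0" "f \<in> slowly_growing"
  shows "resolvent \<tau> f \<in> borel_measurable borel" "AE x in lborel. resolvent \<tau> f x = green_conv \<tau> f x"
proof -
  have R: "solves_resolvent_eq \<tau> f (resolvent \<tau> f)"
    unfolding resolvent_def using green_conv_solves[OF assms] someI[of "solves_resolvent_eq \<tau> f"] by blast
  then show "resolvent \<tau> f \<in> borel_measurable borel"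
    by (auto simp: solves_resolvent_eq_def slowly_growing_def)
  show "AE x in lborel. resolvent \<tau> f x = green_conv \<tau> f x"
    using resolvent_eq_unique[OF assms(1) R green_conv_solves[OF assms]] .
qed

section \<open>Lebesgue space estimates\<close>

lemma Lp_nn_integral:
  assumes "f \<in> Lp p"
  shows "f \<in> borel_measurable borel"
    "(\<integral>\<^sup>+x. ennreal (norm (f x) powr p) \<partial>lborel) = ennreal (\<integral>x. norm (f x) powr p \<partial>lborel)"
  using assms by (auto simp: Lp_def intro!: nn_integral_eq_integral)

lemma Lp_normI:
  fixes g :: "plane \<Rightarrow> complex"
  assumes [measurable]: "g \<in> borel_measurable borel" and "p > 0" "M \<ge> 0"
    and le: "(\<integral>\<^sup>+x. ennreal (norm (g x) powr p) \<partial>lborel) \<le> ennreal (M powr p)"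
  shows "g \<in> Lp p \<and> Lp_norm p g \<le> M"
proof -
  have int: "integrable lborel (\<lambda>x. norm (g x) powr p)"
    using le le_less_trans[OF le] by (intro integrableI_bounded) auto
  then have "ennreal (\<integral>x. norm (g x) powr p \<partial>lborel) \<le> ennreal (M powr p)"
    using le by (simp add: nn_integral_eq_integral)
  then have "(\<integral>x. norm (g x) powr p \<partial>lborel) \<le> M powr p" by simp
  then have "Lp_norm p g \<le> (M powr p) powr (1 / p)"
    unfolding Lp_norm_def using assms by (intro powr_mono2) auto
  also have "\<dots> = M" using assms by (simp add: powr_powr)
  finally show ?thesis using int by (simp add: Lp_def)
qed

text \<open>\<open>|f| \<le> 1 + |f|\<^sup>p\<close>, and the weight \<open>\<langle>x\<rangle>\<^sup>-\<^sup>3\<close> makes the constant integrable.\<close>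

lemma Lp_slowly_growing:
  assumes "f \<in> Lp p" "p \<ge> 1"
  shows "f \<in> slowly_growing"
proof -
  have [measurable]: "f \<in> borel_measurable borel" and int: "integrable lborel (\<lambda>x. norm (f x) powr p)"
    using assms by (auto simp: Lp_def)
  have "integrable lborel (\<lambda>x. norm (f x) / bracket x ^ 3)"
  proof (rule Bochner_Integration.integrable_bound)
    show "integrable lborel (\<lambda>x. 1 / bracket x ^ 3 + norm (f x) powr p)"
      using int by (intro Bochner_Integration.integrable_add integrable_inverse_bracket_power) auto
    have "norm (f x) / bracket x ^ 3 \<le> 1 / bracket x ^ 3 + norm (f x) powr p" for x
    proof (cases "norm (f x) \<le> 1")
      case True
      then show ?thesis using bracket_pos[of x] by (intro add_increasing2) (auto simp: divide_right_mono)
    next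
      case False
      then have "norm (f x) \<le> norm (f x) powr p" using assms powr_mono[of 1 p "norm (f x)"] by simp
      moreover have "norm (f x) / bracket x ^ 3 \<le> norm (f x)" by (simp add: divide_bracket_power_le)
      ultimately show ?thesis using bracket_pos[of x] by (intro add_increasing) (auto simp: less_imp_le)
    qed
    then show "AE x in lborel. norm (norm (f x) / bracket x ^ 3) \<le> norm (1 / bracket x ^ 3 + norm (f x) powr p)"
      using bracket_pos by (intro AE_I2) (simp add: less_imp_le add_nonneg_nonneg)
  qed measurable
  then show ?thesis unfolding slowly_growing_def by auto
qed

text \<open>Young's inequality with a weight. Hoelder's inequality for the three functions \<open>G(x - y) |f(y)|\<^sup>p\<close>,
  \<open>G(x - y)\<close> and \<open>|f(y)|\<^sup>p\<close> of \<open>y\<close>, where \<open>G = green\<close> to the power \<open>1/s\<close>, with the exponents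
  \<open>\<theta>\<close>, \<open>s - \<theta>\<close> and \<open>1 - s\<close>, bounds the convolution at \<open>x\<close> by a constant times \<open>j(x)\<close> to the power \<open>\<theta>\<close>,
  where \<open>j = G * |f|\<^sup>p\<close> is integrable. A second application, in \<open>x\<close>, combines \<open>j\<close> with the weight \<open>W\<close>
  using \<open>1/q = \<theta> + \<delta>\<close>. The case \<open>\<delta> = 0\<close> is Young's inequality; \<open>\<theta> = 0\<close> is a bound of the
  convolution in \<open>L\<^sup>\<infinity>\<close> followed by integration of the weight.\<close>

lemma green_conv_weighted_estimate:
  assumes s: "0 < s" "s \<le> 1" and pq: "1 \<le> p" "1 \<le> q" and ex: "0 \<le> \<theta>" "0 \<le> \<delta>" "1 / p = \<theta> + (1 - s)" "1 / q = \<theta> + \<delta>"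
    and W: "W \<in> borel_measurable borel" "\<And>x. 0 \<le> W x" "0 \<le> K" "(\<integral>\<^sup>+x. ennreal (W x) \<partial>lborel) \<le> ennreal K"
    and a: "0 \<le> a" "(\<integral>\<^sup>+x. ennreal (green \<tau> x powr (1 / s)) \<partial>lborel) \<le> ennreal (a powr (1 / s))"
    and f: "f \<in> Lp p"
  shows "(\<integral>\<^sup>+x. ennreal ((W x powr \<delta> * norm (green_conv \<tau> f x)) powr q) \<partial>lborel)
    \<le> ennreal ((K powr \<delta> * a * Lp_norm p f) powr q)"
proof -
  have [measurable]: "f \<in> borel_measurable borel" "W \<in> borel_measurable borel" using Lp_nn_integral[OF f] W by auto
  define A where "A = a powr (1 / s)"
  define B where "B = (\<integral>x. norm (f x) powr p \<partial>lborel)"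
  have B: "B \<ge> 0" "(\<integral>\<^sup>+x. ennreal (norm (f x) powr p) \<partial>lborel) = ennreal B"
    using Lp_nn_integral[OF f] by (auto simp: B_def)
  have A: "A \<ge> 0" by (simp add: A_def)
  have "1 / p \<le> 1" using pq by simp
  then have "\<theta> \<le> s" using ex by simp
  define G where "G z = green \<tau> z powr (1 / s)" for z
  define H where "H y = norm (f y) powr p" for y
  have [measurable]: "G \<in> borel_measurable borel" "H \<in> borel_measurable borel" unfolding G_def H_def by measurable
  have G: "(\<integral>\<^sup>+y. ennreal (G (x - y)) \<partial>lborel) \<le> ennreal A" for x
    using nn_integral_plane_minus(1)[of "\<lambda>z. ennreal (G z)" x] a(2) by (simp add: G_def A_def)
  have G': "(\<integral>\<^sup>+x. ennreal (G (x - y)) \<partial>lborel) \<le> ennreal A" for y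
    using nn_integral_plane_minus(2)[of "\<lambda>z. ennreal (G z)" y] a(2) by (simp add: G_def A_def)
  define J where "J x = (\<integral>\<^sup>+y. ennreal (G (x - y) * H y) \<partial>lborel)" for x
  have [measurable]: "J \<in> borel_measurable borel" unfolding J_def by measurable
  have J: "(\<integral>\<^sup>+x. J x \<partial>lborel) \<le> ennreal (A * B)"
  proof -
    have "(\<integral>\<^sup>+x. J x \<partial>lborel) = (\<integral>\<^sup>+y. (\<integral>\<^sup>+x. ennreal (G (x - y) * H y) \<partial>lborel) \<partial>lborel)"
      unfolding J_def by (intro lborel_pair.Fubini') measurable
    also have "\<dots> = (\<integral>\<^sup>+y. (\<integral>\<^sup>+x. ennreal (G (x - y)) \<partial>lborel) * ennreal (H y) \<partial>lborel)"
      by (intro nn_integral_cong) (simp add: G_def H_def ennreal_mult' nn_integral_multc)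
    also have "\<dots> \<le> (\<integral>\<^sup>+y. ennreal A * ennreal (H y) \<partial>lborel)"
      by (intro nn_integral_mono mult_right_mono G') simp
    also have "\<dots> = ennreal (A * B)"
      using B A by (simp add: nn_integral_cmult H_def ennreal_mult')
    finally show ?thesis .
  qed
  define j where "j x = enn2real (J x)" for x
  have [measurable]: "j \<in> borel_measurable borel" unfolding j_def by measurable
  have J_fin: "AE x in lborel. J x = ennreal (j x)"
  proof -
    have "AE x in lborel. J x \<noteq> \<infinity>"
      using J by (intro nn_integral_PInf_AE) (auto simp: top_unique)
    then show ?thesis by eventually_elim (simp add: j_def less_top)
  qed
  have j: "(\<integral>\<^sup>+x. ennreal (j x) \<partial>lborel) \<le> ennreal (A * B)"
  proof -
    have "(\<integral>\<^sup>+x. ennreal (j x) \<partial>lborel) = (\<integral>\<^sup>+x. J x \<partial>lborel)"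
      using J_fin by (intro nn_integral_cong_AE) auto
    then show ?thesis using J by simp
  qed
  define M where "M = A powr (s - \<theta>) * B powr (1 - s)"
  have M: "M \<ge> 0" by (simp add: M_def)
  have pointwise: "norm (green_conv \<tau> f x) \<le> j x powr \<theta> * M" if Jx: "J x = ennreal (j x)" for x
  proof -
    have split: "(G (x - y) * H y) powr \<theta> * G (x - y) powr (s - \<theta>) * H y powr (1 - s) = norm (f y) * green \<tau> (x - y)" for y
    proof -
      have "p * \<theta> + p * (1 - s) = p * (1 / p)" unfolding ex(3) by (simp add: distrib_left)
      then have "p * \<theta> + p * (1 - s) = 1" using pq by simp
      then have 1: "norm (f y) powr (p * \<theta>) * norm (f y) powr (p * (1 - s)) = norm (f y)"
        by (simp flip: powr_add)
      have "1 / s * \<theta> + 1 / s * (s - \<theta>) = 1" using s by (simp add: field_simps)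
      then have 2: "green \<tau> (x - y) powr (1 / s * \<theta>) * green \<tau> (x - y) powr (1 / s * (s - \<theta>)) = green \<tau> (x - y)"
        using green_nonneg[of \<tau> "x - y"] by (simp flip: powr_add)
      have "(G (x - y) * H y) powr \<theta> * G (x - y) powr (s - \<theta>) * H y powr (1 - s)
          = (norm (f y) powr (p * \<theta>) * norm (f y) powr (p * (1 - s)))
            * (green \<tau> (x - y) powr (1 / s * \<theta>) * green \<tau> (x - y) powr (1 / s * (s - \<theta>)))"
        by (simp only: G_def H_def powr_mult powr_powr powr_ge_zero mult_ac)
      then show ?thesis unfolding 1 2 .
    qed
    have "(\<integral>\<^sup>+y. ennreal ((G (x - y) * H y) powr \<theta> * G (x - y) powr (s - \<theta>) * H y powr (1 - s)) \<partial>lborel)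
        \<le> ennreal (j x powr \<theta> * A powr (s - \<theta>) * B powr (1 - s))"
      using ex \<open>\<theta> \<le> s\<close> s A B Jx G[of x]
      by (intro nn_integral_Hoelder3) (auto simp: G_def H_def j_def J_def)
    then have le: "(\<integral>\<^sup>+y. ennreal (norm (f y * of_real (green \<tau> (x - y)))) \<partial>lborel) \<le> ennreal (j x powr \<theta> * M)"
      unfolding split by (simp add: norm_mult green_nonneg M_def mult.assoc)
    have int: "integrable lborel (\<lambda>y. f y * complex_of_real (green \<tau> (x - y)))"
      using le_less_trans[OF le] by (intro integrableI_bounded) auto
    have "ennreal (norm (green_conv \<tau> f x)) \<le> ennreal (j x powr \<theta> * M)"
      unfolding green_conv_def using integral_norm_bound_ennreal[OF int] le by (rule order_trans)
    then show ?thesis using M by simp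
  qed
  have "(\<integral>\<^sup>+x. ennreal ((W x powr \<delta> * norm (green_conv \<tau> f x)) powr q) \<partial>lborel)
      \<le> (\<integral>\<^sup>+x. ennreal (M powr q) * ennreal (j x powr (\<theta> * q) * W x powr (\<delta> * q)) \<partial>lborel)"
  proof (rule nn_integral_mono_AE)
    show "AE x in lborel. ennreal ((W x powr \<delta> * norm (green_conv \<tau> f x)) powr q)
      \<le> ennreal (M powr q) * ennreal (j x powr (\<theta> * q) * W x powr (\<delta> * q))"
      using J_fin
    proof eventually_elim
      case (elim x)
      have "(W x powr \<delta> * norm (green_conv \<tau> f x)) powr q \<le> (W x powr \<delta> * (j x powr \<theta> * M)) powr q"
        using pointwise[OF elim] pq by (intro powr_mono2 mult_left_mono) auto
      also have "\<dots> = M powr q * (j x powr (\<theta> * q) * W x powr (\<delta> * q))"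
        using M by (simp add: powr_mult powr_powr)
      finally show ?case by (simp add: ennreal_leI flip: ennreal_mult')
    qed
  qed
  also have "\<dots> = ennreal (M powr q) * (\<integral>\<^sup>+x. ennreal (j x powr (\<theta> * q) * W x powr (\<delta> * q)) \<partial>lborel)"
    by (simp add: nn_integral_cmult)
  also have "\<dots> \<le> ennreal (M powr q) * ennreal ((A * B) powr (\<theta> * q) * K powr (\<delta> * q))"
  proof (intro mult_left_mono nn_integral_Hoelder2)
    have "\<theta> * q + \<delta> * q = 1 / q * q" unfolding ex(4) by (simp add: distrib_right)
    then show "\<theta> * q + \<delta> * q = 1" using pq by simp
  qed (use ex pq A B j W in \<open>auto simp: j_def\<close>)
  also have "\<dots> = ennreal ((K powr \<delta> * a * Lp_norm p f) powr q)"
  proof -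
    have "M powr q * ((A * B) powr (\<theta> * q) * K powr (\<delta> * q))
        = (K powr \<delta> * (A powr \<theta> * A powr (s - \<theta>)) * (B powr \<theta> * B powr (1 - s))) powr q"
      using A B W by (simp add: M_def powr_mult powr_powr mult_ac)
    also have "A powr \<theta> * A powr (s - \<theta>) = a"
    proof -
      have "\<theta> / s + (s - \<theta>) / s = 1" using s by (simp flip: add_divide_distrib)
      then show ?thesis using a by (simp add: A_def powr_powr flip: powr_add)
    qed
    also have "B powr \<theta> * B powr (1 - s) = Lp_norm p f"
      unfolding Lp_norm_def B_def ex(3) by (simp flip: powr_add)
    finally show ?thesis by (simp flip: ennreal_mult')
  qed
  finally show ?thesis .
qed

text \<open>The common form of the unweighted estimate (\<open>\<delta> = 0\<close>) and of the estimate with the weight after the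
  resolvent (\<open>p = q\<close>, \<open>\<delta> = 1 - s\<close>).\<close>

lemma resolvent_weighted_estimate:
  assumes s: "0 < s" "s \<le> 1" and pq: "1 \<le> p" "1 \<le> q" and ex: "0 \<le> \<theta>" "0 \<le> \<delta>" "1 / p = \<theta> + (1 - s)" "1 / q = \<theta> + \<delta>"
    and b: "b > 2" "b * \<delta> \<le> a"
  shows "\<exists>C>0. \<forall>\<tau>>0. \<forall>f\<in>Lp p. bracket_mult a (resolvent \<tau> f) \<in> Lp q \<and>
    Lp_norm q (bracket_mult a (resolvent \<tau> f)) \<le> C * \<tau> powr (- s) * Lp_norm p f"
proof -
  obtain c where c: "c > 0" "\<And>\<tau>. \<tau> > 0 \<Longrightarrow>
      (\<integral>\<^sup>+x. ennreal (green \<tau> x powr (1 / s)) \<partial>lborel) \<le> ennreal ((c * \<tau> powr (- s)) powr (1 / s))"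
    using green_Lr_norm[OF s] by blast
  define W where "W x = bracket x powr (- b)" for x
  have [measurable]: "W \<in> borel_measurable borel" unfolding W_def by measurable
  obtain K where K: "K > 0" "(\<integral>\<^sup>+x. ennreal (W x) \<partial>lborel) \<le> ennreal K"
    unfolding W_def by (rule nn_integral_bracket_powr_le[OF b(1)])
  show ?thesis
  proof (intro exI[of _ "K powr \<delta> * c"] conjI allI impI ballI)
    show "0 < K powr \<delta> * c" using K c by simp
    fix \<tau> :: real and f assume \<tau>: "\<tau> > 0" and f: "f \<in> Lp p"
    have sg: "f \<in> slowly_growing" using f pq(1) by (rule Lp_slowly_growing)
    note R = resolvent_eq_green_conv[OF \<tau> sg]
    note [measurable] = R(1)
    have meas: "bracket_mult a (resolvent \<tau> f) \<in> borel_measurable borel"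
      unfolding bracket_mult_def by measurable
    have nonneg: "0 \<le> Lp_norm p f" by (simp add: Lp_norm_def)
    have "(\<integral>\<^sup>+x. ennreal (norm (bracket_mult a (resolvent \<tau> f) x) powr q) \<partial>lborel)
        \<le> (\<integral>\<^sup>+x. ennreal ((W x powr \<delta> * norm (green_conv \<tau> f x)) powr q) \<partial>lborel)"
    proof (rule nn_integral_mono_AE)
      show "AE x in lborel. ennreal (norm (bracket_mult a (resolvent \<tau> f) x) powr q)
        \<le> ennreal ((W x powr \<delta> * norm (green_conv \<tau> f x)) powr q)"
        using R(2)
      proof eventually_elim
        case (elim x)
        have "bracket x powr (- a) \<le> W x powr \<delta>"
          unfolding W_def powr_powr using b bracket_ge_1[of x] by (intro powr_mono) auto
        then have "norm (bracket_mult a (resolvent \<tau> f) x) \<le> W x powr \<delta> * norm (green_conv \<tau> f x)"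
          using elim by (simp add: bracket_mult_def norm_mult mult_right_mono)
        then show ?case using pq by (intro ennreal_leI powr_mono2) auto
      qed
    qed
    also have "\<dots> \<le> ennreal ((K powr \<delta> * (c * \<tau> powr (- s)) * Lp_norm p f) powr q)"
      using K c \<tau> by (intro green_conv_weighted_estimate[OF s pq ex _ _ _ _ _ _ f]) (auto simp: W_def)
    also have "K powr \<delta> * (c * \<tau> powr (- s)) * Lp_norm p f = K powr \<delta> * c * \<tau> powr (- s) * Lp_norm p f"
      by simp
    finally have *: "(\<integral>\<^sup>+x. ennreal (norm (bracket_mult a (resolvent \<tau> f) x) powr q) \<partial>lborel)
        \<le> ennreal ((K powr \<delta> * c * \<tau> powr (- s) * Lp_norm p f) powr q)" .
    have "bracket_mult a (resolvent \<tau> f) \<in> Lp q \<and>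
        Lp_norm q (bracket_mult a (resolvent \<tau> f)) \<le> K powr \<delta> * c * \<tau> powr (- s) * Lp_norm p f"
      using K c nonneg pq by (intro Lp_normI meas *) auto
    then show "bracket_mult a (resolvent \<tau> f) \<in> Lp q"
      "Lp_norm q (bracket_mult a (resolvent \<tau> f)) \<le> K powr \<delta> * c * \<tau> powr (- s) * Lp_norm p f" by auto
  qed
qed

lemma bracket_mult_Lp:
  assumes pq: "1 \<le> p" "1 \<le> q" "0 \<le> \<delta>" "1 / p = 1 / q + \<delta>" and b: "b > 2" "b * \<delta> \<le> a"
  shows "\<exists>C>0. \<forall>f\<in>Lp q. bracket_mult a f \<in> Lp p \<and> Lp_norm p (bracket_mult a f) \<le> C * Lp_norm q f"
proof -
  define W where "W x = bracket x powr (- b)" for x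
  have [measurable]: "W \<in> borel_measurable borel" unfolding W_def by measurable
  obtain K where K: "K > 0" "(\<integral>\<^sup>+x. ennreal (W x) \<partial>lborel) \<le> ennreal K"
    unfolding W_def by (rule nn_integral_bracket_powr_le[OF b(1)])
  show ?thesis
  proof (intro exI[of _ "K powr \<delta>"] conjI ballI)
    show "0 < K powr \<delta>" using K by simp
    fix f assume f: "f \<in> Lp q"
    have [measurable]: "f \<in> borel_measurable borel" using Lp_nn_integral[OF f] by auto
    define B where "B = (\<integral>x. norm (f x) powr q \<partial>lborel)"
    have B: "B \<ge> 0" "(\<integral>\<^sup>+x. ennreal (norm (f x) powr q) \<partial>lborel) = ennreal B"
      using Lp_nn_integral[OF f] by (auto simp: B_def)
    have "(\<integral>\<^sup>+x. ennreal (norm (bracket_mult a f x) powr p) \<partial>lborel)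
        \<le> (\<integral>\<^sup>+x. ennreal (W x powr (\<delta> * p) * (norm (f x) powr q) powr (p / q)) \<partial>lborel)"
    proof (rule nn_integral_mono)
      fix x
      have "bracket x powr (- a) \<le> W x powr \<delta>"
        unfolding W_def powr_powr using b bracket_ge_1[of x] by (intro powr_mono) auto
      then have "norm (bracket_mult a f x) \<le> W x powr \<delta> * norm (f x)"
        by (simp add: bracket_mult_def norm_mult mult_right_mono)
      then have "norm (bracket_mult a f x) powr p \<le> (W x powr \<delta> * norm (f x)) powr p"
        using pq by (intro powr_mono2) auto
      also have "\<dots> = W x powr (\<delta> * p) * (norm (f x) powr q) powr (p / q)"
        using pq by (simp add: powr_mult powr_powr)
      finally show "ennreal (norm (bracket_mult a f x) powr p)
        \<le> ennreal (W x powr (\<delta> * p) * (norm (f x) powr q) powr (p / q))" by (rule ennreal_leI)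
    qed
    also have "\<dots> \<le> ennreal (K powr (\<delta> * p) * B powr (p / q))"
    proof (rule nn_integral_Hoelder2)
      have "\<delta> * p + p / q = p * (1 / p)" unfolding pq(4) by (simp add: algebra_simps)
      also have "\<dots> = 1" using pq(1) by simp
      finally show "\<delta> * p + p / q = 1" .
    qed (use pq K B in \<open>auto simp: W_def\<close>)
    also have "K powr (\<delta> * p) * B powr (p / q) = (K powr \<delta> * Lp_norm q f) powr p"
      by (simp add: Lp_norm_def B_def powr_mult powr_powr)
    finally have "bracket_mult a f \<in> Lp p \<and> Lp_norm p (bracket_mult a f) \<le> K powr \<delta> * Lp_norm q f"
      using pq by (intro Lp_normI) (auto simp: bracket_mult_def Lp_norm_def)
    then show "bracket_mult a f \<in> Lp p" "Lp_norm p (bracket_mult a f) \<le> K powr \<delta> * Lp_norm q f" by auto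
  qed
qed

text \<open>The exponent \<open>b\<close> makes \<open>\<langle>x\<rangle>\<^sup>-\<^sup>b\<close> integrable while its power \<open>\<delta>\<close> still dominates \<open>\<langle>x\<rangle>\<^sup>-\<^sup>a\<close>; stated this
  way the estimates need not single out \<open>\<delta> = 0\<close>, where \<open>a/\<delta>\<close> makes no sense.\<close>

lemma weight_exponent_exists:
  fixes a \<delta> :: real
  assumes "a > 2 * \<delta>" "\<delta> \<ge> 0"
  obtains b where "b > 2" "b * \<delta> \<le> a"
proof (cases "\<delta> = 0")
  case True
  then show thesis using that[of 3] assms by simp
next
  case False
  then show thesis using that[of "a / \<delta>"] assms by (simp add: less_divide_eq)
qed

lemma bracket_mult_0: "bracket_mult 0 f = f"
  using bracket_pos by (auto simp: bracket_mult_def fun_eq_iff less_le)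

theorem lemma4p1:
  shows
    "(\<forall>q s0 k :: real. 1 < q \<and> 0 < s0 \<and> s0 \<le> 1 \<and> 1 / k = 1 / q + 1 - s0 \<and> 1 \<le> k \<longrightarrow>
        (\<exists>C>0. \<forall>\<tau>>0. \<forall>f \<in> Lp k.
           resolvent \<tau> f \<in> Lp q \<and>
           Lp_norm q (resolvent \<tau> f) \<le> C * \<tau> powr (- s0) * Lp_norm k f))
   \<and> (\<forall>q s0 a :: real. 1 < q \<and> 0 < s0 \<and> s0 \<le> 1 \<and> a > 2 * (1 - s0) \<and> 1 / q \<le> s0 \<longrightarrow>
        (\<exists>C>0. \<forall>\<tau>>0. \<forall>f \<in> Lp q.
           resolvent \<tau> (bracket_mult a f) \<in> Lp q \<and>
           Lp_norm q (resolvent \<tau> (bracket_mult a f)) \<le> C * \<tau> powr (- s0) * Lp_norm q f))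
   \<and> (\<forall>q s0 a :: real. 1 < q \<and> 0 < s0 \<and> s0 \<le> 1 \<and> a > 2 * (1 - s0) \<and> 1 - 1 / q \<le> s0 \<longrightarrow>
        (\<exists>C>0. \<forall>\<tau>>0. \<forall>f \<in> Lp q.
           bracket_mult a (resolvent \<tau> f) \<in> Lp q \<and>
           Lp_norm q (bracket_mult a (resolvent \<tau> f)) \<le> C * \<tau> powr (- s0) * Lp_norm q f))"
proof -
  have part1: "\<exists>C>0. \<forall>\<tau>>0. \<forall>f \<in> Lp k. resolvent \<tau> f \<in> Lp q \<and>
      Lp_norm q (resolvent \<tau> f) \<le> C * \<tau> powr (- s0) * Lp_norm k f"
    if "1 < q" "0 < s0" "s0 \<le> 1" "1 / k = 1 / q + 1 - s0" "1 \<le> k" for q s0 k :: real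
    \<comment> \<open>The weight is trivial here; \<open>3\<close> is an arbitrary number greater than \<open>2\<close>.\<close>
    using resolvent_weighted_estimate[of s0 k q "1 / q" 0 3 0] that by (simp add: bracket_mult_0)
  have part2: "\<exists>C>0. \<forall>\<tau>>0. \<forall>f \<in> Lp q. resolvent \<tau> (bracket_mult a f) \<in> Lp q \<and>
      Lp_norm q (resolvent \<tau> (bracket_mult a f)) \<le> C * \<tau> powr (- s0) * Lp_norm q f"
    if h: "1 < q" "0 < s0" "s0 \<le> 1" "a > 2 * (1 - s0)" "1 / q \<le> s0" for q s0 a :: real
  proof -
    define k where "k = 1 / (1 / q + (1 - s0))"
    have kpos: "1 / q + (1 - s0) > 0" using h by (intro add_pos_nonneg) auto
    have k: "1 / k = 1 / q + (1 - s0)" by (simp add: k_def)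
    have k1: "1 \<le> k" unfolding k_def using kpos h(5) by (subst pos_le_divide_eq) simp_all
    obtain b where b: "b > 2" "b * (1 - s0) \<le> a"
      by (rule weight_exponent_exists[OF h(4)]) (use h in auto)
    obtain C where C: "C > 0" "\<forall>\<tau>>0. \<forall>f \<in> Lp k. resolvent \<tau> f \<in> Lp q \<and>
        Lp_norm q (resolvent \<tau> f) \<le> C * \<tau> powr (- s0) * Lp_norm k f"
      using part1[of q s0 k] h(1-3) k k1 by (metis add_diff_eq)
    obtain D where D: "D > 0" "\<forall>f\<in>Lp q. bracket_mult a f \<in> Lp k \<and> Lp_norm k (bracket_mult a f) \<le> D * Lp_norm q f"
      using bracket_mult_Lp[OF k1 _ _ k b] h(1-3) by (metis diff_ge_0_iff_ge less_imp_le)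
    show ?thesis
    proof (intro exI[of _ "C * D"] conjI allI impI ballI)
      show "0 < C * D" using C D by simp
      fix \<tau> :: real and f assume \<tau>: "\<tau> > 0" and f: "f \<in> Lp q"
      show "resolvent \<tau> (bracket_mult a f) \<in> Lp q" using C D \<tau> f by blast
      have "Lp_norm q (resolvent \<tau> (bracket_mult a f)) \<le> C * \<tau> powr (- s0) * Lp_norm k (bracket_mult a f)"
        using C D \<tau> f by blast
      also have "\<dots> \<le> C * \<tau> powr (- s0) * (D * Lp_norm q f)"
        using C D f by (intro mult_left_mono) auto
      finally show "Lp_norm q (resolvent \<tau> (bracket_mult a f)) \<le> C * D * \<tau> powr (- s0) * Lp_norm q f"
        by (simp add: mult_ac)
    qed
  qed
  have part3: "\<exists>C>0. \<forall>\<tau>>0. \<forall>f \<in> Lp q. bracket_mult a (resolvent \<tau> f) \<in> Lp q \<and>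
      Lp_norm q (bracket_mult a (resolvent \<tau> f)) \<le> C * \<tau> powr (- s0) * Lp_norm q f"
    if h: "1 < q" "0 < s0" "s0 \<le> 1" "a > 2 * (1 - s0)" "1 - 1 / q \<le> s0" for q s0 a :: real
  proof -
    obtain b where "b > 2" "b * (1 - s0) \<le> a"
      by (rule weight_exponent_exists[OF h(4)]) (use h in auto)
    then show ?thesis
      using resolvent_weighted_estimate[of s0 q q "1 / q - (1 - s0)" "1 - s0" b a] h by simp
  qed
  show ?thesis
    by (intro conjI allI impI; elim conjE) (rule part1 part2 part3; assumption)+
qed

end
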